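(* Let $(M_n,S_n)_{n\ge0}$ be a Markov random walk with irreducible positive recurrent driving chain on a countable set $\mathcal S$, and let $\mu\in\mathbb R$. The following are equivalent: (a) $X_1$ is $\mathbb P_\pi$-integrable and $\mathbb E_\pi X_1=\mu$; (b) $n^{-1}S_n\to\mu$ a.s. and $\mathbb E_\pi X_1$ exists, i.e. $\mathbb E_\pi X_1^-<\infty$ or $\mathbb E_\pi X_1^+<\infty$; (c) $n^{-1}S_n^\ominus\to\mu^-$ and $n^{-1}S_n^\oplus\to\mu^+$ a.s. for some real $\mu^\pm$ with $\mu^+-\mu^-=\mu$; (d) for some (equivalently all) $i\in\mathcal S$: $\tau_n(i)^{-1}S^\ominus_{\tau_n(i)}\to\mu^-$ and $\tau_n(i)^{-1}S^\oplus_{\tau_n(i)}\to\mu^+$ $\mathbb P_i$-a.s. for some real $\mu^\pm$ with $\mu^+-\mu^-=\mu$; (e) for some (equivalently all) $i\in\mathcal S$: $S^\ominus_{\tau(i)}$ and $S^\oplus_{\tau(i)}$ are $\mathbb P_i$-integrable and $\mathbb E_iS_{\tau(i)}=\pi_i^{-1}\mu$; (f) $\mathbb E_\pi X_1$ exists and $\sum_{n\ge1}n^{-1}\mathbb P_i(|n^{-1}S_n-\mu|>\varepsilon)<\infty$ for all $\varepsilon>0$ and some (equivalently all) $i\in\mathcal S$.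
   Context: $\mathcal S$ countable; $(M_n)_{n\ge0}$ irreducible positive recurrent Markov chain on $\mathcal S$ with stationary distribution $\pi=(\pi_i)$. Markov random walk: $S_0=0$, $S_n=X_1+\dots+X_n$, the $X_n$ conditionally independent given $(M_n)$ with $\mathbb P((X_1,\dots,X_n)\in\cdot\mid M_0=i_0,\dots,M_n=i_n)=K_{i_0i_1}\otimes\cdots\otimes K_{i_{n-1}i_n}$ for a stochastic kernel $K$ from $\mathcal S^2$ to $\mathbb R$. $\mathbb P_i=\mathbb P(\cdot\mid M_0=i)$, $\mathbb P_\pi=\sum_i\pi_i\mathbb P_i$; "a.s." means $\mathbb P_i$-a.s. for all $i$. $S_n^\oplus=\sum_{k=1}^nX_k^+$, $S_n^\ominus=\sum_{k=1}^nX_k^-$. $\tau_0(i)=0$, $\tau(i)=\tau_1(i)=\inf\{n\ge1:M_n=i\}$, $\tau_n(i)$ the $n$-th return time to $i$. *)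

theory Defs
  imports "HOL-Probability.Probability"
begin

text \<open>Markov random walk on a countable state space (the type 's).
  P i = probability measure P_i (chain started in i), M n = M_n, X n = X_n,
  p = transition matrix of the driving chain, K i j = law of X_n given M_{n-1}=i, M_n=j.
  The defining property: joint law of (M_0,...,M_n,X_1,...,X_n) under P_i is
  delta_i(i_0) p(i_0,i_1)...p(i_{n-1},i_n) K_{i_0 i_1} x ... x K_{i_{n-1} i_n}.\<close>

definition MRW ::
  "('s::countable \<Rightarrow> 'w measure) \<Rightarrow> (nat \<Rightarrow> 'w \<Rightarrow> 's) \<Rightarrow> (nat \<Rightarrow> 'w \<Rightarrow> real)
   \<Rightarrow> ('s \<Rightarrow> 's \<Rightarrow> real) \<Rightarrow> ('s \<Rightarrow> 's \<Rightarrow> real measure) \<Rightarrow> bool" where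
  "MRW P M X p K \<longleftrightarrow>
     (\<forall>i. prob_space (P i)) \<and> (\<forall>i j. sets (P i) = sets (P j)) \<and>
     (\<forall>i n. M n \<in> measurable (P i) (count_space UNIV)) \<and>
     (\<forall>i n. X n \<in> borel_measurable (P i)) \<and>
     (\<forall>i j. 0 \<le> p i j) \<and> (\<forall>i. ((\<lambda>j. p i j) has_sum 1) UNIV) \<and>
     (\<forall>i j. prob_space (K i j) \<and> sets (K i j) = sets borel) \<and>
     (\<forall>i n (js :: nat \<Rightarrow> 's) (B :: nat \<Rightarrow> real set). (\<forall>k. B k \<in> sets borel) \<longrightarrow>
        measure (P i) {\<omega> \<in> space (P i). (\<forall>k\<le>n. M k \<omega> = js k) \<and> (\<forall>k\<in>{1..n}. X k \<omega> \<in> B k)}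
        = (if js 0 = i then 1 else 0) *
          (\<Prod>k\<in>{1..n}. p (js (k - 1)) (js k) * measure (K (js (k - 1)) (js k)) (B k)))"

fun ret_time :: "(nat \<Rightarrow> 'w \<Rightarrow> 's) \<Rightarrow> 's \<Rightarrow> nat \<Rightarrow> 'w \<Rightarrow> nat" where
  "ret_time M i 0 \<omega> = 0"
| "ret_time M i (Suc n) \<omega> = (LEAST m. m > ret_time M i n \<omega> \<and> M m \<omega> = i)"

abbreviation tau :: "(nat \<Rightarrow> 'w \<Rightarrow> 's) \<Rightarrow> 's \<Rightarrow> 'w \<Rightarrow> nat" where
  "tau M i \<equiv> ret_time M i 1"

definition irreducible_chain :: "('s \<Rightarrow> 'w measure) \<Rightarrow> (nat \<Rightarrow> 'w \<Rightarrow> 's) \<Rightarrow> bool" where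
  "irreducible_chain P M \<longleftrightarrow>
     (\<forall>i j. \<exists>n. measure (P i) {\<omega> \<in> space (P i). M n \<omega> = j} > 0)"

definition positive_recurrent :: "('s \<Rightarrow> 'w measure) \<Rightarrow> (nat \<Rightarrow> 'w \<Rightarrow> 's) \<Rightarrow> bool" where
  "positive_recurrent P M \<longleftrightarrow>
     (\<forall>i. (AE \<omega> in P i. \<exists>n\<ge>1. M n \<omega> = i) \<and>
          (\<integral>\<^sup>+ \<omega>. ennreal (real (tau M i \<omega>)) \<partial>P i) < \<infinity>)"

definition stationary_distribution :: "('s \<Rightarrow> 's \<Rightarrow> real) \<Rightarrow> ('s \<Rightarrow> real) \<Rightarrow> bool" where
  "stationary_distribution p \<pi> \<longleftrightarrow>
     (\<forall>i. 0 \<le> \<pi> i) \<and> (\<pi> has_sum 1) UNIV \<and>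
     (\<forall>j. ((\<lambda>i. \<pi> i * p i j) has_sum \<pi> j) UNIV)"

definition Ssum :: "(nat \<Rightarrow> 'w \<Rightarrow> real) \<Rightarrow> nat \<Rightarrow> 'w \<Rightarrow> real" where
  "Ssum X n \<omega> = (\<Sum>k=1..n. X k \<omega>)"

definition Splus :: "(nat \<Rightarrow> 'w \<Rightarrow> real) \<Rightarrow> nat \<Rightarrow> 'w \<Rightarrow> real" where
  "Splus X n \<omega> = (\<Sum>k=1..n. max (X k \<omega>) 0)"

definition Sminus :: "(nat \<Rightarrow> 'w \<Rightarrow> real) \<Rightarrow> nat \<Rightarrow> 'w \<Rightarrow> real" where
  "Sminus X n \<omega> = (\<Sum>k=1..n. max (- X k \<omega>) 0)"

text \<open>Integral of a nonnegative function w.r.t. P_pi = sum_i pi_i P_i.\<close>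
definition Epi_nn :: "('s \<Rightarrow> 'w measure) \<Rightarrow> ('s \<Rightarrow> real) \<Rightarrow> ('w \<Rightarrow> ennreal) \<Rightarrow> ennreal" where
  "Epi_nn P \<pi> f = (\<integral>\<^sup>+ i. ennreal (\<pi> i) * (\<integral>\<^sup>+ \<omega>. f \<omega> \<partial>P i) \<partial>count_space UNIV)"

abbreviation EposX1 where "EposX1 P \<pi> X \<equiv> Epi_nn P \<pi> (\<lambda>\<omega>. ennreal (max (X (1::nat) \<omega>) 0))"
abbreviation EnegX1 where "EnegX1 P \<pi> X \<equiv> Epi_nn P \<pi> (\<lambda>\<omega>. ennreal (max (- X (1::nat) \<omega>) 0))"

end

theory Submission
  imports Defs
begin

text \<open>Under \<open>P\<^sub>i\<close> the successive visits to \<open>i\<close> cut the walk into independent, identically distributed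
  cycles, and uniqueness of the invariant measure identifies the mean of the sum of
  \<open>v (X\<^sub>n)\<close> over one cycle, \<open>v \<ge> 0\<close>, as \<open>E\<^sub>\<pi> v(X\<^sub>1) / \<pi>\<^sub>i\<close>. If \<open>E\<^sub>\<pi> v(X\<^sub>1)\<close> is finite, truncation and Chebyshev's
  inequality bound the deviations of sums of cycles and of cycle lengths; since \<open>\<Sum>k\<le>n. v (X\<^sub>k)\<close> is
  nondecreasing in \<open>n\<close>, this transfers to deterministic times and gives
  \<open>\<Sum>n. n\<inverse> P\<^sub>i(\<bar>n\<inverse> \<Sum>k\<le>n. v (X\<^sub>k) - E\<^sub>\<pi> v(X\<^sub>1)\<bar> > \<epsilon>) < \<infinity>\<close>. For monotone processes that summability already
  implies almost sure convergence. Truncating \<open>v\<close> shows that the averages tend to infinity when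
  \<open>E\<^sub>\<pi> v(X\<^sub>1) = \<infinity>\<close>. Applying this to the positive and negative parts yields all the equivalences.\<close>

section \<open>Deviations of sums of pairwise independent variables\<close>

text \<open>An integrable \<open>Y \<ge> 0\<close> satisfies
  \<open>\<Sum>n. E (min Y n)^2 / n^2 < \<infinity>\<close>. This is just enough for series with
  weights \<open>1/n\<close>, and for monotone sums such series already give the strong law. One
  estimate thus serves both summability and almost sure convergence, and pairwise independence of
  the cycles suffices. The obstacle is that \<open>S_n\<close> is not monotone: inside a cycle it
  may go far away and come back, so information at cycle ends says nothing about a fixed time
  \<open>n\<close>. Hence everything is proved for sums of a nonnegative function of the increments,
  and \<open>S_n\<close> enters only as a difference of two such sums. In the converse directions
  the danger is infinity minus infinity. Conditions (c), (d), (e) bound each sign separately.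
  Conditions (b) and (f) see only the difference, and the existence of \<open>E_\<pi> X_1\<close> is
  what gives \<open>S_n / n\<close> a limit in the extended reals. If that limit is not
  \<open>\<mu>\<close>, the averages eventually stay a fixed distance away, and the divergence of
  the harmonic series refutes (f).\<close>

lemma sum_truncated_squares_le:
  fixes y :: real
  assumes y: "0 \<le> y"
  shows "(\<Sum>n<N. (min y (real n))\<^sup>2 / (real n)\<^sup>2) \<le> 6 * (1 + y)"
proof -
  \<comment> \<open>Each term is compared with the telescoping difference
    \<open>f n - f (Suc n)\<close>, which handles the terms equal to 1 (for
    \<open>n \<le> y\<close>) and the terms \<open>y^2 / n^2\<close> beyond in one sum. The factor 6
    comes from the range \<open>n > y\<close>, where \<open>n + y \<le> 2 n\<close> and
    \<open>n + 1 + y \<le> 3 n\<close>.\<close>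
  define f where "f n = 1 / (real n + y)" for n
  have step: "(min y (real n))\<^sup>2 / (real n)\<^sup>2 \<le> 6 * (1 + y)\<^sup>2 * (f n - f (Suc n))" if n: "n \<ge> 1" for n
  proof -
    have pos: "real n + y > 0" "real n + 1 + y > 0" "real n \<ge> 1" using n y by auto
    have fd: "f n - f (Suc n) = 1 / ((real n + y) * (real n + 1 + y))"
      using pos by (simp add: f_def field_simps)
    have key: "(min y (real n))\<^sup>2 * ((real n + y) * (real n + 1 + y)) \<le> 6 * (1 + y)\<^sup>2 * (real n)\<^sup>2"
    proof (cases "real n \<le> y")
      case True
      have "(real n + y) * (real n + 1 + y) \<le> (2 * (1 + y)) * (2 * (1 + y))"
        using True y by (intro mult_mono) auto
      also have "\<dots> = 4 * (1 + y)\<^sup>2" by (simp add: power2_eq_square algebra_simps)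
      also have "\<dots> \<le> 6 * (1 + y)\<^sup>2" by simp
      finally have "(real n)\<^sup>2 * ((real n + y) * (real n + 1 + y)) \<le> (real n)\<^sup>2 * (6 * (1 + y)\<^sup>2)"
        by (intro mult_left_mono) auto
      with True show ?thesis by (simp add: min_absorb2 mult.commute)
    next
      case False
      have "(real n + y) * (real n + 1 + y) \<le> (2 * real n) * (3 * real n)"
        using False y pos by (intro mult_mono; linarith)
      also have "\<dots> = 6 * (real n)\<^sup>2" by (simp add: power2_eq_square)
      finally have "y\<^sup>2 * ((real n + y) * (real n + 1 + y)) \<le> (1 + y)\<^sup>2 * (6 * (real n)\<^sup>2)"
        using y by (intro mult_mono[where b="(1 + y)\<^sup>2"] power_mono) auto
      with False show ?thesis by (simp add: min_def mult_ac)
    qed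
    show ?thesis unfolding fd using key pos by (simp add: divide_simps mult_ac)
  qed
  have "(\<Sum>n<N. (min y (real n))\<^sup>2 / (real n)\<^sup>2) \<le> (\<Sum>n<Suc N. (min y (real n))\<^sup>2 / (real n)\<^sup>2)"
    by (intro sum_mono2) auto
  also have "\<dots> = (\<Sum>n<N. (min y (real (Suc n)))\<^sup>2 / (real (Suc n))\<^sup>2)"
    by (subst sum.lessThan_Suc_shift) simp
  also have "\<dots> \<le> (\<Sum>n<N. 6 * (1 + y)\<^sup>2 * (f (Suc n) - f (Suc (Suc n))))"
    by (intro sum_mono step) auto
  also have "\<dots> = 6 * (1 + y)\<^sup>2 * (f (Suc 0) - f (Suc N))"
    using sum_lessThan_telescope'[of "\<lambda>n. f (Suc n)" N] by (simp add: sum_distrib_left[symmetric])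
  also have "\<dots> \<le> 6 * (1 + y)\<^sup>2 * (1 / (1 + y))"
    using y by (intro mult_left_mono) (auto simp: f_def)
  also have "\<dots> = 6 * (1 + y)" using y by (simp add: power2_eq_square)
  finally show ?thesis .
qed

context prob_space
begin

text \<open>Chebyshev's inequality; pairwise independence is enough because only covariances have to
  vanish. The bounded function \<open>g\<close> stands for a truncation and is kept abstract, since
  upper deviations need a level growing with \<open>n\<close> and lower deviations a fixed
  one.\<close>

lemma prob_sum_pairwise_indep_deviation_le:
  fixes Y :: "nat \<Rightarrow> 'a \<Rightarrow> real" and g :: "real \<Rightarrow> real"
  assumes Y[measurable]: "\<And>j. random_variable borel (Y j)"
    and ident: "\<And>j. distr M borel (Y j) = distr M borel (Y 0)"
    and indep: "\<And>j l. j \<noteq> l \<Longrightarrow> indep_var borel (Y j) borel (Y l)"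
    and g[measurable]: "g \<in> borel_measurable borel" and bound: "\<And>x. \<bar>g x\<bar> \<le> b"
    and t: "t > 0"
  shows "prob {\<omega> \<in> space M. \<bar>(\<Sum>j<k. g (Y j \<omega>)) - real k * expectation (\<lambda>\<omega>. g (Y 0 \<omega>))\<bar> \<ge> t}
           \<le> real k * expectation (\<lambda>\<omega>. (g (Y 0 \<omega>))\<^sup>2) / t\<^sup>2"
proof -
  define m where "m = expectation (\<lambda>\<omega>. g (Y 0 \<omega>))"
  define Z where "Z j \<omega> = g (Y j \<omega>) - m" for j \<omega>
  have same: "expectation (\<lambda>\<omega>. h (Y j \<omega>)) = expectation (\<lambda>\<omega>. h (Y 0 \<omega>))"
    if [measurable]: "h \<in> borel_measurable borel" for h :: "real \<Rightarrow> real" and j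
  proof -
    have "expectation (\<lambda>\<omega>. h (Y j \<omega>)) = (\<integral>x. h x \<partial>distr M borel (Y j))" for j
      by (subst integral_distr) auto
    then show ?thesis using ident by metis
  qed
  have Zm[measurable]: "random_variable borel (Z j)" for j unfolding Z_def by measurable
  have b0: "b \<ge> 0" using bound[of 0] by linarith
  have gint: "integrable M (\<lambda>\<omega>. g (Y j \<omega>))" for j
    by (rule integrable_const_bound[of _ b]) (use bound in auto)
  have Zb: "\<bar>Z j \<omega>\<bar> \<le> b + \<bar>m\<bar>" for j \<omega> unfolding Z_def using bound[of "Y j \<omega>"] by linarith
  have ZZint: "integrable M (\<lambda>\<omega>. Z j \<omega> * Z l \<omega>)" for j l
    by (rule integrable_const_bound[of _ "(b + \<bar>m\<bar>) * (b + \<bar>m\<bar>)"])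
       (auto simp: abs_mult b0 intro!: mult_mono Zb AE_I2)
  have Zint: "integrable M (Z j)" for j unfolding Z_def using gint by auto
  have Z0: "expectation (Z j) = 0" for j
    unfolding Z_def using gint[of j] same[of g j] by (simp add: prob_space m_def)
  have cross: "expectation (\<lambda>\<omega>. Z j \<omega> * Z l \<omega>) = 0" if "j \<noteq> l" for j l
  proof -
    have "indep_var borel ((\<lambda>x. g x - m) \<circ> Y j) borel ((\<lambda>x. g x - m) \<circ> Y l)"
      by (rule indep_var_compose[OF indep[OF that]]) auto
    then have "indep_var borel (Z j) borel (Z l)" unfolding Z_def comp_def .
    from indep_var_lebesgue_integral[OF this Zint Zint] show ?thesis by (simp add: Z0)
  qed
  have sq: "expectation (\<lambda>\<omega>. Z j \<omega> * Z j \<omega>) \<le> expectation (\<lambda>\<omega>. (g (Y 0 \<omega>))\<^sup>2)" for j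
  proof -
    have g2: "integrable M (\<lambda>\<omega>. (g (Y j \<omega>))\<^sup>2)"
      by (rule integrable_const_bound[of _ "b\<^sup>2"]) (auto simp: abs_le_square_iff[symmetric] bound b0 abs_of_nonneg)
    have "expectation (\<lambda>\<omega>. Z j \<omega> * Z j \<omega>)
        = expectation (\<lambda>\<omega>. (g (Y j \<omega>))\<^sup>2 - 2 * m * g (Y j \<omega>) + m\<^sup>2)"
      by (intro Bochner_Integration.integral_cong) (auto simp: Z_def power2_eq_square algebra_simps)
    also have "\<dots> = expectation (\<lambda>\<omega>. (g (Y j \<omega>))\<^sup>2) - 2 * m * expectation (\<lambda>\<omega>. g (Y j \<omega>)) + m\<^sup>2"
      using g2 gint[of j] by (simp add: prob_space)
    also have "\<dots> = expectation (\<lambda>\<omega>. (g (Y 0 \<omega>))\<^sup>2) - m\<^sup>2"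
      using same[of g j] same[of "\<lambda>x. (g x)\<^sup>2" j] by (simp add: m_def[symmetric] power2_eq_square)
    finally show ?thesis by simp
  qed
  define S where "S \<omega> = (\<Sum>j<k. Z j \<omega>)" for \<omega>
  have S2: "(S \<omega>)\<^sup>2 = (\<Sum>j<k. \<Sum>l<k. Z j \<omega> * Z l \<omega>)" for \<omega>
    unfolding S_def power2_eq_square by (simp add: sum_product)
  have S2int: "integrable M (\<lambda>\<omega>. (S \<omega>)\<^sup>2)" unfolding S2 using ZZint by auto
  have "expectation (\<lambda>\<omega>. (S \<omega>)\<^sup>2) = (\<Sum>j<k. \<Sum>l<k. expectation (\<lambda>\<omega>. Z j \<omega> * Z l \<omega>))"
    unfolding S2 using ZZint by (simp add: Bochner_Integration.integral_sum)
  also have "\<dots> = (\<Sum>j<k. expectation (\<lambda>\<omega>. Z j \<omega> * Z j \<omega>))"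
  proof (rule sum.cong)
    fix j assume "j \<in> {..<k}"
    then have "(\<Sum>l<k. expectation (\<lambda>\<omega>. Z j \<omega> * Z l \<omega>))
       = (\<Sum>l<k. if l = j then expectation (\<lambda>\<omega>. Z j \<omega> * Z j \<omega>) else 0)"
      by (intro sum.cong) (auto simp: cross)
    then show "(\<Sum>l<k. expectation (\<lambda>\<omega>. Z j \<omega> * Z l \<omega>)) = expectation (\<lambda>\<omega>. Z j \<omega> * Z j \<omega>)"
      using \<open>j \<in> _\<close> by simp
  qed simp
  also have "\<dots> \<le> real k * expectation (\<lambda>\<omega>. (g (Y 0 \<omega>))\<^sup>2)"
    using sum_bounded_above[of "{..<k}" "\<lambda>j. expectation (\<lambda>\<omega>. Z j \<omega> * Z j \<omega>)", OF sq] by simp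
  finally have E: "expectation (\<lambda>\<omega>. (S \<omega>)\<^sup>2) \<le> real k * expectation (\<lambda>\<omega>. (g (Y 0 \<omega>))\<^sup>2)" .
  have eq: "\<bar>(\<Sum>j<k. g (Y j \<omega>)) - real k * m\<bar> \<ge> t \<longleftrightarrow> (S \<omega>)\<^sup>2 \<ge> t\<^sup>2" for \<omega>
  proof -
    have "S \<omega> = (\<Sum>j<k. g (Y j \<omega>)) - real k * m"
      unfolding S_def Z_def by (simp add: sum_subtractf)
    then show ?thesis using t abs_le_square_iff[of t "S \<omega>"] by simp
  qed
  have [measurable]: "random_variable borel S" unfolding S_def by measurable
  have "prob {\<omega> \<in> space M. (S \<omega>)\<^sup>2 \<ge> t\<^sup>2} \<le> expectation (\<lambda>\<omega>. (S \<omega>)\<^sup>2) / t\<^sup>2"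
    by (rule integral_Markov_inequality_measure[where A="{}"]) (use S2int t in auto)
  also have "\<dots> \<le> real k * expectation (\<lambda>\<omega>. (g (Y 0 \<omega>))\<^sup>2) / t\<^sup>2"
    using E by (intro divide_right_mono) auto
  finally show ?thesis unfolding m_def[symmetric] eq .
qed

text \<open>The truncation level \<open>n\<close> in the \<open>n\<close>-th upper deviation is what makes a first moment suffice.\<close>

lemma summable_upper_deviations:
  fixes Y :: "nat \<Rightarrow> 'a \<Rightarrow> real" and k :: "nat \<Rightarrow> nat"
  assumes Y[measurable]: "\<And>j. random_variable borel (Y j)"
    and nonneg: "\<And>j \<omega>. 0 \<le> Y j \<omega>"
    and ident: "\<And>j. distr M borel (Y j) = distr M borel (Y 0)"
    and indep: "\<And>j l. j \<noteq> l \<Longrightarrow> indep_var borel (Y j) borel (Y l)"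
    and int: "integrable M (Y 0)"
    and k: "\<And>n. real (k n) \<le> c * real n" and \<epsilon>: "\<epsilon> > 0"
  shows "summable (\<lambda>n. 1 / real n *
    prob {\<omega> \<in> space M. (\<Sum>j<k n. Y j \<omega>) > real (k n) * expectation (Y 0) + \<epsilon> * real n})"
proof -
  \<comment> \<open>\<open>q n\<close> dominates both error terms: up to constants it is the
    Chebyshev bound for the variables cut at \<open>n\<close>, and it bounds \<open>P(Y > n)\<close>
    because \<open>min Y n / n = 1\<close> on that event.\<close>
  define q where "q n = expectation (\<lambda>\<omega>. (min (Y 0 \<omega>) (real n))\<^sup>2 / (real n)\<^sup>2)" for n
  have tint: "integrable M (\<lambda>\<omega>. (min (Y 0 \<omega>) (real n))\<^sup>2)" for n
    by (rule integrable_const_bound[of _ "(real n)\<^sup>2"]) (auto intro!: power_mono nonneg AE_I2)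
  have qint: "integrable M (\<lambda>\<omega>. (min (Y 0 \<omega>) (real n))\<^sup>2 / (real n)\<^sup>2)" for n
    using tint by simp
  have q0: "q n \<ge> 0" for n unfolding q_def by (intro integral_nonneg_AE) auto
  have qsum: "summable q"
  proof (rule summableI_nonneg_bounded[where x="expectation (\<lambda>\<omega>. 6 * (1 + Y 0 \<omega>))"])
    fix N
    have "sum q {..<N} = expectation (\<lambda>\<omega>. \<Sum>n<N. (min (Y 0 \<omega>) (real n))\<^sup>2 / (real n)\<^sup>2)"
      unfolding q_def using qint by simp
    also have "\<dots> \<le> expectation (\<lambda>\<omega>. 6 * (1 + Y 0 \<omega>))"
      using qint int by (intro integral_mono sum_truncated_squares_le nonneg) auto
    finally show "sum q {..<N} \<le> expectation (\<lambda>\<omega>. 6 * (1 + Y 0 \<omega>))" .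
  qed (rule q0)
  have c0: "c \<ge> 0" using k[of 1] by simp
  show ?thesis
  proof (rule summable_comparison_test'[where g="\<lambda>n. (c + c / \<epsilon>\<^sup>2) * q n" and N=1])
    show "summable (\<lambda>n. (c + c / \<epsilon>\<^sup>2) * q n)" using qsum by (rule summable_mult)
    fix n :: nat assume n: "1 \<le> n"
    \<comment> \<open>The outer \<open>max 0\<close> changes nothing on the nonnegative
      \<open>Y j\<close>; it makes the truncation bounded on the whole line, as the Chebyshev bound
      requires.\<close>
    let ?m = "expectation (Y 0)" and ?g = "\<lambda>x. max 0 (min x (real n))"
    let ?U = "{\<omega> \<in> space M. (\<Sum>j<k n. Y j \<omega>) > real (k n) * ?m + \<epsilon> * real n}"
    let ?V = "{\<omega> \<in> space M. \<bar>(\<Sum>j<k n. ?g (Y j \<omega>)) - real (k n) * expectation (\<lambda>\<omega>. ?g (Y 0 \<omega>))\<bar> \<ge> \<epsilon> * real n}"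
    let ?T = "\<lambda>j. {\<omega> \<in> space M. Y j \<omega> > real n}"
    have gY: "?g (Y j \<omega>) = min (Y j \<omega>) (real n)" for j \<omega> using nonneg[of j \<omega>] by simp
    have gm: "expectation (\<lambda>\<omega>. ?g (Y 0 \<omega>)) \<le> ?m"
      unfolding gY by (rule integral_mono) (use int nonneg in \<open>auto intro!: integrable_const_bound[of _ "real n"] AE_I2\<close>)
    have sub: "?U \<subseteq> ?V \<union> (\<Union>j<k n. ?T j)"
    proof
      fix \<omega> assume w: "\<omega> \<in> ?U"
      show "\<omega> \<in> ?V \<union> (\<Union>j<k n. ?T j)"
      proof (cases "\<exists>j<k n. Y j \<omega> > real n")
        case False
        then have "(\<Sum>j<k n. ?g (Y j \<omega>)) = (\<Sum>j<k n. Y j \<omega>)"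
          unfolding gY by (intro sum.cong refl min_absorb1) (metis lessThan_iff not_le_imp_less)
        moreover have "real (k n) * expectation (\<lambda>\<omega>. ?g (Y 0 \<omega>)) \<le> real (k n) * ?m"
          using gm by (intro mult_left_mono) auto
        ultimately have "\<omega> \<in> ?V" using w by auto
        then show ?thesis by blast
      qed (use w in auto)
    qed
    have "prob ?U \<le> prob (?V \<union> (\<Union>j<k n. ?T j))" by (rule finite_measure_mono[OF sub]) measurable
    also have "\<dots> \<le> prob ?V + prob (\<Union>j<k n. ?T j)" by (rule measure_Un_le) measurable
    also have "prob (\<Union>j<k n. ?T j) \<le> (\<Sum>j<k n. prob (?T j))"
      by (rule finite_measure_subadditive_finite) auto
    also have "(\<Sum>j<k n. prob (?T j)) = real (k n) * prob (?T 0)"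
    proof -
      have "prob (?T j) = measure (distr M borel (Y j)) {real n<..}" for j
        by (subst measure_distr) (auto intro!: arg_cong[where f=prob])
      then have T: "prob (?T j) = prob (?T 0)" for j using ident by metis
      show ?thesis by (subst sum.cong[OF refl T]) simp
    qed
    also have "prob ?V \<le> real (k n) * expectation (\<lambda>\<omega>. (?g (Y 0 \<omega>))\<^sup>2) / (\<epsilon> * real n)\<^sup>2"
      by (rule prob_sum_pairwise_indep_deviation_le[where b="real n"])
         (use indep \<epsilon> n ident in auto)
    also have "expectation (\<lambda>\<omega>. (?g (Y 0 \<omega>))\<^sup>2) = (real n)\<^sup>2 * q n"
      unfolding gY q_def using n by simp
    also have "real (k n) * ((real n)\<^sup>2 * q n) / (\<epsilon> * real n)\<^sup>2 = real (k n) * q n / \<epsilon>\<^sup>2"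
      using n by (simp add: power_mult_distrib)
    also have "prob (?T 0) \<le> q n"
    proof -
      have "prob (?T 0) = expectation (indicator (?T 0))" by simp
      also have "\<dots> \<le> q n" unfolding q_def
      proof (rule integral_mono[OF _ qint])
        show "integrable M (indicator (?T 0) :: _ \<Rightarrow> real)"
          by (rule integrable_const_bound[of _ 1]) (auto simp: indicator_def)
      qed (use n in \<open>auto simp: indicator_def min_def\<close>)
      finally show ?thesis .
    qed
    finally have "prob ?U \<le> real (k n) * q n / \<epsilon>\<^sup>2 + real (k n) * q n"
      by (simp add: mult_left_mono)
    also have "\<dots> = real (k n) * ((1 + 1 / \<epsilon>\<^sup>2) * q n)" by (simp add: algebra_simps)
    also have "\<dots> \<le> (c * real n) * ((1 + 1 / \<epsilon>\<^sup>2) * q n)"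
      using q0 by (intro mult_right_mono k) auto
    finally have "prob ?U \<le> (c + c / \<epsilon>\<^sup>2) * q n * real n" by (simp add: algebra_simps)
    then show "norm (1 / real n * prob ?U) \<le> (c + c / \<epsilon>\<^sup>2) * q n"
      using n by (simp add: divide_simps)
  qed
qed

text \<open>Truncation lowers the sum, so a lower deviation survives it without any exceptional
  event, and a fixed level \<open>b\<close> suffices once it loses little of the mean. For bounded
  variables Chebyshev gives probabilities of order \<open>1/n\<close>, hence a series of order
  \<open>1/n^2\<close>.\<close>

lemma summable_lower_deviations:
  fixes Y :: "nat \<Rightarrow> 'a \<Rightarrow> real" and k :: "nat \<Rightarrow> nat"
  assumes Y[measurable]: "\<And>j. random_variable borel (Y j)"
    and nonneg: "\<And>j \<omega>. 0 \<le> Y j \<omega>"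
    and ident: "\<And>j. distr M borel (Y j) = distr M borel (Y 0)"
    and indep: "\<And>j l. j \<noteq> l \<Longrightarrow> indep_var borel (Y j) borel (Y l)"
    and int: "integrable M (Y 0)"
    and k: "\<And>n. real (k n) \<le> c * real n" and \<epsilon>: "\<epsilon> > 0"
  shows "summable (\<lambda>n. 1 / real n *
    prob {\<omega> \<in> space M. (\<Sum>j<k n. Y j \<omega>) < real (k n) * expectation (Y 0) - \<epsilon> * real n})"
proof -
  have c0: "c \<ge> 0" using k[of 1] by simp
  have "(\<lambda>b. expectation (\<lambda>\<omega>. min (Y 0 \<omega>) (real b))) \<longlonglongrightarrow> expectation (Y 0)"
  proof (rule integral_dominated_convergence[where w="Y 0"])
    show "AE \<omega> in M. (\<lambda>b. min (Y 0 \<omega>) (real b)) \<longlonglongrightarrow> Y 0 \<omega>"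
    proof (intro AE_I2 tendsto_eventually)
      fix \<omega>
      show "\<forall>\<^sub>F b in sequentially. min (Y 0 \<omega>) (real b) = Y 0 \<omega>"
        using eventually_ge_at_top[of "nat \<lceil>Y 0 \<omega>\<rceil>"] by eventually_elim linarith
    qed
  qed (use int nonneg in auto)
  \<comment> \<open>A loss of \<open>\<epsilon> / (2 * (c + 1))\<close> per variable adds up to at
    most \<open>\<epsilon> / 2 * n\<close> over \<open>k n \<le> c * n\<close> variables;
    \<open>c + 1\<close> guards against \<open>c = 0\<close>.\<close>
  moreover have "expectation (Y 0) - \<epsilon> / (2 * (c + 1)) < expectation (Y 0)" using \<epsilon> c0 by simp
  ultimately have "\<forall>\<^sub>F b in sequentially. expectation (\<lambda>\<omega>. min (Y 0 \<omega>) (real b)) > expectation (Y 0) - \<epsilon> / (2 * (c + 1))"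
    by (rule order_tendstoD)
  then obtain b where b: "expectation (\<lambda>\<omega>. min (Y 0 \<omega>) (real b)) > expectation (Y 0) - \<epsilon> / (2 * (c + 1))"
    by (meson eventually_sequentially le_refl)
  let ?g = "\<lambda>x. max 0 (min x (real b))"
  have gY: "?g (Y j \<omega>) = min (Y j \<omega>) (real b)" for j \<omega> using nonneg[of j \<omega>] by simp
  define D where "D = expectation (\<lambda>\<omega>. (?g (Y 0 \<omega>))\<^sup>2)"
  show ?thesis
  proof (rule summable_comparison_test'[where g="\<lambda>n. (4 * c * D / \<epsilon>\<^sup>2) * (1 / (real n)\<^sup>2)" and N=1])
    show "summable (\<lambda>n. (4 * c * D / \<epsilon>\<^sup>2) * (1 / (real n)\<^sup>2))"
      by (intro summable_mult) (use inverse_power_summable[of 2, where 'a=real] in \<open>simp add: field_simps\<close>)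
    fix n :: nat assume n: "1 \<le> n"
    let ?m = "expectation (Y 0)"
    let ?U = "{\<omega> \<in> space M. (\<Sum>j<k n. Y j \<omega>) < real (k n) * ?m - \<epsilon> * real n}"
    let ?V = "{\<omega> \<in> space M. \<bar>(\<Sum>j<k n. ?g (Y j \<omega>)) - real (k n) * expectation (\<lambda>\<omega>. ?g (Y 0 \<omega>))\<bar> \<ge> \<epsilon> / 2 * real n}"
    have km: "real (k n) * ?m - real (k n) * expectation (\<lambda>\<omega>. ?g (Y 0 \<omega>)) \<le> \<epsilon> / 2 * real n"
    proof -
      have "real (k n) * (?m - expectation (\<lambda>\<omega>. ?g (Y 0 \<omega>))) \<le> real (k n) * (\<epsilon> / (2 * (c + 1)))"
        using b unfolding gY by (intro mult_left_mono) auto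
      also have "\<dots> \<le> (c * real n) * (\<epsilon> / (2 * (c + 1)))"
        using k \<epsilon> c0 by (intro mult_right_mono) auto
      also have "\<dots> = (c / (c + 1)) * (\<epsilon> / 2 * real n)" using c0 by (simp add: field_simps)
      also have "\<dots> \<le> 1 * (\<epsilon> / 2 * real n)" using c0 \<epsilon> by (intro mult_right_mono) auto
      finally show ?thesis by (simp add: algebra_simps)
    qed
    have sub: "?U \<subseteq> ?V"
    proof
      fix \<omega> assume w: "\<omega> \<in> ?U"
      have "(\<Sum>j<k n. ?g (Y j \<omega>)) \<le> (\<Sum>j<k n. Y j \<omega>)" unfolding gY by (intro sum_mono) auto
      then have "real (k n) * expectation (\<lambda>\<omega>. ?g (Y 0 \<omega>)) - (\<Sum>j<k n. ?g (Y j \<omega>)) \<ge> \<epsilon> / 2 * real n"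
        using w km by simp
      then have "\<bar>(\<Sum>j<k n. ?g (Y j \<omega>)) - real (k n) * expectation (\<lambda>\<omega>. ?g (Y 0 \<omega>))\<bar> \<ge> \<epsilon> / 2 * real n"
        by linarith
      then show "\<omega> \<in> ?V" using w by blast
    qed
    have "prob ?U \<le> prob ?V" by (rule finite_measure_mono[OF sub]) measurable
    also have "\<dots> \<le> real (k n) * D / (\<epsilon> / 2 * real n)\<^sup>2"
      unfolding D_def by (rule prob_sum_pairwise_indep_deviation_le[where b="real b"])
         (use indep \<epsilon> n ident in auto)
    also have "\<dots> \<le> (c * real n) * D / (\<epsilon> / 2 * real n)\<^sup>2"
      by (intro divide_right_mono mult_right_mono k) (auto simp: D_def)
    also have "\<dots> = (4 * c * D / \<epsilon>\<^sup>2) * (1 / (real n)\<^sup>2) * real n"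
      using n by (simp add: power2_eq_square field_simps)
    finally have "1 / real n * prob ?U \<le> (4 * c * D / \<epsilon>\<^sup>2) * (1 / (real n)\<^sup>2)"
      using n pos_divide_le_eq[of "real n" "prob ?U"] by simp
    then show "norm (1 / real n * prob ?U) \<le> (4 * c * D / \<epsilon>\<^sup>2) * (1 / (real n)\<^sup>2)"
      by simp
  qed
qed

text \<open>A weighted first Borel-Cantelli lemma: the random series has a finite expectation, hence
  is finite almost surely.\<close>

lemma AE_summable_weighted_indicator:
  fixes E :: "nat \<Rightarrow> 'a set"
  assumes [measurable]: "\<And>n. E n \<in> events" and sum: "summable (\<lambda>n. 1 / real n * prob (E n))"
  shows "AE \<omega> in M. summable (\<lambda>n. 1 / real n * indicator (E n) \<omega> :: real)"
proof -
  have "(\<integral>\<^sup>+\<omega>. (\<Sum>n. ennreal (1 / real n * indicator (E n) \<omega>)) \<partial>M)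
      = (\<Sum>n. \<integral>\<^sup>+\<omega>. ennreal (1 / real n * indicator (E n) \<omega>) \<partial>M)"
    by (rule nn_integral_suminf) measurable
  also have "\<dots> = (\<Sum>n. ennreal (1 / real n * prob (E n)))"
  proof (rule suminf_cong)
    fix n
    have "ennreal (1 / real n * indicator (E n) \<omega>) = ennreal (1 / real n) * indicator (E n) \<omega>" for \<omega>
      by (simp add: indicator_def)
    then have "(\<integral>\<^sup>+\<omega>. ennreal (1 / real n * indicator (E n) \<omega>) \<partial>M) = ennreal (1 / real n) * emeasure M (E n)"
      by (simp add: nn_integral_cmult_indicator)
    then show "(\<integral>\<^sup>+\<omega>. ennreal (1 / real n * indicator (E n) \<omega>) \<partial>M) = ennreal (1 / real n * prob (E n))"
      by (simp only: emeasure_eq_measure) (subst ennreal_mult, auto)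
  qed
  also have "\<dots> < \<infinity>"
    using sum by (simp add: suminf_ennreal2 less_top[symmetric])
  finally have "AE \<omega> in M. (\<Sum>n. ennreal (1 / real n * indicator (E n) \<omega>)) \<noteq> \<infinity>"
    by (intro nn_integral_PInf_AE) auto
  then show ?thesis
    by eventually_elim (auto intro!: summable_suminf_not_top)
qed

end

text \<open>If \<open>a n / n\<close> is off by \<open>2\<epsilon>\<close> at some \<open>n\<close>, monotonicity keeps it off by \<open>\<epsilon>\<close> on an adjacent block
  of at least \<open>\<eta> n\<close> indices, whose total weight \<open>\<Sum> 1/j\<close> is bounded below.\<close>

lemma mono_ratio_tendsto:
  fixes a :: "nat \<Rightarrow> real"
  assumes mono: "mono a" and a0: "\<And>n. 0 \<le> a n" and m: "0 \<le> m"
    and sum: "\<And>\<epsilon>. \<epsilon> > 0 \<Longrightarrow> summable (\<lambda>n. 1 / real n * of_bool (\<bar>a n / real n - m\<bar> > \<epsilon>))"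
  shows "(\<lambda>n. a n / real n) \<longlonglongrightarrow> m"
proof (rule LIMSEQ_I)
  fix r :: real assume "r > 0"
  \<comment> \<open>Of the deviation \<open>3 * \<epsilon>\<close> at \<open>n\<close>, one
    \<open>\<epsilon>\<close> is the deviation still required on the block, one is lost while moving
    along the block, and the last keeps the inequalities strict.\<close>
  define \<epsilon> where "\<epsilon> = r / 3"
  have \<epsilon>: "\<epsilon> > 0" using \<open>r > 0\<close> by (simp add: \<epsilon>_def)
  \<comment> \<open>The second bound limits the drift of the threshold over a relative distance
    \<open>\<eta>\<close>, since \<open>(m + \<epsilon>) * \<eta> \<le> \<epsilon>\<close>; the
    bound \<open>1/2\<close> keeps the blocks between \<open>n / 2\<close> and
    \<open>2 * n\<close>.\<close>
  define \<eta> where "\<eta> = min (1/2) (\<epsilon> / (m + \<epsilon> + 1))"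
  have \<eta>: "\<eta> > 0" "\<eta> \<le> 1/2" "(m + \<epsilon>) * \<eta> \<le> \<epsilon>"
  proof -
    show "\<eta> > 0" "\<eta> \<le> 1/2" using \<epsilon> m by (simp_all only: \<eta>_def min.cobounded1) auto
    have "(m + \<epsilon>) * \<eta> \<le> (m + \<epsilon>) * (\<epsilon> / (m + \<epsilon> + 1))"
      using \<epsilon> m by (intro mult_left_mono) (auto simp: \<eta>_def)
    also have "\<dots> = ((m + \<epsilon>) / (m + \<epsilon> + 1)) * \<epsilon>" by simp
    also have "\<dots> \<le> 1 * \<epsilon>" using \<epsilon> m by (intro mult_right_mono) auto
    finally show "(m + \<epsilon>) * \<eta> \<le> \<epsilon>" by simp
  qed
  define f where "f n = 1 / real n * of_bool (\<bar>a n / real n - m\<bar> > \<epsilon>)" for n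
  have f0: "f n \<ge> 0" for n by (simp add: f_def)
  have "summable f" unfolding f_def by (rule sum[OF \<epsilon>])
  then obtain N where N: "\<And>p q. p \<ge> N \<Longrightarrow> norm (sum f {p..<q}) < \<eta> / 2"
    using \<eta> unfolding summable_Cauchy by (meson half_gt_zero)
  \<comment> \<open>At least \<open>\<eta> * t\<close> indices below \<open>2 * t\<close>, each of
    weight at least \<open>1 / (2 * t)\<close>, have total weight at least
    \<open>\<eta> / 2\<close>, against the Cauchy bound for tails beyond \<open>N\<close>.\<close>
  have block: False if "p \<ge> N" "p \<ge> 1" and len: "real q - real p \<ge> \<eta> * t" and q: "real q \<le> 2 * t"
      and t: "t > 0" and off: "\<And>j. p \<le> j \<Longrightarrow> j < q \<Longrightarrow> \<bar>a j / real j - m\<bar> > \<epsilon>" for p q t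
  proof -
    have "\<eta> / 2 = (\<eta> * t) * (1 / (2 * t))" using t by simp
    also have "\<dots> \<le> (real q - real p) * (1 / (2 * t))" using len t by (intro mult_right_mono) auto
    also have "\<dots> = (\<Sum>j\<in>{p..<q}. 1 / (2 * t))"
    proof -
      have "0 \<le> \<eta> * t" using t \<eta> by simp
      then have "p \<le> q" using len by linarith
      then show ?thesis by (simp add: of_nat_diff)
    qed
    also have "\<dots> \<le> sum f {p..<q}"
    proof (rule sum_mono)
      fix j assume j: "j \<in> {p..<q}"
      then have "0 < real j" "real j \<le> 2 * t" using q \<open>p \<ge> 1\<close> by auto
      then have "1 / (2 * t) \<le> 1 / real j" using t by (intro divide_left_mono) auto
      also have "\<dots> = f j" using off[of j] j by (simp add: f_def)
      finally show "1 / (2 * t) \<le> f j" .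
    qed
    also have "\<dots> < \<eta> / 2" using N[OF \<open>p \<ge> N\<close>, of q] by simp
    finally show False by simp
  qed
  show "\<exists>no. \<forall>n\<ge>no. norm (a n / real n - m) < r"
  proof (intro exI allI impI)
    \<comment> \<open>The block used in the case \<open>down\<close> begins at some
      \<open>p \<ge> n / 2\<close>; this choice gives \<open>p \<ge> N\<close> and
      \<open>p \<ge> 1\<close>.\<close>
    fix n assume n: "n \<ge> 2 * N + 2"
    have n0: "real n > 0" using n by simp
    show "norm (a n / real n - m) < r"
    proof (rule ccontr)
      assume "\<not> ?thesis"
      then consider (up) "a n / real n \<ge> m + 3 * \<epsilon>" | (down) "a n / real n \<le> m - 3 * \<epsilon>"
        unfolding \<epsilon>_def real_norm_def by linarith
      then show False
      proof cases
        case up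
        \<comment> \<open>The final \<open>+ 1\<close> compensates the floor, so that the half-open
          block from \<open>n\<close> to \<open>q\<close> has at least \<open>\<eta> * n\<close>
          elements.\<close>
        define q where "q = n + nat \<lfloor>\<eta> * real n\<rfloor> + 1"
        have "real (nat \<lfloor>\<eta> * real n\<rfloor>) \<le> \<eta> * real n" "\<eta> * real n < real (nat \<lfloor>\<eta> * real n\<rfloor>) + 1"
          using \<eta> n0 by (auto simp: zero_le_mult_iff)
        then have q: "real q \<le> real n + \<eta> * real n + 1" "real q \<ge> real n + \<eta> * real n" unfolding q_def of_nat_add by linarith+
        have q2: "real q \<le> 2 * real n"
        proof -
          have "\<eta> * real n \<le> real n / 2" using mult_right_mono[OF \<eta>(2), of "real n"] n0 by simp
          moreover have "real n \<ge> 2" using n by linarith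
          ultimately show ?thesis using q(1) by linarith
        qed
        show False
        proof (rule block[where p=n and q=q and t="real n"])
          fix j assume j: "n \<le> j" "j < q"
          have j': "real j \<le> (1 + \<eta>) * real n" "real j > 0"
            using j \<open>real (nat \<lfloor>\<eta> * real n\<rfloor>) \<le> \<eta> * real n\<close> n0 unfolding q_def by (auto simp: algebra_simps)
          have "(m + \<epsilon>) * real j \<le> (m + \<epsilon>) * ((1 + \<eta>) * real n)"
            using j' m \<epsilon> by (intro mult_left_mono) auto
          also have "\<dots> = ((m + \<epsilon>) + (m + \<epsilon>) * \<eta>) * real n" by (simp add: algebra_simps)
          also have "\<dots> < (m + 3 * \<epsilon>) * real n" using \<eta> \<epsilon> n0 by (intro mult_strict_right_mono) auto
          also have "\<dots> \<le> a n" using up n0 by (simp add: field_simps)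
          also have "\<dots> \<le> a j" using mono j by (auto dest: monoD)
          finally have "a j / real j > m + \<epsilon>" using j' by (simp add: field_simps)
          then show "\<bar>a j / real j - m\<bar> > \<epsilon>" by simp
        qed (use n n0 q q2 in auto)
      next
        case down
        define p where "p = n - nat \<lfloor>\<eta> * real n\<rfloor>"
        have fl: "real (nat \<lfloor>\<eta> * real n\<rfloor>) \<le> \<eta> * real n" "\<eta> * real n < real (nat \<lfloor>\<eta> * real n\<rfloor>) + 1"
          using \<eta> n0 by (auto simp: zero_le_mult_iff)
        have half: "\<eta> * real n \<le> real n / 2" using mult_right_mono[OF \<eta>(2), of "real n"] n0 by simp
        have p: "real p = real n - real (nat \<lfloor>\<eta> * real n\<rfloor>)"
          unfolding p_def using fl half n0 by (subst of_nat_diff) linarith+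
        have pN: "p \<ge> N" "p \<ge> 1" using p fl half n by linarith+
        have len: "real (Suc n) - real p \<ge> \<eta> * real n" using p fl by linarith
        show False
        proof (rule block[where p=p and q="Suc n" and t="real n"])
          fix j assume j: "p \<le> j" "j < Suc n"
          have j': "real j \<ge> (1 - \<eta>) * real n" "real j > 0"
            using j p fl pN by (auto simp: algebra_simps)
          have "a j \<le> a n" using j by (intro monoD[OF mono]) simp
          also have "\<dots> \<le> (m - 3 * \<epsilon>) * real n" using down n0 by (simp add: field_simps)
          also have "\<dots> < (m - \<epsilon>) * real j"
          \<comment> \<open>If \<open>m - \<epsilon>\<close> is negative, lowering \<open>j\<close>
            no longer lowers the threshold; but then \<open>down\<close> would force
            \<open>a n < 0\<close>, which is impossible.\<close>
          proof (cases "m - \<epsilon> \<ge> 0")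
            case True
            have "(m - 3 * \<epsilon>) * real n < ((m - \<epsilon>) - (m - \<epsilon>) * \<eta>) * real n"
            proof (intro mult_strict_right_mono n0)
              have "(m - \<epsilon>) * \<eta> \<le> (m + \<epsilon>) * \<eta>" using \<epsilon> \<eta> by (intro mult_right_mono) auto
              then show "m - 3 * \<epsilon> < (m - \<epsilon>) - (m - \<epsilon>) * \<eta>" using \<eta> \<epsilon> by linarith
            qed
            also have "\<dots> = (m - \<epsilon>) * ((1 - \<eta>) * real n)" by (simp add: algebra_simps)
            also have "\<dots> \<le> (m - \<epsilon>) * real j" using True j' by (intro mult_left_mono) auto
            finally show ?thesis .
          next
            case False
            then have "m - 3 * \<epsilon> < 0" using \<epsilon> by simp
            then have "(m - 3 * \<epsilon>) * real n < 0" using n0 by (simp add: mult_neg_pos)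
            moreover have "(m - 3 * \<epsilon>) * real n \<ge> a n" using down n0 by (simp add: field_simps)
            ultimately show ?thesis using a0[of n] by linarith
          qed
          finally have "a j / real j < m - \<epsilon>" using j' by (simp add: field_simps)
          then show "\<bar>a j / real j - m\<bar> > \<epsilon>" by simp
        qed (use n n0 len pN in auto)
      qed
    qed
  qed
qed

text \<open>The thresholds \<open>1 / Suc k\<close> produce a single null set. A larger threshold
  has a smaller indicator series, so off that set the pathwise criterion holds for every
  \<open>\<epsilon>\<close>.\<close>

lemma (in prob_space) AE_mono_ratio_tendsto:
  fixes A :: "nat \<Rightarrow> 'a \<Rightarrow> real"
  assumes [measurable]: "\<And>n. random_variable borel (A n)"
    and mono: "\<And>\<omega>. mono (\<lambda>n. A n \<omega>)" and A0: "\<And>n \<omega>. 0 \<le> A n \<omega>" and m: "0 \<le> m"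
    and sum: "\<And>\<epsilon>. \<epsilon> > 0 \<Longrightarrow> summable (\<lambda>n. 1 / real n * prob {\<omega> \<in> space M. \<bar>A n \<omega> / real n - m\<bar> > \<epsilon>})"
  shows "AE \<omega> in M. (\<lambda>n. A n \<omega> / real n) \<longlonglongrightarrow> m"
proof -
  let ?E = "\<lambda>e n. {\<omega> \<in> space M. \<bar>A n \<omega> / real n - m\<bar> > e}"
  have "AE \<omega> in M. \<forall>k. summable (\<lambda>n. 1 / real n * indicator (?E (1 / real (Suc k)) n) \<omega> :: real)"
    unfolding AE_all_countable by (intro allI AE_summable_weighted_indicator sum) auto
  with AE_space show ?thesis
  proof eventually_elim
    case (elim \<omega>)
    show ?case
    proof (rule mono_ratio_tendsto[OF mono A0 m])
      fix \<epsilon> :: real assume "\<epsilon> > 0"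
      then obtain k where k: "1 / real (Suc k) < \<epsilon>" using nat_approx_posE by blast
      show "summable (\<lambda>n. 1 / real n * of_bool (\<bar>A n \<omega> / real n - m\<bar> > \<epsilon>))"
      proof (rule summable_comparison_test'[OF spec[OF elim(2), of k], where N=0])
        fix n show "norm (1 / real n * of_bool (\<bar>A n \<omega> / real n - m\<bar> > \<epsilon>))
          \<le> 1 / real n * indicator (?E (1 / real (Suc k)) n) \<omega>"
          using k elim(1) by (auto simp: indicator_def)
      qed
    qed
  qed
qed

lemma (in prob_space) indep_varI_prob:
  assumes X: "random_variable S X" and Y: "random_variable T Y"
    and eq: "\<And>A B. A \<in> sets S \<Longrightarrow> B \<in> sets T \<Longrightarrow>
      prob {\<omega> \<in> space M. X \<omega> \<in> A \<and> Y \<omega> \<in> B} = prob {\<omega> \<in> space M. X \<omega> \<in> A} * prob {\<omega> \<in> space M. Y \<omega> \<in> B}"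
  shows "indep_var S X T Y"
proof -
  have stable: "Int_stable {Z -` A \<inter> space M |A. A \<in> sets N}" for Z :: "'a \<Rightarrow> 'z" and N
  proof (rule Int_stableI)
    fix a b assume "a \<in> {Z -` A \<inter> space M |A. A \<in> sets N}" "b \<in> {Z -` A \<inter> space M |A. A \<in> sets N}"
    then obtain A B where "A \<in> sets N" "B \<in> sets N" "a = Z -` A \<inter> space M" "b = Z -` B \<inter> space M" by auto
    then show "a \<inter> b \<in> {Z -` A \<inter> space M |A. A \<in> sets N}"
      by (intro CollectI exI[of _ "A \<inter> B"]) auto
  qed
  show ?thesis unfolding indep_var_eq
  proof (intro conjI indep_set_sigma_sets stable X Y)
    show "indep_set {X -` A \<inter> space M |A. A \<in> sets S} {Y -` A \<inter> space M |A. A \<in> sets T}"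
    proof (safe intro!: indep_setI)
      fix A B assume "A \<in> sets S" "B \<in> sets T"
      from eq[OF this] show "prob ((X -` A \<inter> space M) \<inter> (Y -` B \<inter> space M))
          = prob (X -` A \<inter> space M) * prob (Y -` B \<inter> space M)"
        by (simp add: vimage_def Int_def conj_ac)
    qed (use X Y in \<open>auto intro: measurable_sets\<close>)
  qed
qed

text \<open>Otherwise the weighted indicator series would converge almost surely, although it agrees
  from some index on with the harmonic series. This is how the summability condition of the theorem
  gets refuted.\<close>

lemma (in prob_space) not_summable_weighted_prob:
  assumes [measurable]: "\<And>n. E n \<in> events" and ev: "AE \<omega> in M. \<forall>\<^sub>F n in sequentially. \<omega> \<in> E n"
  shows "\<not> summable (\<lambda>n. 1 / real n * prob (E n))"
proof
  assume "summable (\<lambda>n. 1 / real n * prob (E n))"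
  from AE_summable_weighted_indicator[OF assms(1) this] ev have "AE \<omega> in M. False"
  proof eventually_elim
    case (elim \<omega>)
    from elim(2) have "\<forall>\<^sub>F n in sequentially. 1 / real n * indicator (E n) \<omega> = inverse (real n)"
      by eventually_elim (simp add: field_simps)
    from summable_cong[OF this] elim(1) show False
      using not_summable_harmonic[where 'a=real] by simp
  qed
  then show False by simp
qed

section \<open>Trajectories and the Markov property\<close>

text \<open>Trajectories are sequences of pairs \<open>(M\<^sub>k, X\<^sub>k)\<close>. Cylinders constrain \<open>M\<^sub>0, \<dots>, M\<^sub>n\<close> and
  \<open>X\<^sub>1, \<dots>, X\<^sub>n\<close> only, so the variable \<open>X\<^sub>0\<close>, whose law is unspecified, is invisible to the
  \<open>\<sigma>\<close>-algebras below.\<close>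

definition cyl :: "nat \<Rightarrow> (nat \<Rightarrow> 's) \<Rightarrow> (nat \<Rightarrow> real set) \<Rightarrow> (nat \<Rightarrow> 's \<times> real) set" where
  "cyl n js B = {w. (\<forall>k\<le>n. fst (w k) = js k) \<and> (\<forall>k\<in>{1..n}. snd (w k) \<in> B k)}"

text \<open>The empty set is added for closure under intersection: two cylinders with incompatible
  state prefixes are disjoint.\<close>

definition cyls :: "nat \<Rightarrow> (nat \<Rightarrow> 's \<times> real) set set" where
  "cyls n = insert {} {cyl n js B | js B. \<forall>k. B k \<in> sets borel}"

text \<open>The past up to time \<open>n\<close> is a sub-sigma-algebra on full trajectories, not a
  space of finite words, so that past and future events concern the same points.\<close>

definition hist_space :: "nat \<Rightarrow> (nat \<Rightarrow> 's \<times> real) measure" where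
  "hist_space n = sigma UNIV (cyls n)"

definition traj_space :: "(nat \<Rightarrow> 's \<times> real) measure" where
  "traj_space = sigma UNIV (\<Union>n. cyls n)"

definition shift :: "nat \<Rightarrow> (nat \<Rightarrow> 'b) \<Rightarrow> nat \<Rightarrow> 'b" where
  "shift m w = (\<lambda>k. w (m + k))"

lemma sets_hist_space: "sets (hist_space n) = sigma_sets UNIV (cyls n)"
  and space_hist_space[simp]: "space (hist_space n) = UNIV"
  by (auto simp: hist_space_def sets_measure_of space_measure_of_conv)

lemma sets_traj_space: "sets traj_space = sigma_sets UNIV (\<Union>n. cyls n)"
  and space_traj_space[simp]: "space traj_space = UNIV"
  by (auto simp: traj_space_def sets_measure_of space_measure_of_conv)

lemma sets_hist_le_traj: "sets (hist_space n) \<subseteq> sets traj_space"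
  unfolding sets_hist_space sets_traj_space by (rule sigma_sets_mono') auto

lemma measurable_hist_traj: "f \<in> measurable (hist_space n) N \<Longrightarrow> f \<in> measurable traj_space N"
  using sets_hist_le_traj[of n] by (auto simp: measurable_def)

lemma cyl_in_cyls: "(\<And>k. B k \<in> sets borel) \<Longrightarrow> cyl n js B \<in> cyls n"
  by (auto simp: cyls_def)

lemma cyl_in_hist: "(\<And>k. B k \<in> sets borel) \<Longrightarrow> cyl n js B \<in> sets (hist_space n)"
  unfolding sets_hist_space by (intro sigma_sets.Basic cyl_in_cyls)

lemma countable_prefixes: "countable (Pi\<^sub>E {..n::nat} (\<lambda>_. UNIV :: 's::countable set))"
  by (intro countable_PiE) auto

text \<open>Every cylinder pins down all states up to \<open>n\<close>; leaving states free amounts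
  to a union over prefixes. Using extensional functions as prefixes makes this union
  countable.\<close>

lemma cyl_Un_prefixes:
  "{w. (\<forall>k\<in>{1..n}. snd (w k) \<in> B k) \<and> Q (restrict (\<lambda>k. fst (w k)) {..n})}
     = (\<Union>js\<in>{js \<in> Pi\<^sub>E {..n} (\<lambda>_. UNIV). Q js}. cyl n js B)" (is "?L = ?R")
proof
  show "?L \<subseteq> ?R"
  proof
    fix w assume "w \<in> ?L"
    then have "restrict (\<lambda>k. fst (w k)) {..n} \<in> {js \<in> Pi\<^sub>E {..n} (\<lambda>_. UNIV). Q js}"
      "w \<in> cyl n (restrict (\<lambda>k. fst (w k)) {..n}) B" by (auto simp: cyl_def)
    then show "w \<in> ?R" by blast
  qed
  show "?R \<subseteq> ?L"
  proof
    fix w assume "w \<in> ?R"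
    then obtain js where js: "js \<in> Pi\<^sub>E {..n} (\<lambda>_. UNIV)" "Q js" "w \<in> cyl n js B" by auto
    then have "restrict (\<lambda>k. fst (w k)) {..n} = js"
      by (auto simp: cyl_def PiE_def extensional_def restrict_def fun_eq_iff)
    with js show "w \<in> ?L" by (auto simp: cyl_def)
  qed
qed

lemma measurable_hist_fst:
  assumes "k \<le> n"
  shows "(\<lambda>w. fst (w k) :: 's::countable) \<in> measurable (hist_space n) (count_space UNIV)"
proof -
  have "(\<lambda>w. fst (w k)) -` {a} \<in> sets (hist_space n)" for a :: 's
  proof -
    have "(\<lambda>w. fst (w k)) -` {a} = {w. (\<forall>k\<in>{1..n}. snd (w k) \<in> (UNIV :: real set)) \<and>
        (\<lambda>js. js k = a) (restrict (\<lambda>k. fst (w k)) {..n})}"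
      using assms by auto
    also have "\<dots> = (\<Union>js\<in>{js \<in> Pi\<^sub>E {..n} (\<lambda>_. UNIV). js k = a}. cyl n js (\<lambda>_. UNIV))"
      by (rule cyl_Un_prefixes)
    also have "\<dots> \<in> sets (hist_space n)"
      by (intro sets.countable_UN'' cyl_in_hist countable_subset[OF _ countable_prefixes[of n]]) auto
    finally show ?thesis .
  qed
  then show ?thesis by (subst measurable_count_space_eq_countable) auto
qed

lemma measurable_hist_snd:
  assumes "1 \<le> k" "k \<le> n"
  shows "(\<lambda>w :: nat \<Rightarrow> 's::countable \<times> real. snd (w k)) \<in> borel_measurable (hist_space n)"
proof (rule measurableI)
  fix B :: "real set" assume B: "B \<in> sets borel"
  let ?B = "(\<lambda>_. UNIV)(k := B)"
  have "(\<lambda>w :: nat \<Rightarrow> 's \<times> real. snd (w k)) -` B \<inter> space (hist_space n)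
      = {w. (\<forall>l\<in>{1..n}. snd (w l) \<in> ?B l) \<and> (\<lambda>js. True) (restrict (\<lambda>k. fst (w k)) {..n})}"
    using assms by auto
  also have "\<dots> = (\<Union>js\<in>{js \<in> Pi\<^sub>E {..n} (\<lambda>_. UNIV). True}. cyl n js ?B)"
    by (rule cyl_Un_prefixes)
  also have "\<dots> \<in> sets (hist_space n)"
    using B by (intro sets.countable_UN'' cyl_in_hist countable_subset[OF _ countable_prefixes[of n]]) auto
  finally show "(\<lambda>w :: nat \<Rightarrow> 's \<times> real. snd (w k)) -` B \<inter> space (hist_space n) \<in> sets (hist_space n)" .
qed auto

lemma measurable_traj_fst[measurable]:
  "(\<lambda>w. fst (w k) :: 's::countable) \<in> measurable traj_space (count_space UNIV)"
  by (rule measurable_hist_traj[OF measurable_hist_fst[OF order_refl]])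

lemma measurable_traj_snd[measurable]:
  "(\<lambda>w :: nat \<Rightarrow> 's::countable \<times> real. snd (w (Suc k))) \<in> borel_measurable traj_space"
  by (rule measurable_hist_traj[OF measurable_hist_snd[of "Suc k" "Suc k"]]) auto

lemma cyl_Int:
  assumes "m \<le> n"
  shows "cyl m js B \<inter> cyl n js' B' =
    (if \<forall>k\<le>m. js k = js' k then cyl n js' (\<lambda>k. if k \<le> m then B k \<inter> B' k else B' k) else {})"
  using assms by (auto simp: cyl_def)

lemma cyls_Int:
  fixes A C :: "(nat \<Rightarrow> 's \<times> real) set"
  assumes "m \<le> n" "A \<in> cyls m" "C \<in> cyls n"
  shows "A \<inter> C \<in> cyls n"
proof (cases "A = {} \<or> C = {}")
  case True then show ?thesis by (auto simp: cyls_def)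
next
  case False
  with assms obtain js B js' B' where *: "A = cyl m js B" "C = cyl n js' B'"
    "\<forall>k. B k \<in> sets borel" "\<forall>k. B' k \<in> sets borel" by (auto simp: cyls_def)
  show ?thesis unfolding * cyl_Int[OF assms(1)] using *(3,4)
    by (auto intro!: cyl_in_cyls) (auto simp: cyls_def)
qed

lemma Int_stable_cyls: "Int_stable (cyls n)"
  by (auto simp: Int_stable_def intro: cyls_Int[OF order_refl])

lemma Int_stable_Un_cyls: "Int_stable (\<Union>n. cyls n :: (nat \<Rightarrow> 's \<times> real) set set)"
proof (rule Int_stableI)
  fix A C :: "(nat \<Rightarrow> 's \<times> real) set" assume "A \<in> (\<Union>n. cyls n)" "C \<in> (\<Union>n. cyls n)"
  then obtain m n where mn: "A \<in> cyls m" "C \<in> cyls n" by auto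
  show "A \<inter> C \<in> (\<Union>n. cyls n)"
  proof (cases "m \<le> n")
    case True then show ?thesis using cyls_Int[OF True mn] by blast
  next
    case False then show ?thesis using cyls_Int[of n m C A] mn by (metis Int_commute UN_I UNIV_I nat_le_linear)
  qed
qed

text \<open>The whole space is in general not a cylinder, so the uniqueness theorem is fed a
  countable cover by the cylinders with free increments, one for each state prefix of length
  \<open>n\<close>.\<close>

lemma measure_eqI_cylinders:
  fixes N1 N2 :: "(nat \<Rightarrow> 's::countable \<times> real) measure"
  assumes "sets N1 = sigma_sets UNIV E" "sets N2 = sigma_sets UNIV E" "Int_stable E" "cyls n \<subseteq> E"
    and "\<And>A. A \<in> E \<Longrightarrow> emeasure N1 A = emeasure N2 A" and "finite_measure N1"
  shows "N1 = N2"
proof (rule measure_eqI_generator_eq_countable[where \<Omega>=UNIV and E=E and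
    A="(\<lambda>js. cyl n js (\<lambda>_. UNIV)) ` Pi\<^sub>E {..n} (\<lambda>_. UNIV)"])
  show "(\<lambda>js. cyl n js (\<lambda>_. UNIV)) ` Pi\<^sub>E {..n} (\<lambda>_. UNIV) \<subseteq> E"
    using assms(4) by (auto intro!: cyl_in_cyls subsetD[OF assms(4)])
  have "(\<Union>js\<in>{js \<in> Pi\<^sub>E {..n} (\<lambda>_. UNIV). True}. cyl n js (\<lambda>_. UNIV))
      = (UNIV :: (nat \<Rightarrow> 's \<times> real) set)"
    by (subst cyl_Un_prefixes[symmetric]) auto
  then show "\<Union> ((\<lambda>js. cyl n js (\<lambda>_. UNIV)) ` Pi\<^sub>E {..n} (\<lambda>_. UNIV)) = (UNIV :: (nat \<Rightarrow> 's \<times> real) set)"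
    by simp
  show "countable ((\<lambda>js. cyl n js (\<lambda>_. UNIV)) ` Pi\<^sub>E {..n} (\<lambda>_. UNIV :: 's set))"
    by (intro countable_image countable_prefixes)
  show "emeasure N1 a \<noteq> \<infinity>" for a using finite_measure.emeasure_finite[OF assms(6)] by simp
qed (use assms in auto)

section \<open>The Markov property on trajectory space\<close>

locale markov_random_walk =
  fixes P :: "'s::countable \<Rightarrow> 'w measure" and M :: "nat \<Rightarrow> 'w \<Rightarrow> 's"
    and X :: "nat \<Rightarrow> 'w \<Rightarrow> real" and p :: "'s \<Rightarrow> 's \<Rightarrow> real"
    and K :: "'s \<Rightarrow> 's \<Rightarrow> real measure"
  assumes mrw: "MRW P M X p K"
begin

definition traj :: "'w \<Rightarrow> nat \<Rightarrow> 's \<times> real" where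
  "traj \<omega> = (\<lambda>k. (M k \<omega>, X k \<omega>))"

lemma prob_space_P: "prob_space (P i)"
  and M_measurable[measurable]: "M n \<in> measurable (P i) (count_space UNIV)"
  and X_measurable[measurable]: "X n \<in> borel_measurable (P i)"
  and p_nonneg: "0 \<le> p i j"
  and prob_space_K: "prob_space (K i j)" and sets_K: "sets (K i j) = sets borel"
proof -
  have "\<forall>i. prob_space (P i)" "\<forall>i n. M n \<in> measurable (P i) (count_space UNIV)"
    "\<forall>i n. X n \<in> borel_measurable (P i)" "\<forall>i j. 0 \<le> p i j"
    "\<forall>i j. prob_space (K i j) \<and> sets (K i j) = sets borel"
    using mrw unfolding MRW_def by - (elim conjE, assumption)+
  then show "prob_space (P i)" "M n \<in> measurable (P i) (count_space UNIV)" "X n \<in> borel_measurable (P i)"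
    "0 \<le> p i j" "prob_space (K i j)" "sets (K i j) = sets borel"
    by simp_all
qed

sublocale prob_space "P i" for i by (rule prob_space_P)

lemma prob_cyl:
  assumes "\<And>k. B k \<in> sets borel"
  shows "measure (P i) {\<omega> \<in> space (P i). traj \<omega> \<in> cyl n js B} = (if js 0 = i then 1 else 0) *
          (\<Prod>k\<in>{1..n}. p (js (k - 1)) (js k) * measure (K (js (k - 1)) (js k)) (B k))"
proof -
  have "\<forall>i n (js :: nat \<Rightarrow> 's) (B :: nat \<Rightarrow> real set). (\<forall>k. B k \<in> sets borel) \<longrightarrow>
        measure (P i) {\<omega> \<in> space (P i). (\<forall>k\<le>n. M k \<omega> = js k) \<and> (\<forall>k\<in>{1..n}. X k \<omega> \<in> B k)}
        = (if js 0 = i then 1 else 0) *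
          (\<Prod>k\<in>{1..n}. p (js (k - 1)) (js k) * measure (K (js (k - 1)) (js k)) (B k))"
    using mrw unfolding MRW_def by - (elim conjE, assumption)
  then show ?thesis using assms unfolding cyl_def traj_def by simp
qed

lemma traj_measurable[measurable]: "traj \<in> measurable (P i) traj_space"
  unfolding traj_space_def
proof (rule measurable_measure_of)
  fix A :: "(nat \<Rightarrow> 's \<times> real) set" assume "A \<in> (\<Union>n. cyls n)"
  then consider "A = {}" | n js B where "A = cyl n js B" "\<forall>k. B k \<in> sets borel" by (auto simp: cyls_def)
  then show "traj -` A \<inter> space (P i) \<in> sets (P i)"
  proof cases
    case 2
    then have [measurable]: "B k \<in> sets borel" for k by auto
    have "traj -` A \<inter> space (P i) =
      {\<omega> \<in> space (P i). (\<forall>k\<in>{..n}. M k \<omega> = js k) \<and> (\<forall>k\<in>{1..n}. X k \<omega> \<in> B k)}"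
      unfolding 2 cyl_def traj_def by auto
    then show ?thesis by simp
  qed auto
qed auto

lemma shift_traj_measurable[measurable]: "(\<lambda>\<omega>. shift m (traj \<omega>)) \<in> measurable (P i) traj_space"
  unfolding traj_space_def
proof (rule measurable_measure_of)
  fix A :: "(nat \<Rightarrow> 's \<times> real) set" assume "A \<in> (\<Union>n. cyls n)"
  then consider "A = {}" | n js B where "A = cyl n js B" "\<forall>k. B k \<in> sets borel" by (auto simp: cyls_def)
  then show "(\<lambda>\<omega>. shift m (traj \<omega>)) -` A \<inter> space (P i) \<in> sets (P i)"
  proof cases
    case 2
    then have [measurable]: "B k \<in> sets borel" for k by auto
    have "(\<lambda>\<omega>. shift m (traj \<omega>)) -` A \<inter> space (P i) =
      {\<omega> \<in> space (P i). (\<forall>k\<in>{..n}. M (m + k) \<omega> = js k) \<and> (\<forall>k\<in>{1..n}. X (m + k) \<omega> \<in> B k)}"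
      unfolding 2 cyl_def traj_def shift_def by auto
    then show ?thesis by simp
  qed auto
qed auto

lemma hist_event: "A \<in> sets (hist_space m) \<Longrightarrow> {\<omega> \<in> space (P i). traj \<omega> \<in> A} \<in> sets (P i)"
  using measurable_sets[OF traj_measurable, of A i] sets_hist_le_traj[of m]
  by (auto simp: vimage_def Int_def conj_commute)

lemma traj_event: "C \<in> sets traj_space \<Longrightarrow> {\<omega> \<in> space (P i). traj \<omega> \<in> C} \<in> sets (P i)"
  using measurable_sets[OF traj_measurable, of C i] by (auto simp: vimage_def Int_def conj_commute)

lemma shift_event: "C \<in> sets traj_space \<Longrightarrow> {\<omega> \<in> space (P i). shift m (traj \<omega>) \<in> C} \<in> sets (P i)"
  using measurable_sets[OF shift_traj_measurable, of C m i] by (auto simp: vimage_def Int_def conj_commute)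

text \<open>If the prescribed states disagree with \<open>j\<close> at the junction, both sides
  vanish. Otherwise the two prescriptions glue to one cylinder of length \<open>m + n\<close>, whose
  product weight splits at \<open>m\<close>.\<close>

lemma markov_cyl_cyl:
  assumes B: "\<And>k. B k \<in> sets borel" and B': "\<And>k. B' k \<in> sets borel"
  shows "measure (P i) {\<omega> \<in> space (P i). traj \<omega> \<in> cyl m js B \<and> M m \<omega> = j \<and> shift m (traj \<omega>) \<in> cyl n js' B'}
    = measure (P i) {\<omega> \<in> space (P i). traj \<omega> \<in> cyl m js B \<and> M m \<omega> = j}
        * measure (P j) {\<omega> \<in> space (P j). traj \<omega> \<in> cyl n js' B'}"
proof (cases "js m = j \<and> js' 0 = j")
  case False
  then have "{\<omega> \<in> space (P i). traj \<omega> \<in> cyl m js B \<and> M m \<omega> = j \<and> shift m (traj \<omega>) \<in> cyl n js' B'} = {}"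
    by (auto simp: cyl_def traj_def shift_def)
  moreover have "{\<omega> \<in> space (P i). traj \<omega> \<in> cyl m js B \<and> M m \<omega> = j} = {}
      \<or> measure (P j) {\<omega> \<in> space (P j). traj \<omega> \<in> cyl n js' B'} = 0"
    using False prob_cyl[OF B', of j n js'] by (auto simp: cyl_def traj_def)
  ultimately show ?thesis by (metis (no_types, lifting) measure_empty mult_zero_left mult_zero_right)
next
  case True
  \<comment> \<open>Time \<open>m\<close> belongs to both pieces and is read from the first; the
    agreement \<open>js m = js' 0\<close> makes \<open>js2 (m + k) = js' k\<close> true for
    \<open>k = 0\<close> as well. The set \<open>B' 0\<close> constrains nothing.\<close>
  define js2 where "js2 k = (if k \<le> m then js k else js' (k - m))" for k
  define B2 where "B2 k = (if k \<le> m then B k else B' (k - m))" for k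
  have js2': "js2 (m + k) = js' k" for k using True by (auto simp: js2_def)
  have e1: "{\<omega> \<in> space (P i). traj \<omega> \<in> cyl m js B \<and> M m \<omega> = j \<and> shift m (traj \<omega>) \<in> cyl n js' B'}
      = {\<omega> \<in> space (P i). traj \<omega> \<in> cyl (m + n) js2 B2}" (is "?L = ?R")
  proof
    show "?L \<subseteq> ?R"
    proof safe
      fix \<omega> assume w: "traj \<omega> \<in> cyl m js B" "shift m (traj \<omega>) \<in> cyl n js' B'"
      show "traj \<omega> \<in> cyl (m + n) js2 B2"
        unfolding cyl_def
      proof (safe)
        fix k assume k: "k \<le> m + n"
        show "fst (traj \<omega> k) = js2 k"
        proof (cases "k \<le> m")
          case True then show ?thesis using w(1) by (simp add: cyl_def js2_def)
        next
          case False
          then have "k - m \<le> n" "m + (k - m) = k" using k by auto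
          moreover from this have "fst (shift m (traj \<omega>) (k - m)) = js' (k - m)"
            using w(2) by (simp add: cyl_def)
          ultimately show ?thesis using False by (simp add: js2_def shift_def)
        qed
      next
        fix k assume k: "k \<in> {1..m+n}"
        show "snd (traj \<omega> k) \<in> B2 k"
        proof (cases "k \<le> m")
          case True then show ?thesis using w(1) k by (simp add: cyl_def B2_def)
        next
          case False
          then have "k - m \<in> {1..n}" "m + (k - m) = k" using k by auto
          moreover from this have "snd (shift m (traj \<omega>) (k - m)) \<in> B' (k - m)"
            using w(2) by (simp add: cyl_def)
          ultimately show ?thesis using False by (simp add: B2_def shift_def)
        qed
      qed
    qed
    show "?R \<subseteq> ?L"
    proof safe
      fix \<omega> assume w: "traj \<omega> \<in> cyl (m + n) js2 B2"
      have f: "fst (traj \<omega> k) = js2 k" if "k \<le> m + n" for k using w that by (auto simp: cyl_def)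
      have s: "snd (traj \<omega> k) \<in> B2 k" if "k \<ge> 1" "k \<le> m + n" for k using w that by (auto simp: cyl_def)
      show "traj \<omega> \<in> cyl m js B" unfolding cyl_def
      proof safe
        fix k assume "k \<le> m" then show "fst (traj \<omega> k) = js k" using f[of k] by (simp add: js2_def)
      next
        fix k assume "k \<in> {1..m}" then show "snd (traj \<omega> k) \<in> B k" using s[of k] by (simp add: B2_def)
      qed
      show "M m \<omega> = j" using f[of m] True by (simp add: traj_def js2_def)
      show "shift m (traj \<omega>) \<in> cyl n js' B'" unfolding cyl_def shift_def
      proof safe
        fix k assume "k \<le> n" then show "fst (traj \<omega> (m + k)) = js' k" using f[of "m + k"] js2' by simp
      next
        fix k assume "k \<in> {1..n}" then show "snd (traj \<omega> (m + k)) \<in> B' k"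
          using s[of "m + k"] by (auto simp: B2_def split: if_splits)
      qed
    qed
  qed
  have e2: "{\<omega> \<in> space (P i). traj \<omega> \<in> cyl m js B \<and> M m \<omega> = j} = {\<omega> \<in> space (P i). traj \<omega> \<in> cyl m js B}"
    using True by (auto simp: cyl_def traj_def)
  define F where "F k = p (js2 (k - 1)) (js2 k) * measure (K (js2 (k - 1)) (js2 k)) (B2 k)" for k
  have "prod F {1..m+n} = prod F {1..m} * prod F {m+1..m+n}"
    by (rule prod.ub_add_nat) simp
  also have "prod F {m+1..m+n} = prod (\<lambda>k. F (k + m)) {1..n}"
    using prod.shift_bounds_cl_nat_ivl[of F 1 m n] by (simp add: add.commute)
  also have "\<dots> = (\<Prod>k\<in>{1..n}. p (js' (k - 1)) (js' k) * measure (K (js' (k - 1)) (js' k)) (B' k))"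
  proof (rule prod.cong[OF refl])
    fix k assume k: "k \<in> {1..n}"
    then have "k + m - 1 = m + (k - 1)" "k + m = m + k" by auto
    then have "js2 (k + m - 1) = js' (k - 1)" "js2 (k + m) = js' k" "B2 (k + m) = B' k"
      using js2'[of k] js2'[of "k - 1"] k by (simp_all only:) (auto simp: B2_def)
    then show "F (k + m) = p (js' (k - 1)) (js' k) * measure (K (js' (k - 1)) (js' k)) (B' k)"
      by (simp add: F_def)
  qed
  also have "prod F {1..m} = (\<Prod>k\<in>{1..m}. p (js (k - 1)) (js k) * measure (K (js (k - 1)) (js k)) (B k))"
    by (rule prod.cong) (auto simp: F_def js2_def B2_def)
  finally have pr: "prod F {1..m+n} =
     (\<Prod>k\<in>{1..m}. p (js (k - 1)) (js k) * measure (K (js (k - 1)) (js k)) (B k)) *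
     (\<Prod>k\<in>{1..n}. p (js' (k - 1)) (js' k) * measure (K (js' (k - 1)) (js' k)) (B' k))" .
  have B2: "B2 k \<in> sets borel" for k using B B' by (simp add: B2_def)
  have j0: "js2 0 = js 0" by (simp add: js2_def)
  have "js' 0 = j" using True by simp
  then show ?thesis
    unfolding e1 e2 prob_cyl[OF B2] prob_cyl[OF B] prob_cyl[OF B'] F_def[symmetric] pr j0
    by (simp only: refl if_True mult.assoc mult_1_left)
qed

lemma markov_cyl:
  assumes A: "A \<in> cyls m" and C: "C \<in> cyls n"
  shows "emeasure (P i) {\<omega> \<in> space (P i). traj \<omega> \<in> A \<and> M m \<omega> = j \<and> shift m (traj \<omega>) \<in> C}
    = emeasure (P i) {\<omega> \<in> space (P i). traj \<omega> \<in> A \<and> M m \<omega> = j}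
        * emeasure (P j) {\<omega> \<in> space (P j). traj \<omega> \<in> C}"
proof (cases "A = {} \<or> C = {}")
  case False
  with A C obtain js B js' B' where *: "A = cyl m js B" "C = cyl n js' B'"
    "\<And>k. B k \<in> sets borel" "\<And>k. B' k \<in> sets borel" by (auto simp: cyls_def)
  show ?thesis unfolding *(1,2) emeasure_eq_measure
    using markov_cyl_cyl[where B=B and B'=B', OF *(3,4)] by (simp add: ennreal_mult'[symmetric])
qed auto

text \<open>Two uniqueness arguments. For a cylinder \<open>A\<close> both sides are finite measures
  in \<open>C\<close> that agree on cylinders; then, with \<open>C\<close> fixed, both are finite
  measures in \<open>A\<close> on the history space that agree on cylinders.\<close>

lemma markov_property:
  assumes A: "A \<in> sets (hist_space m)" and C: "C \<in> sets traj_space"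
  shows "emeasure (P i) {\<omega> \<in> space (P i). traj \<omega> \<in> A \<and> M m \<omega> = j \<and> shift m (traj \<omega>) \<in> C}
    = emeasure (P i) {\<omega> \<in> space (P i). traj \<omega> \<in> A \<and> M m \<omega> = j}
        * emeasure (P j) {\<omega> \<in> space (P j). traj \<omega> \<in> C}"
proof -
  have step: "emeasure (P i) {\<omega> \<in> space (P i). traj \<omega> \<in> A \<and> M m \<omega> = j \<and> shift m (traj \<omega>) \<in> C}
    = emeasure (P i) {\<omega> \<in> space (P i). traj \<omega> \<in> A \<and> M m \<omega> = j}
        * emeasure (P j) {\<omega> \<in> space (P j). traj \<omega> \<in> C}"
    if A: "A \<in> cyls m" and C: "C \<in> sets traj_space" for A C
  proof -
    have "A \<in> sets (hist_space m)" using A by (auto simp: sets_hist_space)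
    note [measurable] = hist_event[OF this]
    let ?D = "{\<omega> \<in> space (P i). traj \<omega> \<in> A} \<inter> {\<omega> \<in> space (P i). M m \<omega> = j}"
    let ?N1 = "distr (density (P i) (indicator ?D)) traj_space (\<lambda>\<omega>. shift m (traj \<omega>))"
    let ?N2 = "scale_measure (emeasure (P i) ?D) (distr (P j) traj_space traj)"
    have D: "?D \<in> sets (P i)" by measurable
    have N1: "emeasure ?N1 C = emeasure (P i) {\<omega> \<in> space (P i). traj \<omega> \<in> A \<and> M m \<omega> = j \<and> shift m (traj \<omega>) \<in> C}"
      if "C \<in> sets traj_space" for C
    proof -
      have "emeasure ?N1 C = emeasure (density (P i) (indicator ?D)) ({\<omega> \<in> space (P i). shift m (traj \<omega>) \<in> C})"
        using that by (subst emeasure_distr) (auto intro!: arg_cong[where f="emeasure _"])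
      also have "\<dots> = emeasure (P i) (?D \<inter> {\<omega> \<in> space (P i). shift m (traj \<omega>) \<in> C})"
        by (rule emeasure_restricted[OF D shift_event[OF that]])
      finally show ?thesis by (auto intro!: arg_cong[where f="emeasure _"])
    qed
    have N2: "emeasure ?N2 C = emeasure (P i) {\<omega> \<in> space (P i). traj \<omega> \<in> A \<and> M m \<omega> = j}
        * emeasure (P j) {\<omega> \<in> space (P j). traj \<omega> \<in> C}" if "C \<in> sets traj_space" for C
    proof -
      have "?D = {\<omega> \<in> space (P i). traj \<omega> \<in> A \<and> M m \<omega> = j}" by auto
      moreover have "emeasure (distr (P j) traj_space traj) C = emeasure (P j) {\<omega> \<in> space (P j). traj \<omega> \<in> C}"
        using that by (subst emeasure_distr) (auto intro!: arg_cong[where f="emeasure _"])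
      ultimately show ?thesis by simp
    qed
    have "?N1 = ?N2"
    proof (rule measure_eqI_cylinders[where E="\<Union>n. cyls n" and n=0])
      show "finite_measure ?N1"
        by (rule finite_measureI) (simp add: N1[OF sets.top, simplified] emeasure_eq_measure)
      fix C :: "(nat \<Rightarrow> 's \<times> real) set" assume C: "C \<in> (\<Union>n. cyls n)"
      then have "C \<in> sets traj_space" by (auto simp: sets_traj_space)
      moreover obtain n where "C \<in> cyls n" using C by auto
      ultimately show "emeasure ?N1 C = emeasure ?N2 C"
        by (simp only: N1 N2 markov_cyl[OF A])
    qed (auto simp: sets_traj_space Int_stable_Un_cyls)
    then show ?thesis using N1[OF C] N2[OF C] by simp
  qed
  note [measurable] = shift_event[OF C]
  let ?F = "{\<omega> \<in> space (P i). M m \<omega> = j} \<inter> {\<omega> \<in> space (P i). shift m (traj \<omega>) \<in> C}"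
  let ?G = "{\<omega> \<in> space (P i). M m \<omega> = j}"
  let ?N1 = "distr (density (P i) (indicator ?F)) (hist_space m) traj"
  let ?N2 = "scale_measure (emeasure (P j) {\<omega> \<in> space (P j). traj \<omega> \<in> C})
     (distr (density (P i) (indicator ?G)) (hist_space m) traj)"
  have tr: "traj \<in> measurable (P i) (hist_space m)"
    using traj_measurable[of i] sets_hist_le_traj[of m] by (auto simp: measurable_def)
  have N1: "emeasure ?N1 A = emeasure (P i) {\<omega> \<in> space (P i). traj \<omega> \<in> A \<and> M m \<omega> = j \<and> shift m (traj \<omega>) \<in> C}"
    if "A \<in> sets (hist_space m)" for A
  proof -
    have "emeasure ?N1 A = emeasure (density (P i) (indicator ?F)) ({\<omega> \<in> space (P i). traj \<omega> \<in> A})"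
      using that tr by (subst emeasure_distr) (auto intro!: arg_cong[where f="emeasure _"])
    also have "\<dots> = emeasure (P i) (?F \<inter> {\<omega> \<in> space (P i). traj \<omega> \<in> A})"
      by (rule emeasure_restricted[OF _ hist_event[OF that]]) measurable
    finally show ?thesis by (auto intro!: arg_cong[where f="emeasure _"])
  qed
  have N2: "emeasure ?N2 A = emeasure (P i) {\<omega> \<in> space (P i). traj \<omega> \<in> A \<and> M m \<omega> = j}
        * emeasure (P j) {\<omega> \<in> space (P j). traj \<omega> \<in> C}"
    if "A \<in> sets (hist_space m)" for A
  proof -
    have "emeasure (distr (density (P i) (indicator ?G)) (hist_space m) traj) A
       = emeasure (density (P i) (indicator ?G)) ({\<omega> \<in> space (P i). traj \<omega> \<in> A})"
      using that tr by (subst emeasure_distr) (auto intro!: arg_cong[where f="emeasure _"])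
    also have "\<dots> = emeasure (P i) (?G \<inter> {\<omega> \<in> space (P i). traj \<omega> \<in> A})"
      by (rule emeasure_restricted[OF _ hist_event[OF that]]) measurable
    also have "?G \<inter> {\<omega> \<in> space (P i). traj \<omega> \<in> A} = {\<omega> \<in> space (P i). traj \<omega> \<in> A \<and> M m \<omega> = j}" by auto
    finally show ?thesis by (simp add: mult.commute)
  qed
  have "?N1 = ?N2"
  proof (rule measure_eqI_cylinders[where E="cyls m" and n=m])
    show "finite_measure ?N1"
      by (rule finite_measureI) (simp add: N1[OF sets.top, simplified] emeasure_eq_measure)
    fix A :: "(nat \<Rightarrow> 's \<times> real) set" assume A: "A \<in> cyls m"
    then have "A \<in> sets (hist_space m)" by (auto simp: sets_hist_space)
    then show "emeasure ?N1 A = emeasure ?N2 A"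
      by (simp only: N1 N2 step[OF A C])
  qed (auto simp: sets_hist_space Int_stable_cyls)
  then show ?thesis using N1[OF A] N2[OF A] by simp
qed

end

section \<open>Cycles\<close>

text \<open>Time 0 is not counted, which makes the count additive under shifts: a visit at the
  cutting time is credited to the past only.\<close>

primrec visits :: "'s \<Rightarrow> nat \<Rightarrow> (nat \<Rightarrow> 's \<times> real) \<Rightarrow> nat" where
  "visits i 0 w = 0"
| "visits i (Suc n) w = visits i n w + (if fst (w (Suc n)) = i then 1 else 0)"

text \<open>For trajectories started in \<open>i\<close> this says that \<open>m\<close> is the
  \<open>k\<close>-th return time. As a relation it is decided by the history up to \<open>m\<close>
  and needs no value when the return does not occur.\<close>

definition visit_at :: "'s \<Rightarrow> nat \<Rightarrow> nat \<Rightarrow> (nat \<Rightarrow> 's \<times> real) \<Rightarrow> bool" where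
  "visit_at i k m w \<longleftrightarrow> fst (w m) = i \<and> visits i m w = k"

text \<open>For trajectories started in \<open>i\<close>, \<open>cyc v i k\<close> is the sum of \<open>v (X\<^sub>n)\<close> over
  \<open>\<tau>\<^sub>k(i) < n \<le> \<tau>\<^sub>k\<^sub>+\<^sub>1(i)\<close>.\<close>

definition cyc :: "(real \<Rightarrow> real) \<Rightarrow> 's \<Rightarrow> nat \<Rightarrow> (nat \<Rightarrow> 's \<times> real) \<Rightarrow> ennreal" where
  "cyc v i k w = (\<Sum>l. if visits i l w = k then ennreal (v (snd (w (Suc l)))) else 0)"

lemma visits_shift: "visits i (m + n) w = visits i m w + visits i n (shift m w)"
  by (induction n) (auto simp: shift_def)

lemma visits_mono: "m \<le> n \<Longrightarrow> visits i m w \<le> visits i n w"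
  using visits_shift[of i m "n - m" w] by simp

lemma visit_at_shift:
  "visit_at i k m w \<Longrightarrow> visit_at i r n (shift m w) \<Longrightarrow> visit_at i (k + r) (m + n) w"
  by (simp add: visit_at_def visits_shift) (simp add: shift_def)

lemma visits_less_visit_at:
  assumes "visit_at i k m w" "l < m"
  shows "visits i l w < k"
proof -
  obtain m' where m: "m = Suc m'" using assms(2) by (cases m) auto
  have "visits i l w \<le> visits i m' w" using assms(2) m by (intro visits_mono) simp
  then show ?thesis using assms(1) by (auto simp: visit_at_def m)
qed

lemma visits_ge_visit_at: "visit_at i k m w \<Longrightarrow> m \<le> l \<Longrightarrow> k \<le> visits i l w"
  using visits_mono[of m l i w] by (simp add: visit_at_def)

lemma visit_at_unique: "visit_at i k m w \<Longrightarrow> visit_at i k n w \<Longrightarrow> m = n"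
  using visits_less_visit_at[of i k m w n] visits_less_visit_at[of i k n w m]
  by (cases m n rule: linorder_cases) (auto simp: visit_at_def)

lemma visit_at_first:
  assumes "0 < n" "fst (w n) = i"
  shows "visit_at i 1 (LEAST m. 0 < m \<and> fst (w m) = i) w"
proof -
  define m where "m = (LEAST m. 0 < m \<and> fst (w m) = i)"
  have m: "0 < m \<and> fst (w m) = i" unfolding m_def
    by (rule LeastI[of "\<lambda>m. 0 < m \<and> fst (w m) = i" n]) (use assms in simp)
  have "visits i l w = 0" if "l < m" for l
    using that
  proof (induction l)
    case (Suc l)
    then have "fst (w (Suc l)) \<noteq> i" using not_less_Least[of "Suc l"] unfolding m_def by auto
    with Suc show ?case by simp
  qed simp
  from this[of "m - 1"] m have "visits i m w = 1" by (cases m) auto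
  with m show ?thesis by (simp add: visit_at_def m_def[symmetric])
qed

lemma cyc_shift:
  assumes "visit_at i k m w"
  shows "cyc v i (k + r) w = cyc v i r (shift m w)"
proof -
  let ?f = "\<lambda>l. if visits i l w = k + r then ennreal (v (snd (w (Suc l)))) else 0"
  have "cyc v i (k + r) w = (\<Sum>l. ?f (l + m)) + (\<Sum>l<m. ?f l)"
    unfolding cyc_def by (rule suminf_offset) simp
  also have "(\<Sum>l<m. ?f l) = 0"
    using visits_less_visit_at[OF assms] by (intro sum.neutral) force
  also have "(\<Sum>l. ?f (l + m)) = cyc v i r (shift m w)"
    unfolding cyc_def
  proof (rule suminf_cong)
    fix l
    have "visits i (l + m) w = k + visits i l (shift m w)"
      using visits_shift[of i m l w] assms by (simp add: visit_at_def add.commute)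
    then show "?f (l + m) = (if visits i l (shift m w) = r then ennreal (v (snd (shift m w (Suc l)))) else 0)"
      by (simp add: shift_def add.commute)
  qed
  finally show ?thesis by simp
qed

text \<open>A cycle completed by time \<open>m\<close> is a finite sum over earlier times, hence a
  function of the history. Together with \<open>cyc_shift\<close> this separates past and future at
  a visit.\<close>

lemma cyc_past:
  assumes "visit_at i k m w" "j < k"
  shows "cyc v i j w = (\<Sum>l<m. if visits i l w = j then ennreal (v (snd (w (Suc l)))) else 0)"
proof -
  have "visits i l w \<noteq> j" if "l \<notin> {..<m}" for l
    using visits_ge_visit_at[OF assms(1), of l] assms(2) that by auto
  then show ?thesis unfolding cyc_def by (intro suminf_finite) auto
qed

lemma sum_cyc:
  assumes "visit_at i k m w"
  shows "(\<Sum>j<k. cyc v i j w) = (\<Sum>l<m. ennreal (v (snd (w (Suc l)))))"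
proof -
  have "(\<Sum>j<k. cyc v i j w) = (\<Sum>j<k. \<Sum>l<m. if visits i l w = j then ennreal (v (snd (w (Suc l)))) else 0)"
    using cyc_past[OF assms] by (intro sum.cong) auto
  also have "\<dots> = (\<Sum>l<m. \<Sum>j<k. if visits i l w = j then ennreal (v (snd (w (Suc l)))) else 0)"
    by (rule sum.swap)
  also have "\<dots> = (\<Sum>l<m. ennreal (v (snd (w (Suc l)))))"
    using visits_less_visit_at[OF assms] by (intro sum.cong) auto
  finally show ?thesis .
qed

lemma measurable_hist_visits:
  "l \<le> n \<Longrightarrow> visits (i :: 's::countable) l \<in> measurable (hist_space n) (count_space UNIV)"
proof (induction l)
  case (Suc l)
  then have [measurable]: "visits i l \<in> measurable (hist_space n) (count_space UNIV)"
    "(\<lambda>w. fst (w (Suc l)) :: 's) \<in> measurable (hist_space n) (count_space UNIV)"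
    by (auto intro: measurable_hist_fst)
  show ?case by simp
next
  case 0
  have "visits i 0 = (\<lambda>_. 0)" by auto
  then show ?case by simp
qed

lemma measurable_traj_visits[measurable]:
  "visits (i :: 's::countable) l \<in> measurable traj_space (count_space UNIV)"
  by (rule measurable_hist_traj[OF measurable_hist_visits[OF order_refl]])

lemma measurable_visit_at[measurable]:
  "Measurable.pred traj_space (visit_at (i :: 's::countable) k m)"
  unfolding visit_at_def by measurable

lemma measurable_cyc[measurable]:
  assumes [measurable]: "v \<in> borel_measurable borel"
  shows "cyc v (i :: 's::countable) k \<in> borel_measurable traj_space"
  unfolding cyc_def by measurable

section \<open>Regeneration at visits\<close>

locale recurrent_mrw = markov_random_walk P M X p K
  for P :: "'s::countable \<Rightarrow> 'w measure" and M X p K +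
  assumes returns: "\<And>i. AE \<omega> in P i. \<exists>n\<ge>1. M n \<omega> = i"
begin

lemma AE_start: "AE \<omega> in P i. M 0 \<omega> = i"
proof -
  have "prob i {\<omega> \<in> space (P i). traj \<omega> \<in> cyl 0 (\<lambda>_. i) (\<lambda>_. UNIV)} = 1"
    by (subst prob_cyl) auto
  then show ?thesis by (subst prob_Collect_eq_1[symmetric]) (auto simp: cyl_def traj_def)
qed

text \<open>Never returning to \<open>i\<close> is a null event under \<open>P i\<close>; the Markov
  property carries it to every possible time \<open>m\<close> of the \<open>k\<close>-th visit. Off
  these countably many null sets, induction on \<open>k\<close> yields every visit.\<close>

lemma AE_visit_at: "AE \<omega> in P i. \<forall>k. \<exists>m. visit_at i k m (traj \<omega>)"
proof -
  let ?C = "{w. \<not> (\<exists>n. visit_at i 1 n w)}"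
  have "{w \<in> space traj_space. \<not> (\<exists>n. visit_at i 1 n w)} \<in> sets traj_space" by measurable
  then have C: "?C \<in> sets traj_space" by simp
  have "AE \<omega> in P i. traj \<omega> \<notin> ?C"
    using returns[of i]
  proof eventually_elim
    case (elim \<omega>)
    then obtain n where "0 < n" "fst (traj \<omega> n) = i" by (auto simp: traj_def Suc_le_eq)
    from visit_at_first[of n "traj \<omega>" i, OF this] show ?case by blast
  qed
  then have C0: "emeasure (P i) {\<omega> \<in> space (P i). traj \<omega> \<in> ?C} = 0"
    using traj_event[OF C, of i] by (subst (asm) AE_iff_measurable) auto
  have "AE \<omega> in P i. visit_at i k m (traj \<omega>) \<longrightarrow> shift m (traj \<omega>) \<notin> ?C" for k m
  proof -
    let ?A = "{w. visits i m w = k}"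
    have A: "?A \<in> sets (hist_space m)"
      using measurable_sets[OF measurable_hist_visits[OF order_refl, of i m], of "{k}"] by (simp add: vimage_def)
    from markov_property[OF A C, of i i] C0
    have "emeasure (P i) {\<omega> \<in> space (P i). traj \<omega> \<in> ?A \<and> M m \<omega> = i \<and> shift m (traj \<omega>) \<in> ?C} = 0" by simp
    moreover have "{\<omega> \<in> space (P i). traj \<omega> \<in> ?A \<and> M m \<omega> = i \<and> shift m (traj \<omega>) \<in> ?C} \<in> sets (P i)"
    proof -
      note [measurable] = hist_event[OF A] shift_event[OF C]
      have "{\<omega> \<in> space (P i). traj \<omega> \<in> ?A} \<inter> {\<omega> \<in> space (P i). M m \<omega> = i} \<inter> {\<omega> \<in> space (P i). shift m (traj \<omega>) \<in> ?C} \<in> sets (P i)"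
        by measurable
      then show ?thesis by (rule back_subst[of "\<lambda>x. x \<in> _"]) auto
    qed
    ultimately have "AE \<omega> in P i. \<not> (traj \<omega> \<in> ?A \<and> M m \<omega> = i \<and> shift m (traj \<omega>) \<in> ?C)"
      by (subst AE_iff_measurable) auto
    then show ?thesis by eventually_elim (auto simp: visit_at_def traj_def)
  qed
  then have "AE \<omega> in P i. \<forall>k m. visit_at i k m (traj \<omega>) \<longrightarrow> shift m (traj \<omega>) \<notin> ?C"
    by (simp add: AE_all_countable)
  with AE_start[of i] show ?thesis
  proof eventually_elim
    case (elim \<omega>)
    show ?case
    proof
      fix k show "\<exists>m. visit_at i k m (traj \<omega>)"
      proof (induction k)
        case 0
        then show ?case using elim(1) by (intro exI[of _ 0]) (simp add: visit_at_def traj_def)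
      next
        case (Suc k)
        then obtain m where m: "visit_at i k m (traj \<omega>)" by blast
        with elim(2) obtain n where "visit_at i 1 n (shift m (traj \<omega>))" by blast
        from visit_at_shift[OF m this] show ?case by auto
      qed
    qed
  qed
qed

text \<open>The strong Markov property at the \<open>k\<close>-th visit: \<open>H m\<close>
  describes the past on the event that this visit occurs at time \<open>m\<close>, and these events
  are disjoint, so the Markov property is summed over \<open>m\<close>.\<close>

lemma regeneration:
  assumes H: "\<And>m. H m \<in> sets (hist_space m)" and C: "C \<in> sets traj_space"
  shows "emeasure (P i) {\<omega> \<in> space (P i). \<exists>m. visit_at i k m (traj \<omega>) \<and> traj \<omega> \<in> H m \<and> shift m (traj \<omega>) \<in> C}
    = emeasure (P i) {\<omega> \<in> space (P i). \<exists>m. visit_at i k m (traj \<omega>) \<and> traj \<omega> \<in> H m}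
      * emeasure (P i) {\<omega> \<in> space (P i). traj \<omega> \<in> C}"
proof -
  define A where "A m = H m \<inter> {w. visits i m w = k}" for m
  have A: "A m \<in> sets (hist_space m)" for m
    using measurable_sets[OF measurable_hist_visits[OF order_refl, of i m], of "{k}"] H[of m]
    by (auto simp: vimage_def A_def)
  have e1: "{\<omega> \<in> space (P i). \<exists>m. visit_at i k m (traj \<omega>) \<and> traj \<omega> \<in> H m \<and> shift m (traj \<omega>) \<in> D}
    = (\<Union>m. {\<omega> \<in> space (P i). traj \<omega> \<in> A m \<and> M m \<omega> = i \<and> shift m (traj \<omega>) \<in> D})" for D
    by (auto simp: A_def visit_at_def traj_def)
  have meas: "{\<omega> \<in> space (P i). traj \<omega> \<in> A m \<and> M m \<omega> = i \<and> shift m (traj \<omega>) \<in> D} \<in> sets (P i)"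
    if "D \<in> sets traj_space" for D m
  proof -
    note [measurable] = hist_event[OF A] shift_event[OF that]
    have "{\<omega> \<in> space (P i). traj \<omega> \<in> A m} \<inter> {\<omega> \<in> space (P i). M m \<omega> = i} \<inter> {\<omega> \<in> space (P i). shift m (traj \<omega>) \<in> D} \<in> sets (P i)"
      by measurable
    then show ?thesis by (rule back_subst[of "\<lambda>x. x \<in> _"]) auto
  qed
  have disj: "disjoint_family (\<lambda>m. {\<omega> \<in> space (P i). traj \<omega> \<in> A m \<and> M m \<omega> = i \<and> shift m (traj \<omega>) \<in> D})" for D
  proof -
    have "m = n" if "traj \<omega> \<in> A m" "M m \<omega> = i" "traj \<omega> \<in> A n" "M n \<omega> = i" for m n \<omega>
      by (rule visit_at_unique[of i k _ "traj \<omega>"]) (use that in \<open>auto simp: A_def visit_at_def traj_def\<close>)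
    then show ?thesis unfolding disjoint_family_on_def by blast
  qed
  have em: "emeasure (P i) {\<omega> \<in> space (P i). \<exists>m. visit_at i k m (traj \<omega>) \<and> traj \<omega> \<in> H m \<and> shift m (traj \<omega>) \<in> D}
    = (\<Sum>m. emeasure (P i) {\<omega> \<in> space (P i). traj \<omega> \<in> A m \<and> M m \<omega> = i})
        * emeasure (P i) {\<omega> \<in> space (P i). traj \<omega> \<in> D}"
    if D: "D \<in> sets traj_space" for D
    unfolding e1
    by (subst suminf_emeasure[symmetric, OF _ disj])
       (use meas[OF D] in \<open>auto simp: markov_property[OF A D]\<close>)
  \<comment> \<open>Taking the trivial future in \<open>em\<close> identifies the sum over
    \<open>m\<close> as the probability of the past event.\<close>
  have "UNIV \<in> sets traj_space" using sets.top[of traj_space] by simp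
  from em[OF this] em[OF C] show ?thesis by (simp add: emeasure_space_1)
qed

text \<open>From the \<open>k\<close>-th visit on, cycle \<open>k\<close> is cycle 0 of the shifted
  trajectory; regeneration with a trivial past gives the equality of laws.\<close>

lemma cyc_ident:
  assumes [measurable]: "v \<in> borel_measurable borel" and B: "B \<in> sets borel"
  shows "emeasure (P i) {\<omega> \<in> space (P i). cyc v i k (traj \<omega>) \<in> B}
    = emeasure (P i) {\<omega> \<in> space (P i). cyc v i 0 (traj \<omega>) \<in> B}"
proof -
  let ?C = "{w. cyc v i 0 w \<in> B}"
  note [measurable] = B
  have "{w \<in> space traj_space. cyc v i 0 w \<in> B} \<in> sets traj_space" by measurable
  then have C: "?C \<in> sets traj_space" by simp
  have "emeasure (P i) {\<omega> \<in> space (P i). cyc v i k (traj \<omega>) \<in> B}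
    = emeasure (P i) {\<omega> \<in> space (P i). \<exists>m. visit_at i k m (traj \<omega>) \<and> traj \<omega> \<in> UNIV \<and> shift m (traj \<omega>) \<in> ?C}"
  proof (rule emeasure_eq_AE)
    show "AE \<omega> in P i. (\<omega> \<in> {\<omega> \<in> space (P i). cyc v i k (traj \<omega>) \<in> B}) = (\<omega> \<in> {\<omega> \<in> space (P i).
       \<exists>m. visit_at i k m (traj \<omega>) \<and> traj \<omega> \<in> UNIV \<and> shift m (traj \<omega>) \<in> ?C})"
      using AE_visit_at[of i]
    proof eventually_elim
      case (elim \<omega>)
      then obtain m where m: "visit_at i k m (traj \<omega>)" by blast
      have "shift m (traj \<omega>) \<in> ?C \<longleftrightarrow> cyc v i k (traj \<omega>) \<in> B" if "visit_at i k m (traj \<omega>)" for m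
        using cyc_shift[OF that, of v 0] by simp
      then show ?case using m by blast
    qed
  qed measurable
  also have "\<dots> = emeasure (P i) {\<omega> \<in> space (P i). \<exists>m. visit_at i k m (traj \<omega>) \<and> traj \<omega> \<in> UNIV}
     * emeasure (P i) {\<omega> \<in> space (P i). traj \<omega> \<in> ?C}"
    by (rule regeneration[OF _ C]) (metis sets.top space_hist_space)
  also have "emeasure (P i) {\<omega> \<in> space (P i). \<exists>m. visit_at i k m (traj \<omega>) \<and> traj \<omega> \<in> UNIV} = 1"
    using AE_visit_at[of i] by (intro emeasure_eq_1_AE) auto
  finally show ?thesis by simp
qed

text \<open>The cut is at visit \<open>Suc k\<close>, where cycle \<open>k\<close> has just become
  past and cycle \<open>Suc k + r\<close> is cycle \<open>r\<close> of the future.\<close>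

lemma cyc_indep:
  assumes v[measurable]: "v \<in> borel_measurable borel" and A: "A \<in> sets borel" and B: "B \<in> sets borel"
  shows "emeasure (P i) {\<omega> \<in> space (P i). cyc v i k (traj \<omega>) \<in> A \<and> cyc v i (Suc k + r) (traj \<omega>) \<in> B}
    = emeasure (P i) {\<omega> \<in> space (P i). cyc v i k (traj \<omega>) \<in> A} * emeasure (P i) {\<omega> \<in> space (P i). cyc v i r (traj \<omega>) \<in> B}"
proof -
  let ?C = "{w. cyc v i r w \<in> B}"
  have C: "?C \<in> sets traj_space"
    using measurable_sets[OF measurable_cyc[OF v] B, of i r] by (simp add: vimage_def)
  \<comment> \<open>The series defining \<open>cyc\<close> looks beyond time \<open>m\<close>; its
    partial sum is history measurable and agrees with it when \<open>m\<close> is the time of visit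
    \<open>Suc k\<close>.\<close>
  let ?H = "\<lambda>m. {w. (\<Sum>l<m. if visits i l w = k then ennreal (v (snd (w (Suc l)))) else 0) \<in> A}"
  note [measurable] = A B
  have H: "?H m \<in> sets (hist_space m)" for m
  proof -
    have "(\<lambda>w. \<Sum>l<m. if visits i l w = k then ennreal (v (snd (w (Suc l)))) else 0) \<in> borel_measurable (hist_space m)"
    proof (rule borel_measurable_sum)
      fix l assume "l \<in> {..<m}"
      then have [measurable]: "visits i l \<in> measurable (hist_space m) (count_space UNIV)"
        "(\<lambda>w :: nat \<Rightarrow> 's \<times> real. snd (w (Suc l))) \<in> borel_measurable (hist_space m)"
        by (auto intro!: measurable_hist_visits measurable_hist_snd)
      show "(\<lambda>w. if visits i l w = k then ennreal (v (snd (w (Suc l)))) else 0) \<in> borel_measurable (hist_space m)"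
        by measurable
    qed
    from measurable_sets[OF this A] show ?thesis by (simp add: vimage_def)
  qed
  have Htraj[measurable]: "{\<omega> \<in> space (P i). traj \<omega> \<in> ?H m} \<in> sets (P i)" for m by (rule hist_event[OF H])
  have past: "traj \<omega> \<in> ?H m \<longleftrightarrow> cyc v i k (traj \<omega>) \<in> A" if "visit_at i (Suc k) m (traj \<omega>)" for m \<omega>
    using cyc_past[OF that, of k v] by simp
  have future: "shift m (traj \<omega>) \<in> ?C \<longleftrightarrow> cyc v i (Suc k + r) (traj \<omega>) \<in> B" if "visit_at i (Suc k) m (traj \<omega>)" for m \<omega>
    using cyc_shift[OF that, of v r] by simp
  have e1: "emeasure (P i) {\<omega> \<in> space (P i). cyc v i k (traj \<omega>) \<in> A \<and> cyc v i (Suc k + r) (traj \<omega>) \<in> B}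
    = emeasure (P i) {\<omega> \<in> space (P i). \<exists>m. visit_at i (Suc k) m (traj \<omega>) \<and> traj \<omega> \<in> ?H m \<and> shift m (traj \<omega>) \<in> ?C}"
  proof (rule emeasure_eq_AE)
    show "AE \<omega> in P i. (\<omega> \<in> {\<omega> \<in> space (P i). cyc v i k (traj \<omega>) \<in> A \<and> cyc v i (Suc k + r) (traj \<omega>) \<in> B})
      = (\<omega> \<in> {\<omega> \<in> space (P i). \<exists>m. visit_at i (Suc k) m (traj \<omega>) \<and> traj \<omega> \<in> ?H m \<and> shift m (traj \<omega>) \<in> ?C})"
      using AE_visit_at[of i]
    proof eventually_elim
      case (elim \<omega>)
      then obtain m where m: "visit_at i (Suc k) m (traj \<omega>)" by blast
      show ?case using m past future by blast
    qed
    have "{\<omega> \<in> space (P i). \<exists>m. visit_at i (Suc k) m (traj \<omega>) \<and> traj \<omega> \<in> ?H m \<and> shift m (traj \<omega>) \<in> ?C}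
      = (\<Union>m. {\<omega> \<in> space (P i). visit_at i (Suc k) m (traj \<omega>)} \<inter> {\<omega> \<in> space (P i). traj \<omega> \<in> ?H m}
          \<inter> {\<omega> \<in> space (P i). shift m (traj \<omega>) \<in> ?C})" by blast
    also have "\<dots> \<in> sets (P i)"
      by (intro sets.countable_UN'' sets.Int Htraj shift_event[OF C]) measurable
    finally show "{\<omega> \<in> space (P i). \<exists>m. visit_at i (Suc k) m (traj \<omega>) \<and> traj \<omega> \<in> ?H m \<and> shift m (traj \<omega>) \<in> ?C} \<in> sets (P i)" .
  qed measurable
  have e2: "emeasure (P i) {\<omega> \<in> space (P i). cyc v i k (traj \<omega>) \<in> A}
    = emeasure (P i) {\<omega> \<in> space (P i). \<exists>m. visit_at i (Suc k) m (traj \<omega>) \<and> traj \<omega> \<in> ?H m}"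
  proof (rule emeasure_eq_AE)
    show "AE \<omega> in P i. (\<omega> \<in> {\<omega> \<in> space (P i). cyc v i k (traj \<omega>) \<in> A})
      = (\<omega> \<in> {\<omega> \<in> space (P i). \<exists>m. visit_at i (Suc k) m (traj \<omega>) \<and> traj \<omega> \<in> ?H m})"
      using AE_visit_at[of i]
    proof eventually_elim
      case (elim \<omega>)
      then obtain m where m: "visit_at i (Suc k) m (traj \<omega>)" by blast
      show ?case using m past by blast
    qed
    have "{\<omega> \<in> space (P i). \<exists>m. visit_at i (Suc k) m (traj \<omega>) \<and> traj \<omega> \<in> ?H m}
      = (\<Union>m. {\<omega> \<in> space (P i). visit_at i (Suc k) m (traj \<omega>)} \<inter> {\<omega> \<in> space (P i). traj \<omega> \<in> ?H m})" by blast
    also have "\<dots> \<in> sets (P i)"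
      by (intro sets.countable_UN'' sets.Int Htraj) measurable
    finally show "{\<omega> \<in> space (P i). \<exists>m. visit_at i (Suc k) m (traj \<omega>) \<and> traj \<omega> \<in> ?H m} \<in> sets (P i)" .
  qed measurable
  show ?thesis unfolding e1 e2 regeneration[OF H C] by simp
qed

text \<open>\<open>enn2real\<close> sends an infinite value to 0, so this is real and nonnegative
  everywhere, as the deviation lemmas demand. Almost surely cycles are finite, so nothing is
  lost.\<close>

definition cycR :: "(real \<Rightarrow> real) \<Rightarrow> 's \<Rightarrow> nat \<Rightarrow> 'w \<Rightarrow> real" where
  "cycR v i k \<omega> = enn2real (cyc v i k (traj \<omega>))"

lemma measurable_cycR[measurable]:
  assumes [measurable]: "v \<in> borel_measurable borel"
  shows "cycR v i k \<in> borel_measurable (P j)"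
  unfolding cycR_def[abs_def] by measurable

lemma distr_cycR:
  assumes [measurable]: "v \<in> borel_measurable borel"
  shows "distr (P i) borel (cycR v i k) = distr (P i) borel (cycR v i 0)"
proof (rule measure_eqI)
  fix B assume "B \<in> sets (distr (P i) borel (cycR v i k))"
  then have B: "B \<in> sets borel" by simp
  have "enn2real -` B \<in> sets borel" using measurable_sets[OF borel_measurable_enn2real[OF measurable_ident] B] by simp
  from cyc_ident[OF assms this, of i k] B
  show "emeasure (distr (P i) borel (cycR v i k)) B = emeasure (distr (P i) borel (cycR v i 0)) B"
    by (simp add: emeasure_distr cycR_def vimage_def Int_def conj_commute)
qed simp

lemma indep_cycR:
  assumes v[measurable]: "v \<in> borel_measurable borel" and "k \<noteq> l"
  shows "indep_var i borel (cycR v i k) borel (cycR v i l)"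
proof -
  have prod: "prob i {\<omega> \<in> space (P i). cycR v i k \<omega> \<in> A \<and> cycR v i l \<omega> \<in> B}
      = prob i {\<omega> \<in> space (P i). cycR v i k \<omega> \<in> A} * prob i {\<omega> \<in> space (P i). cycR v i l \<omega> \<in> B}"
    if "k < l" and A: "A \<in> sets borel" and B: "B \<in> sets borel" for k l A B
  proof -
    have s: "enn2real -` A \<in> sets borel" "enn2real -` B \<in> sets borel"
      using measurable_sets[OF borel_measurable_enn2real[OF measurable_ident] A]
        measurable_sets[OF borel_measurable_enn2real[OF measurable_ident] B] by simp_all
    obtain r where l: "l = Suc k + r" using \<open>k < l\<close> less_iff_Suc_add by auto
    have "emeasure (P i) {\<omega> \<in> space (P i). cyc v i r (traj \<omega>) \<in> enn2real -` B}
      = emeasure (P i) {\<omega> \<in> space (P i). cyc v i l (traj \<omega>) \<in> enn2real -` B}"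
      using cyc_ident[OF v s(2), of i r] cyc_ident[OF v s(2), of i l] by simp
    with cyc_indep[OF v s, of i k r]
    have "emeasure (P i) {\<omega> \<in> space (P i). cycR v i k \<omega> \<in> A \<and> cycR v i l \<omega> \<in> B}
      = emeasure (P i) {\<omega> \<in> space (P i). cycR v i k \<omega> \<in> A} * emeasure (P i) {\<omega> \<in> space (P i). cycR v i l \<omega> \<in> B}"
      by (simp add: l cycR_def)
    then show ?thesis by (simp add: emeasure_eq_measure ennreal_mult''[symmetric])
  qed
  show ?thesis
  proof (rule indep_varI_prob)
    fix A B :: "real set" assume AB: "A \<in> sets borel" "B \<in> sets borel"
    show "prob i {\<omega> \<in> space (P i). cycR v i k \<omega> \<in> A \<and> cycR v i l \<omega> \<in> B}
      = prob i {\<omega> \<in> space (P i). cycR v i k \<omega> \<in> A} * prob i {\<omega> \<in> space (P i). cycR v i l \<omega> \<in> B}"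
    proof (cases "k < l")
      case True then show ?thesis using prod AB by blast
    next
      case False
      then have "l < k" using \<open>k \<noteq> l\<close> by simp
      from prod[OF this AB(2,1)] show ?thesis by (simp add: conj_commute mult.commute)
    qed
  qed measurable
qed

end

section \<open>The occupation measure of a cycle\<close>

lemma nn_integral_count_space_has_sum:
  fixes f :: "'b \<Rightarrow> real"
  assumes f: "(f has_sum s) A" and nonneg: "\<And>x. 0 \<le> f x"
  shows "(\<integral>\<^sup>+x. ennreal (f x) \<partial>count_space A) = ennreal s"
proof -
  have "f summable_on A" using f by (rule has_sum_imp_summable)
  then have "(\<lambda>x. norm (f x)) summable_on A" using nonneg by simp
  then have abs: "Infinite_Set_Sum.abs_summable_on f A" by (simp only: abs_summable_equivalent)
  then show ?thesis
    using nn_integral_conv_infsetsum[OF abs] nonneg infsetsum_infsum[OF abs] infsumI[OF f] by simp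
qed

lemma nn_integral_swap_count_space:
  "(\<integral>\<^sup>+x. \<integral>\<^sup>+y. f x y \<partial>count_space UNIV \<partial>count_space UNIV)
    = (\<integral>\<^sup>+y. \<integral>\<^sup>+x. f x y \<partial>count_space UNIV \<partial>count_space UNIV)"
  using nn_integral_fst_count_space[of "\<lambda>(x, y). f x y"] nn_integral_snd_count_space[of "\<lambda>(x, y). f x y"]
  by simp

context markov_random_walk
begin

text \<open>The Markov property for events of the first shifted increment says that the law of
  \<open>X (Suc m)\<close> restricted to the history event is a multiple of the law of
  \<open>X 1\<close> under \<open>P j\<close>. Equality of these measures extends to integrals of
  \<open>h\<close>.\<close>

lemma nn_integral_next_increment:
  assumes A: "A \<in> sets (hist_space m)" and [measurable]: "h \<in> borel_measurable borel"
  shows "(\<integral>\<^sup>+\<omega>. indicator {\<omega>. traj \<omega> \<in> A \<and> M m \<omega> = j} \<omega> * h (X (Suc m) \<omega>) \<partial>P i)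
    = emeasure (P i) {\<omega> \<in> space (P i). traj \<omega> \<in> A \<and> M m \<omega> = j} * (\<integral>\<^sup>+\<omega>. h (X 1 \<omega>) \<partial>P j)"
proof -
  let ?D = "{\<omega> \<in> space (P i). traj \<omega> \<in> A} \<inter> {\<omega> \<in> space (P i). M m \<omega> = j}"
  note [measurable] = hist_event[OF A]
  have D[measurable]: "?D \<in> sets (P i)" by measurable
  have Deq: "{\<omega> \<in> space (P i). traj \<omega> \<in> A \<and> M m \<omega> = j} = ?D" by auto
  let ?N1 = "distr (density (P i) (indicator ?D)) borel (X (Suc m))"
  let ?N2 = "scale_measure (emeasure (P i) ?D) (distr (P j) borel (X 1))"
  have "?N1 = ?N2"
  proof (rule measure_eqI)
    fix B assume "B \<in> sets ?N1"
    then have B: "B \<in> sets borel" by simp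
    let ?C = "{w :: nat \<Rightarrow> 's \<times> real. snd (w (Suc 0)) \<in> B}"
    have C: "?C \<in> sets traj_space"
      using measurable_sets[OF measurable_traj_snd[of 0] B] by (simp add: vimage_def)
    have B': "{\<omega> \<in> space (P i). X (Suc m) \<omega> \<in> B} \<in> sets (P i)" using B by measurable
    have "emeasure ?N1 B = emeasure (density (P i) (indicator ?D)) {\<omega> \<in> space (P i). X (Suc m) \<omega> \<in> B}"
      using B by (subst emeasure_distr) (auto intro!: arg_cong[where f="emeasure _"])
    also have "\<dots> = emeasure (P i) (?D \<inter> {\<omega> \<in> space (P i). X (Suc m) \<omega> \<in> B})"
      by (rule emeasure_restricted[OF D B'])
    also have "?D \<inter> {\<omega> \<in> space (P i). X (Suc m) \<omega> \<in> B}
      = {\<omega> \<in> space (P i). traj \<omega> \<in> A \<and> M m \<omega> = j \<and> shift m (traj \<omega>) \<in> ?C}"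
      by (auto simp: traj_def shift_def)
    also have "emeasure (P i) \<dots> = emeasure (P i) ?D * emeasure (P j) {\<omega> \<in> space (P j). traj \<omega> \<in> ?C}"
      unfolding markov_property[OF A C] Deq ..
    also have "emeasure (P j) {\<omega> \<in> space (P j). traj \<omega> \<in> ?C} = emeasure (distr (P j) borel (X 1)) B"
      using B by (subst emeasure_distr) (auto simp: traj_def intro!: arg_cong[where f="emeasure _"])
    finally show "emeasure ?N1 B = emeasure ?N2 B" by simp
  qed simp
  have "(\<integral>\<^sup>+\<omega>. indicator {\<omega>. traj \<omega> \<in> A \<and> M m \<omega> = j} \<omega> * h (X (Suc m) \<omega>) \<partial>P i)
    = (\<integral>\<^sup>+\<omega>. indicator ?D \<omega> * h (X (Suc m) \<omega>) \<partial>P i)"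
    by (intro nn_integral_cong) (auto simp: indicator_def)
  also have "\<dots> = (\<integral>\<^sup>+\<omega>. h (X (Suc m) \<omega>) \<partial>density (P i) (indicator ?D))"
    by (subst nn_integral_density) auto
  also have "\<dots> = (\<integral>\<^sup>+x. h x \<partial>?N1)"
    by (subst nn_integral_distr) auto
  also have "\<dots> = (\<integral>\<^sup>+x. h x \<partial>?N2)" using \<open>?N1 = ?N2\<close> by simp
  also have "\<dots> = emeasure (P i) ?D * (\<integral>\<^sup>+x. h x \<partial>distr (P j) borel (X 1))"
    by (rule nn_integral_scale_measure) simp
  also have "(\<integral>\<^sup>+x. h x \<partial>distr (P j) borel (X 1)) = (\<integral>\<^sup>+\<omega>. h (X 1 \<omega>) \<partial>P j)"
    by (subst nn_integral_distr) auto
  finally show ?thesis unfolding Deq .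
qed

lemma emeasure_M1: "emeasure (P i) {\<omega> \<in> space (P i). M 1 \<omega> = j} = ennreal (p i j)"
proof -
  have "prob i {\<omega> \<in> space (P i). traj \<omega> \<in> cyl 1 (\<lambda>k. if k = 0 then i else j) (\<lambda>_. UNIV)} = p i j"
    using prob_space.prob_space[OF prob_space_K, of i j] sets_eq_imp_space_eq[OF sets_K, of i j]
    by (subst prob_cyl) auto
  also have "prob i {\<omega> \<in> space (P i). traj \<omega> \<in> cyl 1 (\<lambda>k. if k = 0 then i else j) (\<lambda>_. UNIV)}
    = prob i {\<omega> \<in> space (P i). M 0 \<omega> = i \<and> M 1 \<omega> = j}"
    by (intro arg_cong[where f="prob i"]) (auto simp: cyl_def traj_def le_Suc_eq)
  also have "\<dots> = prob i {\<omega> \<in> space (P i). M 1 \<omega> = j}"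
  proof (rule finite_measure_eq_AE)
    have "prob i {\<omega> \<in> space (P i). traj \<omega> \<in> cyl 0 (\<lambda>_. i) (\<lambda>_. UNIV)} = 1"
      by (subst prob_cyl) auto
    then have "AE \<omega> in P i. M 0 \<omega> = i"
      by (subst prob_Collect_eq_1[symmetric]) (auto simp: cyl_def traj_def)
    then show "AE \<omega> in P i. (\<omega> \<in> {\<omega> \<in> space (P i). M 0 \<omega> = i \<and> M 1 \<omega> = j}) = (\<omega> \<in> {\<omega> \<in> space (P i). M 1 \<omega> = j})"
      by eventually_elim auto
  qed measurable
  finally show ?thesis by (simp add: emeasure_eq_measure)
qed

text \<open>The history event \<open>A\<close> is carried along because the occupation measure needs
  transitions of paths that have not yet returned.\<close>

lemma emeasure_next_state:
  assumes A: "A \<in> sets (hist_space m)"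
  shows "emeasure (P i) {\<omega> \<in> space (P i). traj \<omega> \<in> A \<and> M (Suc m) \<omega> = j}
    = (\<integral>\<^sup>+h. emeasure (P i) {\<omega> \<in> space (P i). traj \<omega> \<in> A \<and> M m \<omega> = h} * ennreal (p h j) \<partial>count_space UNIV)"
proof -
  let ?C = "{w :: nat \<Rightarrow> 's \<times> real. fst (w 1) = j}"
  have C: "?C \<in> sets traj_space"
    using measurable_sets[OF measurable_traj_fst[of 1], of "{j}"] by (simp add: vimage_def)
  have Ceq: "{\<omega> \<in> space (P h). traj \<omega> \<in> ?C} = {\<omega> \<in> space (P h). M 1 \<omega> = j}" for h
    by (auto simp: traj_def)
  note [measurable] = hist_event[OF A]
  have meas: "{\<omega> \<in> space (P i). traj \<omega> \<in> A \<and> M m \<omega> = h \<and> shift m (traj \<omega>) \<in> ?C} \<in> sets (P i)" for h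
  proof -
    have "{\<omega> \<in> space (P i). traj \<omega> \<in> A} \<inter> {\<omega> \<in> space (P i). M m \<omega> = h} \<inter> {\<omega> \<in> space (P i). shift m (traj \<omega>) \<in> ?C} \<in> sets (P i)"
      by (intro sets.Int shift_event[OF C]) measurable
    then show ?thesis by (rule back_subst[of "\<lambda>x. x \<in> _"]) auto
  qed
  have "{\<omega> \<in> space (P i). traj \<omega> \<in> A \<and> M (Suc m) \<omega> = j}
    = (\<Union>h\<in>UNIV. {\<omega> \<in> space (P i). traj \<omega> \<in> A \<and> M m \<omega> = h \<and> shift m (traj \<omega>) \<in> ?C})"
    by (auto simp: traj_def shift_def)
  also have "emeasure (P i) \<dots>
    = (\<integral>\<^sup>+h. emeasure (P i) {\<omega> \<in> space (P i). traj \<omega> \<in> A \<and> M m \<omega> = h \<and> shift m (traj \<omega>) \<in> ?C} \<partial>count_space UNIV)"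
    by (rule emeasure_UN_countable[OF meas]) (auto simp: disjoint_family_on_def)
  finally show ?thesis unfolding markov_property[OF A C] Ceq emeasure_M1 .
qed

text \<open>Irreducibility only offers positive \<open>n\<close>-step probabilities, so invariance
  is needed over \<open>n\<close> steps. It is stated for an arbitrary \<open>\<rho>\<close> to
  cover both \<open>\<pi>\<close> and the occupation measure.\<close>

lemma invariant_iterate:
  assumes inv: "\<And>j. (\<integral>\<^sup>+h. \<rho> h * ennreal (p h j) \<partial>count_space UNIV) = \<rho> j"
  shows "(\<integral>\<^sup>+h. \<rho> h * emeasure (P h) {\<omega> \<in> space (P h). M n \<omega> = j} \<partial>count_space UNIV) = \<rho> j"
proof (induction n arbitrary: j)
  case 0
  have "emeasure (P h) {\<omega> \<in> space (P h). M 0 \<omega> = j} = indicator {j} h" for h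
  proof -
    have "prob h {\<omega> \<in> space (P h). traj \<omega> \<in> cyl 0 (\<lambda>_. j) (\<lambda>_. UNIV)} = (if j = h then 1 else 0)"
      by (subst prob_cyl) auto
    then show ?thesis by (auto simp: cyl_def traj_def emeasure_eq_measure)
  qed
  then show ?case by (simp add: nn_integral_count_space_indicator[symmetric] flip: nn_integral_cmult)
next
  case (Suc n)
  have top: "UNIV \<in> sets (hist_space n)" by (metis sets.top space_hist_space)
  have step: "emeasure (P h) {\<omega> \<in> space (P h). M (Suc n) \<omega> = j}
     = (\<integral>\<^sup>+l. emeasure (P h) {\<omega> \<in> space (P h). M n \<omega> = l} * ennreal (p l j) \<partial>count_space UNIV)" for h
    using emeasure_next_state[OF top, of h j] by simp
  have "(\<integral>\<^sup>+h. \<rho> h * emeasure (P h) {\<omega> \<in> space (P h). M (Suc n) \<omega> = j} \<partial>count_space UNIV)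
    = (\<integral>\<^sup>+h. \<integral>\<^sup>+l. \<rho> h * emeasure (P h) {\<omega> \<in> space (P h). M n \<omega> = l} * ennreal (p l j) \<partial>count_space UNIV \<partial>count_space UNIV)"
    unfolding step by (subst nn_integral_cmult[symmetric]) (auto simp: mult.assoc)
  also have "\<dots> = (\<integral>\<^sup>+l. \<integral>\<^sup>+h. \<rho> h * emeasure (P h) {\<omega> \<in> space (P h). M n \<omega> = l} * ennreal (p l j) \<partial>count_space UNIV \<partial>count_space UNIV)"
    by (rule nn_integral_swap_count_space)
  also have "\<dots> = (\<integral>\<^sup>+l. \<rho> l * ennreal (p l j) \<partial>count_space UNIV)"
    by (subst nn_integral_multc) (auto simp: Suc.IH)
  finally show ?case using inv by simp
qed

end

section \<open>Stationary distribution and taboo probabilities\<close>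

locale stationary_mrw = recurrent_mrw P M X p K
  for P :: "'s::countable \<Rightarrow> 'w measure" and M X p K +
  fixes \<pi> :: "'s \<Rightarrow> real"
  assumes irreducible: "irreducible_chain P M" and stationary: "stationary_distribution p \<pi>"
begin

lemma pi_nonneg: "0 \<le> \<pi> i"
  using stationary by (simp add: stationary_distribution_def)

lemma pi_total: "(\<integral>\<^sup>+j. ennreal (\<pi> j) \<partial>count_space UNIV) = 1"
  using stationary nn_integral_count_space_has_sum[where f=\<pi> and A=UNIV and s=1] by (simp add: stationary_distribution_def)

lemma pi_invariant: "(\<integral>\<^sup>+h. ennreal (\<pi> h) * ennreal (p h j) \<partial>count_space UNIV) = ennreal (\<pi> j)"
  using stationary nn_integral_count_space_has_sum[where f="\<lambda>h. \<pi> h * p h j" and s="\<pi> j" and A=UNIV] pi_nonneg p_nonneg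
  by (simp add: stationary_distribution_def ennreal_mult)

lemma obtain_step:
  obtains n where "0 < emeasure (P h) {\<omega> \<in> space (P h). M n \<omega> = i}"
  using irreducible by (auto simp: irreducible_chain_def emeasure_eq_measure)

text \<open>A zero of \<open>\<pi>\<close> at \<open>i\<close> spreads backwards to every state from
  which \<open>i\<close> can be reached, hence to all states, against total mass 1.\<close>

lemma pi_pos: "0 < \<pi> i"
proof (rule ccontr)
  assume "\<not> 0 < \<pi> i"
  then have i0: "\<pi> i = 0" using pi_nonneg[of i] by simp
  have "\<pi> h = 0" for h
  proof -
    obtain n where n: "0 < emeasure (P h) {\<omega> \<in> space (P h). M n \<omega> = i}" by (rule obtain_step)
    have "(\<integral>\<^sup>+h. ennreal (\<pi> h) * emeasure (P h) {\<omega> \<in> space (P h). M n \<omega> = i} \<partial>count_space UNIV) = 0"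
      using invariant_iterate[of "\<lambda>h. ennreal (\<pi> h)", OF pi_invariant, of n i] i0 by simp
    then have "ennreal (\<pi> h) * emeasure (P h) {\<omega> \<in> space (P h). M n \<omega> = i} = 0"
      by (subst (asm) nn_integral_0_iff_AE) (auto simp: AE_count_space)
    then show "\<pi> h = 0" using n pi_nonneg[of h] by auto
  qed
  then show False using pi_total by simp
qed

text \<open>The taboo probability \<open>P_i(tau(i) > n, M_n = j)\<close>. Its sum over
  \<open>n\<close> is the expected number of visits to \<open>j\<close> in one cycle, counting the
  start but not the closing return.\<close>

definition occ :: "'s \<Rightarrow> nat \<Rightarrow> 's \<Rightarrow> ennreal" where
  "occ i n j = emeasure (P i) {\<omega> \<in> space (P i). visits i n (traj \<omega>) = 0 \<and> M n \<omega> = j}"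

lemma no_visit_hist: "{w. visits (i :: 's) n w = 0} \<in> sets (hist_space n)"
  using measurable_sets[OF measurable_hist_visits[OF order_refl, of i n], of "{0}"] by (simp add: vimage_def)

lemma occ_0: "occ i 0 j = (if j = i then 1 else 0)"
proof (cases "j = i")
  case True
  then show ?thesis unfolding occ_def using AE_start[of i] by (auto intro!: emeasure_eq_1_AE)
next
  case False
  then have "AE \<omega> in P i. \<not> (visits i 0 (traj \<omega>) = 0 \<and> M 0 \<omega> = j)"
    using AE_start[of i] by (auto elim!: eventually_mono)
  then show ?thesis unfolding occ_def using False by (subst (asm) AE_iff_measurable) auto
qed

lemma emeasure_occ_next:
  "emeasure (P i) {\<omega> \<in> space (P i). visits i n (traj \<omega>) = 0 \<and> M (Suc n) \<omega> = j}
    = (\<integral>\<^sup>+h. occ i n h * ennreal (p h j) \<partial>count_space UNIV)"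
  using emeasure_next_state[OF no_visit_hist[of i n], of i j] by (simp add: occ_def)

lemma occ_Suc: "occ i (Suc n) j = (if j = i then 0 else \<integral>\<^sup>+h. occ i n h * ennreal (p h j) \<partial>count_space UNIV)"
proof (cases "j = i")
  case True
  then have "{\<omega> \<in> space (P i). visits i (Suc n) (traj \<omega>) = 0 \<and> M (Suc n) \<omega> = j} = {}"
    by (auto simp: traj_def)
  then show ?thesis unfolding occ_def using True by (simp only: emeasure_empty if_True simp_thms)
next
  case False
  then have "{\<omega> \<in> space (P i). visits i (Suc n) (traj \<omega>) = 0 \<and> M (Suc n) \<omega> = j}
    = {\<omega> \<in> space (P i). visits i n (traj \<omega>) = 0 \<and> M (Suc n) \<omega> = j}"
    by (auto simp: traj_def)
  then have "occ i (Suc n) j = emeasure (P i) {\<omega> \<in> space (P i). visits i n (traj \<omega>) = 0 \<and> M (Suc n) \<omega> = j}"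
    by (simp only: occ_def)
  then show ?thesis unfolding emeasure_occ_next using False by simp
qed

text \<open>The minimality argument for invariant measures. At \<open>j = i\<close> only the term
  \<open>n = 0\<close> contributes; elsewhere the last step is split off and the induction
  hypothesis is inserted into the invariance equation of \<open>\<pi>\<close>.\<close>

lemma sum_occ_le: "ennreal (\<pi> i) * (\<Sum>n<N. occ i n j) \<le> ennreal (\<pi> j)"
proof (induction N arbitrary: j)
  case (Suc N)
  have s: "(\<Sum>n<Suc N. occ i n j) = occ i 0 j + (\<Sum>n<N. occ i (Suc n) j)"
    by (rule sum.lessThan_Suc_shift)
  show ?case
  proof (cases "j = i")
    case True
    then show ?thesis unfolding s by (simp add: occ_0 occ_Suc)
  next
    case False
    then have "ennreal (\<pi> i) * (\<Sum>n<Suc N. occ i n j)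
       = ennreal (\<pi> i) * (\<Sum>n<N. \<integral>\<^sup>+h. occ i n h * ennreal (p h j) \<partial>count_space UNIV)"
      unfolding s by (simp add: occ_0 occ_Suc)
    also have "\<dots> = (\<integral>\<^sup>+h. (ennreal (\<pi> i) * (\<Sum>n<N. occ i n h)) * ennreal (p h j) \<partial>count_space UNIV)"
      by (subst nn_integral_sum[symmetric], simp, subst nn_integral_cmult[symmetric])
         (auto simp: sum_distrib_right mult.assoc)
    also have "\<dots> \<le> (\<integral>\<^sup>+h. ennreal (\<pi> h) * ennreal (p h j) \<partial>count_space UNIV)"
      by (intro nn_integral_mono mult_right_mono Suc.IH) auto
    also have "\<dots> = ennreal (\<pi> j)" by (rule pi_invariant)
    finally show ?thesis .
  qed
qed simp

text \<open>The summand is \<open>P_i(tau(i) = n + 1)\<close>, so this is recurrence; it supplies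
  the invariance of the occupation measure at \<open>i\<close> itself.\<close>

lemma total_return: "(\<Sum>n. \<integral>\<^sup>+h. occ i n h * ennreal (p h i) \<partial>count_space UNIV) = 1"
proof -
  let ?E = "\<lambda>n. {\<omega> \<in> space (P i). visit_at i 1 (Suc n) (traj \<omega>)}"
  have "(\<Sum>n. \<integral>\<^sup>+h. occ i n h * ennreal (p h i) \<partial>count_space UNIV) = (\<Sum>n. emeasure (P i) (?E n))"
    unfolding emeasure_occ_next[symmetric]
    by (intro suminf_cong arg_cong[where f="emeasure _"]) (auto simp: visit_at_def traj_def)
  also have "\<dots> = emeasure (P i) (\<Union>n. ?E n)"
  proof (rule suminf_emeasure)
    show "disjoint_family ?E"       unfolding disjoint_family_on_def by (blast dest: visit_at_unique)
  qed auto
  also have "\<dots> = 1"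
  proof (rule emeasure_eq_1_AE)
    show "AE \<omega> in P i. \<omega> \<in> (\<Union>n. ?E n)"
      using AE_visit_at[of i] AE_space
    proof eventually_elim
      case (elim \<omega>)
      then obtain m where m: "visit_at i 1 m (traj \<omega>)" by blast
      have "m \<noteq> 0"
      proof
        assume "m = 0"
        with m show False by (simp add: visit_at_def)
      qed
      then obtain m' where "m = Suc m'" by (cases m) auto
      then show ?case using m elim(2) by auto
    qed
  qed auto
  finally show ?thesis .
qed

lemma occ_invariant: "(\<integral>\<^sup>+h. (\<Sum>n. occ i n h) * ennreal (p h j) \<partial>count_space UNIV) = (\<Sum>n. occ i n j)"
proof -
  have s: "(\<Sum>n. occ i n j) = occ i 0 j + (\<Sum>n. occ i (Suc n) j)"
    using suminf_offset[of "\<lambda>n. occ i n j" 1] by (simp add: add.commute)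
  have "(\<integral>\<^sup>+h. (\<Sum>n. occ i n h) * ennreal (p h j) \<partial>count_space UNIV)
    = (\<Sum>n. \<integral>\<^sup>+h. occ i n h * ennreal (p h j) \<partial>count_space UNIV)"
    by (subst nn_integral_suminf[symmetric]) auto
  also have "\<dots> = (\<Sum>n. occ i n j)"
    unfolding s using total_return[of i] by (cases "j = i") (simp_all add: occ_0 occ_Suc)
  finally show ?thesis .
qed

text \<open>Both sides are invariant and comparable, and they agree at \<open>i\<close>; irreducibility propagates the
  equality to every state.\<close>

lemma occ_total: "ennreal (\<pi> i) * (\<Sum>n. occ i n j) = ennreal (\<pi> j)"
proof (rule antisym)
  let ?\<rho> = "\<lambda>j. ennreal (\<pi> i) * (\<Sum>n. occ i n j)"
  have le: "?\<rho> j \<le> ennreal (\<pi> j)" for j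
  proof -
    have "?\<rho> j = (\<Sum>n. ennreal (\<pi> i) * occ i n j)" by simp
    also have "\<dots> \<le> ennreal (\<pi> j)"
      by (rule suminf_le_const) (use sum_occ_le in \<open>auto simp: sum_distrib_left\<close>)
    finally show ?thesis .
  qed
  then show "?\<rho> j \<le> ennreal (\<pi> j)" .
  \<comment> \<open>The state \<open>i\<close> is reached from \<open>j\<close> in \<open>n\<close>
    steps with positive probability \<open>q j\<close>. The nonnegative difference of the two
    measures, weighted by \<open>q\<close>, has integral \<open>\<pi> i - \<pi> i = 0\<close>; hence
    it vanishes at \<open>j\<close>, and \<open>q j\<close> can be cancelled.\<close>
  obtain n where n: "0 < emeasure (P j) {\<omega> \<in> space (P j). M n \<omega> = i}" by (rule obtain_step)
  define q where "q h = emeasure (P h) {\<omega> \<in> space (P h). M n \<omega> = i}" for h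
  have inv: "(\<integral>\<^sup>+h. ?\<rho> h * ennreal (p h j) \<partial>count_space UNIV) = ?\<rho> j" for j
    unfolding occ_invariant[symmetric, of i j] by (subst nn_integral_cmult[symmetric]) (auto simp: mult.assoc)
  have "(\<Sum>n. occ i n i) = 1"
    using suminf_offset[of "\<lambda>n. occ i n i" 1] by (simp add: occ_0 occ_Suc)
  then have r: "(\<integral>\<^sup>+h. ?\<rho> h * q h \<partial>count_space UNIV) = ennreal (\<pi> i)"
    unfolding q_def using invariant_iterate[of ?\<rho>, OF inv, of n i] by simp
  have pq: "(\<integral>\<^sup>+h. ennreal (\<pi> h) * q h \<partial>count_space UNIV) = ennreal (\<pi> i)"
    unfolding q_def by (rule invariant_iterate[OF pi_invariant])
  have "(\<integral>\<^sup>+h. ennreal (\<pi> h) * q h - ?\<rho> h * q h \<partial>count_space UNIV) = ennreal (\<pi> i) - ennreal (\<pi> i)"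
    by (subst nn_integral_diff) (auto simp: r pq intro!: mult_right_mono le)
  then have "(\<integral>\<^sup>+h. ennreal (\<pi> h) * q h - ?\<rho> h * q h \<partial>count_space UNIV) = 0" by simp
  then have "ennreal (\<pi> j) * q j - ?\<rho> j * q j = 0"
    by (subst (asm) nn_integral_0_iff_AE) (auto simp: AE_count_space)
  then have *: "ennreal (\<pi> j) * q j \<le> ?\<rho> j * q j"
    by (metis diff_eq_0_iff_ennreal diff_eq_0_ennreal ennreal_minus_eq_0)
  have "q j \<noteq> \<top>" "q j \<noteq> 0" using n by (auto simp: q_def emeasure_eq_measure)
  with * show "ennreal (\<pi> j) \<le> ?\<rho> j"
    by (simp add: ennreal_mult_le_mult_iff mult.commute[of _ "q j"])
qed

text \<open>The cycle sum is split by the time \<open>n\<close> and the state \<open>j\<close>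
  before each increment. By the Markov property a piece has mean \<open>occ i n j\<close> times the
  mean of \<open>v (X 1)\<close> under \<open>P j\<close>, and summing over \<open>n\<close> turns
  the taboo probabilities into \<open>\<pi> j / \<pi> i\<close>.\<close>

lemma cycle_expectation:
  assumes [measurable]: "v \<in> borel_measurable borel"
  shows "ennreal (\<pi> i) * (\<integral>\<^sup>+\<omega>. cyc v i 0 (traj \<omega>) \<partial>P i) = Epi_nn P \<pi> (\<lambda>\<omega>. ennreal (v (X 1 \<omega>)))"
proof -
  let ?h = "\<lambda>x. ennreal (v x)"
  let ?I = "\<lambda>n j. indicator {\<omega>. traj \<omega> \<in> {w. visits i n w = 0} \<and> M n \<omega> = j} :: _ \<Rightarrow> ennreal"
  have split: "(if visits i n (traj \<omega>) = 0 then ennreal (v (snd (traj \<omega> (Suc n)))) else 0)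
      = (\<integral>\<^sup>+j. ?I n j \<omega> * ?h (X (Suc n) \<omega>) \<partial>count_space UNIV)" for n \<omega>
  proof -
    have "(\<integral>\<^sup>+j. ?I n j \<omega> * ?h (X (Suc n) \<omega>) \<partial>count_space UNIV)
      = (\<integral>\<^sup>+j. (if visits i n (traj \<omega>) = 0 then ?h (X (Suc n) \<omega>) else 0) * indicator {M n \<omega>} j \<partial>count_space UNIV)"
      by (intro nn_integral_cong) (auto simp: indicator_def)
    also have "\<dots> = (if visits i n (traj \<omega>) = 0 then ?h (X (Suc n) \<omega>) else 0)"
      by (simp add: nn_integral_cmult_indicator)
    finally show ?thesis by (simp add: traj_def)
  qed
  have I[measurable]: "?I n j \<in> borel_measurable (P i)" for n j
  proof -
    have "{\<omega> \<in> space (P i). visits i n (traj \<omega>) = 0 \<and> M n \<omega> = j} \<in> sets (P i)" by measurable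
    then show ?thesis by (subst borel_measurable_indicator_iff) (auto simp: Int_def conj_ac)
  qed
  have "(\<integral>\<^sup>+\<omega>. cyc v i 0 (traj \<omega>) \<partial>P i)
    = (\<Sum>n. \<integral>\<^sup>+\<omega>. \<integral>\<^sup>+j. ?I n j \<omega> * ?h (X (Suc n) \<omega>) \<partial>count_space UNIV \<partial>P i)"
    unfolding cyc_def split[symmetric] by (rule nn_integral_suminf) measurable
  also have "\<dots> = (\<Sum>n. \<integral>\<^sup>+j. \<integral>\<^sup>+\<omega>. ?I n j \<omega> * ?h (X (Suc n) \<omega>) \<partial>P i \<partial>count_space UNIV)"
    by (intro suminf_cong nn_integral_count_space_nn_integral) auto
  also have "\<dots> = (\<Sum>n. \<integral>\<^sup>+j. occ i n j * (\<integral>\<^sup>+\<omega>. ?h (X 1 \<omega>) \<partial>P j) \<partial>count_space UNIV)"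
    using nn_integral_next_increment[OF no_visit_hist, of ?h i] by (simp add: occ_def)
  also have "\<dots> = (\<integral>\<^sup>+j. (\<Sum>n. occ i n j) * (\<integral>\<^sup>+\<omega>. ?h (X 1 \<omega>) \<partial>P j) \<partial>count_space UNIV)"
    by (subst nn_integral_suminf[symmetric]) auto
  finally have "ennreal (\<pi> i) * (\<integral>\<^sup>+\<omega>. cyc v i 0 (traj \<omega>) \<partial>P i)
    = (\<integral>\<^sup>+j. ennreal (\<pi> i) * (\<Sum>n. occ i n j) * (\<integral>\<^sup>+\<omega>. ?h (X 1 \<omega>) \<partial>P j) \<partial>count_space UNIV)"
    by (simp add: nn_integral_cmult[symmetric] mult.assoc)
  then show ?thesis by (simp add: occ_total Epi_nn_def)
qed

end

section \<open>Sums of functions of the increments\<close>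

lemma nat_ceiling_of_nat_bounds:
  assumes "0 < c"
  shows "c * real n \<le> real (nat \<lceil>c * real n\<rceil>)" "real (nat \<lceil>c * real n\<rceil>) \<le> c * real n + 1"
    "real (nat \<lceil>c * real n\<rceil>) \<le> (c + 1) * real n"
proof -
  have nonneg: "0 \<le> c * real n" using assms by simp
  show up: "real (nat \<lceil>c * real n\<rceil>) \<le> c * real n + 1" using nonneg by linarith
  show "c * real n \<le> real (nat \<lceil>c * real n\<rceil>)" by linarith
  show "real (nat \<lceil>c * real n\<rceil>) \<le> (c + 1) * real n"
  proof (cases "n = 0")
    case False
    then have "real n \<ge> 1" by simp
    then show ?thesis using up by (simp add: distrib_right)
  qed simp
qed

lemma nat_floor_of_nat_bounds:
  assumes "0 < c"
  shows "real (nat \<lfloor>c * real n\<rfloor>) \<le> c * real n" "c * real n - 1 \<le> real (nat \<lfloor>c * real n\<rfloor>)"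
proof -
  have "0 \<le> c * real n" using assms by simp
  then show "real (nat \<lfloor>c * real n\<rfloor>) \<le> c * real n" "c * real n - 1 \<le> real (nat \<lfloor>c * real n\<rfloor>)"
    by linarith+
qed

context stationary_mrw
begin

text \<open>The function \<open>v\<close> is a parameter so that the positive part, the negative
  part, their truncations and the constant 1, which measures time, share one analysis.\<close>

definition asum :: "(real \<Rightarrow> real) \<Rightarrow> nat \<Rightarrow> 'w \<Rightarrow> real" where
  "asum v n \<omega> = (\<Sum>k=1..n. v (X k \<omega>))"

abbreviation Epi :: "(real \<Rightarrow> real) \<Rightarrow> ennreal" where
  "Epi v \<equiv> Epi_nn P \<pi> (\<lambda>\<omega>. ennreal (v (X 1 \<omega>)))"

lemma asum_measurable[measurable]:
  assumes [measurable]: "v \<in> borel_measurable borel"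
  shows "asum v n \<in> borel_measurable (P i)"
  unfolding asum_def[abs_def] by measurable

lemma asum_nonneg: "(\<And>x. 0 \<le> v x) \<Longrightarrow> 0 \<le> asum v n \<omega>"
  unfolding asum_def by (intro sum_nonneg) auto

lemma asum_mono: "(\<And>x. 0 \<le> v x) \<Longrightarrow> mono (\<lambda>n. asum v n \<omega>)"
  unfolding asum_def by (intro monoI sum_mono2) auto

lemma sum_cycR:
  assumes "visit_at i k m (traj \<omega>)" and nonneg: "\<And>x. 0 \<le> v x"
  shows "(\<Sum>j<k. cycR v i j \<omega>) = asum v m \<omega>"
proof -
  have s: "(\<Sum>j<k. cyc v i j (traj \<omega>)) = ennreal (asum v m \<omega>)"
    unfolding sum_cyc[OF assms(1)] asum_def
    using nonneg by (simp add: sum.atLeast1_atMost_eq traj_def sum_ennreal)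
  have "cyc v i j (traj \<omega>) < \<top>" if "j < k" for j
  proof -
    have "cyc v i j (traj \<omega>) \<le> (\<Sum>j<k. cyc v i j (traj \<omega>))"
      using that by (intro member_le_sum) auto
    then show ?thesis unfolding s by (rule le_less_trans) simp
  qed
  then have "enn2real (\<Sum>j<k. cyc v i j (traj \<omega>)) = (\<Sum>j<k. cycR v i j \<omega>)"
    by (subst enn2real_sum) (auto simp: cycR_def)
  then show ?thesis unfolding s using asum_nonneg[of v m \<omega>, OF nonneg] by simp
qed

lemma AE_ennreal_cycR:
  assumes nonneg: "\<And>x. 0 \<le> v x"
  shows "AE \<omega> in P i. ennreal (cycR v i 0 \<omega>) = cyc v i 0 (traj \<omega>)"
  using AE_visit_at[of i]
proof eventually_elim
  case (elim \<omega>)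
  then obtain m where m: "visit_at i 1 m (traj \<omega>)" by blast
  have "cyc v i 0 (traj \<omega>) = (\<Sum>l<m. ennreal (v (snd (traj \<omega> (Suc l)))))"
    using sum_cyc[OF m, of v] by simp
  also have "\<dots> < \<top>" by (simp add: less_top[symmetric])
  finally show ?case unfolding cycR_def by simp
qed

lemma nn_integral_cycR:
  assumes [measurable]: "v \<in> borel_measurable borel" and nonneg: "\<And>x. 0 \<le> v x"
  shows "ennreal (\<pi> i) * (\<integral>\<^sup>+\<omega>. ennreal (cycR v i 0 \<omega>) \<partial>P i) = Epi v"
proof -
  have "(\<integral>\<^sup>+\<omega>. ennreal (cycR v i 0 \<omega>) \<partial>P i) = (\<integral>\<^sup>+\<omega>. cyc v i 0 (traj \<omega>) \<partial>P i)"
    using AE_ennreal_cycR[OF nonneg] by (rule nn_integral_cong_AE)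
  then show ?thesis by (simp only: cycle_expectation[OF assms(1)])
qed

lemma cycR_nonneg: "0 \<le> cycR v i k \<omega>"
  by (simp add: cycR_def)

lemma cycR_integrable:
  assumes v[measurable]: "v \<in> borel_measurable borel" and nonneg: "\<And>x. 0 \<le> v x" and fin: "Epi v < \<infinity>"
  shows "integrable (P i) (cycR v i 0)" and "expectation i (cycR v i 0) = enn2real (Epi v) / \<pi> i"
proof -
  have E: "ennreal (\<pi> i) * (\<integral>\<^sup>+\<omega>. ennreal (cycR v i 0 \<omega>) \<partial>P i) = Epi v"
    by (rule nn_integral_cycR[OF v nonneg])
  have "(\<integral>\<^sup>+\<omega>. ennreal (cycR v i 0 \<omega>) \<partial>P i) < \<infinity>"
    using fin pi_pos[of i] unfolding E[symmetric] by (auto simp: ennreal_mult_less_top)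
  then show int: "integrable (P i) (cycR v i 0)"
    using cycR_nonneg by (intro integrableI_bounded) auto
  have "(\<integral>\<^sup>+\<omega>. ennreal (cycR v i 0 \<omega>) \<partial>P i) = ennreal (expectation i (cycR v i 0))"
    using int cycR_nonneg by (intro nn_integral_eq_integral) auto
  then have "Epi v = ennreal (\<pi> i * expectation i (cycR v i 0))"
    using E pi_nonneg[of i] by (simp add: ennreal_mult')
  then have "enn2real (Epi v) = \<pi> i * expectation i (cycR v i 0)"
    using pi_nonneg[of i] cycR_nonneg by simp
  then show "expectation i (cycR v i 0) = enn2real (Epi v) / \<pi> i"
    using pi_pos[of i] by (simp add: field_simps)
qed

text \<open>With \<open>c = 1\<close> and \<open>cycR_integrable\<close> this gives Kac's formula:
  the mean cycle length is \<open>1 / \<pi> i\<close>.\<close>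

lemma Epi_const: "0 \<le> c \<Longrightarrow> Epi (\<lambda>_. c) = ennreal c"
  unfolding Epi_nn_def by (simp add: nn_integral_multc emeasure_space_1 pi_total)

text \<open>A deviation of \<open>asum v\<close> at the deterministic time \<open>n\<close> forces, by monotonicity, a deviation
  either of the sum or of the length of about \<open>\<pi>\<^sub>i n\<close> complete cycles.\<close>

lemma summable_deviations:
  assumes v[measurable]: "v \<in> borel_measurable borel" and nonneg: "\<And>x. 0 \<le> v x" and fin: "Epi v < \<infinity>"
    and \<epsilon>: "0 < \<epsilon>"
  shows "summable (\<lambda>n. 1 / real n *
    prob i {\<omega> \<in> space (P i). \<bar>asum v n \<omega> / real n - enn2real (Epi v)\<bar> > \<epsilon>})"
proof -
  define e where "e = enn2real (Epi v)"
  define one :: "real \<Rightarrow> real" where "one = (\<lambda>_. 1)"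
  have one[measurable]: "one \<in> borel_measurable borel" and one0: "\<And>x. 0 \<le> one x"
    by (simp_all add: one_def)
  define m where "m = e / \<pi> i"
  have e0: "0 \<le> e" by (simp add: e_def)
  have p: "0 < \<pi> i" by (rule pi_pos)
  have m: "0 \<le> m" using e0 p by (simp add: m_def)
  have Ev: "expectation i (cycR v i 0) = m" and intv: "integrable (P i) (cycR v i 0)"
    using cycR_integrable[OF v nonneg fin] by (simp_all add: m_def e_def)
  have "Epi one = 1" unfolding one_def using Epi_const[of 1] by simp
  then have E1: "expectation i (cycR one i 0) = 1 / \<pi> i" and int1: "integrable (P i) (cycR one i 0)"
    using cycR_integrable[OF one one0] by simp_all
  \<comment> \<open>The first bound keeps \<open>\<pi> i - \<delta>\<close> positive; the second
    makes \<open>\<delta> * n\<close> surplus cycles, of mean \<open>m\<close> each, worth at most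
    \<open>\<epsilon> / 4 * n\<close>.\<close>
  define \<delta> where "\<delta> = min (\<pi> i / 2) (\<epsilon> / (4 * (m + 1)))"
  have "\<delta> \<le> \<pi> i / 2" unfolding \<delta>_def by (rule min.cobounded1)
  then have \<delta>: "0 < \<delta>" "0 < \<pi> i - \<delta>" using p \<epsilon> m by (auto simp: \<delta>_def)
  have \<delta>m: "\<delta> * m \<le> \<epsilon> / 4"
  proof -
    have "\<delta> * m \<le> \<epsilon> / (4 * (m + 1)) * m" using m by (intro mult_right_mono) (auto simp: \<delta>_def)
    also have "\<dots> = \<epsilon> / 4 * (m / (m + 1))" using m by simp
    also have "\<dots> \<le> \<epsilon> / 4 * 1" using m \<epsilon> by (intro mult_left_mono) auto
    finally show ?thesis by simp
  qed
  have one_sum: "asum one n \<omega> = real n" for n \<omega> by (simp add: asum_def one_def)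
  \<comment> \<open>\<open>ku n\<close> cycles are slightly too many and \<open>kl n\<close>
    slightly too few to fill time \<open>n\<close>. If \<open>ku n\<close> cycles end before
    \<open>n\<close>, they were too short by \<open>\<delta> / \<pi> i * n\<close>, which is
    \<open>U2\<close>; otherwise their sum dominates \<open>asum v n\<close>, and an excess is
    \<open>U1\<close>. \<open>L1\<close> and \<open>L2\<close> mirror this for
    \<open>kl n\<close>.\<close>
  define ku where "ku n = nat \<lceil>(\<pi> i + \<delta>) * real n\<rceil>" for n
  define kl where "kl n = nat \<lfloor>(\<pi> i - \<delta>) * real n\<rfloor>" for n
  have ku: "(\<pi> i + \<delta>) * real n \<le> real (ku n)" "real (ku n) \<le> (\<pi> i + \<delta>) * real n + 1"
    "real (ku n) \<le> (\<pi> i + \<delta> + 1) * real n" for n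
    unfolding ku_def using nat_ceiling_of_nat_bounds[of "\<pi> i + \<delta>" n] p \<delta> by auto
  have kl: "real (kl n) \<le> (\<pi> i - \<delta>) * real n" "(\<pi> i - \<delta>) * real n - 1 \<le> real (kl n)" for n
    unfolding kl_def using nat_floor_of_nat_bounds[of "\<pi> i - \<delta>" n] \<delta> by auto
  let ?S = "\<lambda>u k \<omega>. \<Sum>j<k. cycR u i j \<omega>"
  define U1 where "U1 n = {\<omega> \<in> space (P i). ?S v (ku n) \<omega> > real (ku n) * m + \<epsilon> / 2 * real n}" for n
  define U2 where "U2 n = {\<omega> \<in> space (P i). ?S one (ku n) \<omega> < real (ku n) * (1 / \<pi> i) - \<delta> / \<pi> i * real n}" for n
  define L1 where "L1 n = {\<omega> \<in> space (P i). ?S v (kl n) \<omega> < real (kl n) * m - \<epsilon> / 2 * real n}" for n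
  define L2 where "L2 n = {\<omega> \<in> space (P i). ?S one (kl n) \<omega> > real (kl n) * (1 / \<pi> i) + \<delta> / \<pi> i * real n}" for n
  have [measurable]: "U1 n \<in> sets (P i)" "U2 n \<in> sets (P i)" "L1 n \<in> sets (P i)" "L2 n \<in> sets (P i)" for n
    unfolding U1_def U2_def L1_def L2_def by measurable
  note iid = distr_cycR indep_cycR cycR_nonneg
  have \<delta>p: "0 < \<delta> / \<pi> i" using \<delta> p by simp
  have "summable (\<lambda>n. 1 / real n * prob i (U1 n))"
    unfolding U1_def Ev[symmetric]
    by (rule summable_upper_deviations[where c="\<pi> i + \<delta> + 1"]) (use \<epsilon> intv ku v in \<open>auto intro: iid\<close>)
  moreover have "summable (\<lambda>n. 1 / real n * prob i (U2 n))"
    unfolding U2_def E1[symmetric]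
    by (rule summable_lower_deviations[where c="\<pi> i + \<delta> + 1"]) (use \<delta>p int1 ku one in \<open>auto intro: iid\<close>)
  moreover have "summable (\<lambda>n. 1 / real n * prob i (L1 n))"
    unfolding L1_def Ev[symmetric]
    by (rule summable_lower_deviations[where c="\<pi> i - \<delta>"]) (use \<epsilon> intv kl v in \<open>auto intro: iid\<close>)
  moreover have "summable (\<lambda>n. 1 / real n * prob i (L2 n))"
    unfolding L2_def E1[symmetric]
    by (rule summable_upper_deviations[where c="\<pi> i - \<delta>"]) (use \<delta>p int1 kl one in \<open>auto intro: iid\<close>)
  ultimately have sum: "summable (\<lambda>n. 1 / real n * prob i (U1 n) + 1 / real n * prob i (U2 n)
      + (1 / real n * prob i (L1 n) + 1 / real n * prob i (L2 n)))"
    by (intro summable_add)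
  show ?thesis
    unfolding e_def[symmetric]
  \<comment> \<open>Rounding the number of cycles costs at most one cycle mean \<open>m\<close>,
    which for \<open>n \<ge> 4 * m / \<epsilon>\<close> is absorbed in another
    \<open>\<epsilon> / 4 * n\<close>.\<close>
  proof (rule summable_comparison_test'[OF sum, where N="nat \<lceil>4 * m / \<epsilon>\<rceil> + 1"])
    fix n assume n: "nat \<lceil>4 * m / \<epsilon>\<rceil> + 1 \<le> n"
    then have n0: "0 < real n" by simp
    have "4 * m / \<epsilon> \<le> real n" using n by linarith
    then have mn: "m \<le> \<epsilon> / 4 * real n" using \<epsilon> by (simp add: field_simps)
    let ?E = "{\<omega> \<in> space (P i). \<bar>asum v n \<omega> / real n - e\<bar> > \<epsilon>}"
    have pm: "\<pi> i * m = e" using p by (simp add: m_def)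
    have kum: "real (ku n) * m + \<epsilon> / 2 * real n \<le> (e + \<epsilon>) * real n"
    proof -
      have "real (ku n) * m \<le> ((\<pi> i + \<delta>) * real n + 1) * m" using ku m by (intro mult_right_mono) auto
      also have "\<dots> = (\<pi> i * m) * real n + (\<delta> * m) * real n + m" by (simp add: algebra_simps)
      also have "\<dots> \<le> e * real n + \<epsilon> / 4 * real n + \<epsilon> / 4 * real n"
        unfolding pm using mn \<delta>m n0 by (intro add_mono mult_right_mono) auto
      finally show ?thesis by (simp add: algebra_simps)
    qed
    have klm: "(e - \<epsilon>) * real n \<le> real (kl n) * m - \<epsilon> / 2 * real n"
    proof -
      have "e * real n - \<epsilon> / 4 * real n - \<epsilon> / 4 * real n \<le> (\<pi> i * m) * real n - (\<delta> * m) * real n - m"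
        unfolding pm using mn \<delta>m n0 by (intro diff_mono mult_right_mono) auto
      also have "\<dots> = ((\<pi> i - \<delta>) * real n - 1) * m" by (simp add: algebra_simps)
      also have "\<dots> \<le> real (kl n) * m" using kl m by (intro mult_right_mono) auto
      finally show ?thesis by (simp add: algebra_simps)
    qed
    have ku1: "real n \<le> real (ku n) * (1 / \<pi> i) - \<delta> / \<pi> i * real n"
      using ku(1)[of n] p by (simp add: field_simps)
    have kl1: "real (kl n) * (1 / \<pi> i) + \<delta> / \<pi> i * real n \<le> real n"
      using kl(1)[of n] p by (simp add: field_simps)
    have "prob i ?E \<le> prob i (U1 n \<union> U2 n \<union> (L1 n \<union> L2 n))"
    proof (rule finite_measure_mono_AE)
      show "AE \<omega> in P i. \<omega> \<in> ?E \<longrightarrow> \<omega> \<in> U1 n \<union> U2 n \<union> (L1 n \<union> L2 n)"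
        using AE_visit_at[of i]
      proof eventually_elim
        case (elim \<omega>)
        obtain t where t: "visit_at i (ku n) t (traj \<omega>)" using elim by blast
        obtain s where s: "visit_at i (kl n) s (traj \<omega>)" using elim by blast
        show ?case
        proof
          assume E: "\<omega> \<in> ?E"
          then consider "asum v n \<omega> / real n > e + \<epsilon>" | "asum v n \<omega> / real n < e - \<epsilon>" by force
          then show "\<omega> \<in> U1 n \<union> U2 n \<union> (L1 n \<union> L2 n)"
          proof cases
            case 1
            then have a: "asum v n \<omega> > (e + \<epsilon>) * real n" using n0 by (simp add: field_simps)
            show ?thesis
            proof (cases "n \<le> t")
              case True
              then have "asum v n \<omega> \<le> asum v t \<omega>" by (rule monoD[OF asum_mono[OF nonneg]])
              then have "\<omega> \<in> U1 n" unfolding U1_def using a kum E sum_cycR[OF t nonneg] by simp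
              then show ?thesis by simp
            next
              case False
              then have "\<omega> \<in> U2 n" unfolding U2_def using ku1 E sum_cycR[OF t one0] one_sum by simp
              then show ?thesis by simp
            qed
          next
            case 2
            then have a: "asum v n \<omega> < (e - \<epsilon>) * real n" using n0 by (simp add: field_simps)
            show ?thesis
            proof (cases "s \<le> n")
              case True
              then have "asum v s \<omega> \<le> asum v n \<omega>" by (rule monoD[OF asum_mono[OF nonneg]])
              then have "\<omega> \<in> L1 n" unfolding L1_def using a klm E sum_cycR[OF s nonneg] by simp
              then show ?thesis by simp
            next
              case False
              then have "\<omega> \<in> L2 n" unfolding L2_def using kl1 E sum_cycR[OF s one0] one_sum by simp
              then show ?thesis by simp
            qed
          qed
        qed
      qed
    qed measurable
    also have "\<dots> \<le> prob i (U1 n \<union> U2 n) + prob i (L1 n \<union> L2 n)" by (rule measure_Un_le) measurable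
    also have "\<dots> \<le> (prob i (U1 n) + prob i (U2 n)) + (prob i (L1 n) + prob i (L2 n))"
      by (intro add_mono measure_Un_le) measurable
    finally have "1 / real n * prob i ?E \<le> 1 / real n * ((prob i (U1 n) + prob i (U2 n)) + (prob i (L1 n) + prob i (L2 n)))"
      by (intro mult_left_mono) auto
    then show "norm (1 / real n * prob i ?E) \<le> 1 / real n * prob i (U1 n) + 1 / real n * prob i (U2 n)
      + (1 / real n * prob i (L1 n) + 1 / real n * prob i (L2 n))"
      by (simp add: distrib_left add_divide_distrib)
  qed
qed

lemma AE_asum_tendsto:
  assumes v[measurable]: "v \<in> borel_measurable borel" and nonneg: "\<And>x. 0 \<le> v x" and fin: "Epi v < \<infinity>"
  shows "AE \<omega> in P i. (\<lambda>n. asum v n \<omega> / real n) \<longlonglongrightarrow> enn2real (Epi v)"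
proof (rule AE_mono_ratio_tendsto)
  show "mono (\<lambda>n. asum v n \<omega>)" for \<omega> by (rule asum_mono[OF nonneg])
  show "0 \<le> asum v n \<omega>" for n \<omega> by (rule asum_nonneg[OF nonneg])
  show "summable (\<lambda>n. 1 / real n * prob i {\<omega> \<in> space (P i). \<bar>asum v n \<omega> / real n - enn2real (Epi v)\<bar> > \<epsilon>})"
    if "0 < \<epsilon>" for \<epsilon> by (rule summable_deviations[OF assms that])
qed auto

text \<open>Monotone convergence is used twice, under each \<open>P i\<close> and over the states.
  When \<open>Epi v\<close> is infinite, the finite truncated means therefore exceed every
  bound.\<close>

lemma Epi_SUP:
  assumes [measurable]: "v \<in> borel_measurable borel"
  shows "(SUP C. Epi (\<lambda>x. min (v x) (real C))) = Epi v"
proof -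
  have sup: "(SUP C. ennreal (min x (real C))) = ennreal x" for x
  proof (rule antisym)
    show "(SUP C. ennreal (min x (real C))) \<le> ennreal x" by (intro SUP_least ennreal_leI) simp
    obtain C :: nat where "x \<le> real C" using real_arch_simple by blast
    then have "ennreal x = ennreal (min x (real C))" by simp
    also have "\<dots> \<le> (SUP C. ennreal (min x (real C)))" by (rule SUP_upper) simp
    finally show "ennreal x \<le> (SUP C. ennreal (min x (real C)))" .
  qed
  have inner: "(\<integral>\<^sup>+\<omega>. ennreal (v (X 1 \<omega>)) \<partial>P i) = (SUP C. \<integral>\<^sup>+\<omega>. ennreal (min (v (X 1 \<omega>)) (real C)) \<partial>P i)" for i
    unfolding sup[of "v _", symmetric]
    by (rule nn_integral_monotone_convergence_SUP) (auto simp: incseq_def le_fun_def intro!: ennreal_leI)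
  show ?thesis
    unfolding Epi_nn_def inner SUP_mult_left_ennreal
    by (rule nn_integral_monotone_convergence_SUP[symmetric])
       (auto simp: incseq_def le_fun_def intro!: mult_left_mono nn_integral_mono ennreal_leI)
qed

lemma AE_asum_at_top:
  assumes v[measurable]: "v \<in> borel_measurable borel" and nonneg: "\<And>x. 0 \<le> v x" and inf: "Epi v = \<infinity>"
  shows "AE \<omega> in P i. filterlim (\<lambda>n. asum v n \<omega> / real n) at_top sequentially"
proof -
  let ?v = "\<lambda>C x. min (v x) (real C)"
  have fin: "Epi (?v C) < \<infinity>" for C
  proof -
    have "Epi (?v C) \<le> Epi (\<lambda>_. real C)"
      unfolding Epi_nn_def by (intro nn_integral_mono mult_left_mono ennreal_leI) auto
    also have "\<dots> < \<infinity>" by (simp add: Epi_const)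
    finally show ?thesis .
  qed
  have "AE \<omega> in P i. \<forall>C. (\<lambda>n. asum (?v C) n \<omega> / real n) \<longlonglongrightarrow> enn2real (Epi (?v C))"
    unfolding AE_all_countable using nonneg fin by (intro allI AE_asum_tendsto) auto
  then show ?thesis
  proof eventually_elim
    case (elim \<omega>)
    show ?case unfolding filterlim_at_top
    proof
      fix Z :: real
      have "ennreal (max Z 0) < (SUP C. Epi (?v C))" unfolding Epi_SUP[OF v] inf by simp
      then obtain C where C: "ennreal (max Z 0) < Epi (?v C)" unfolding less_SUP_iff by blast
      have "ennreal (max Z 0) < ennreal (enn2real (Epi (?v C)))" using C fin[of C] by simp
      then have "max Z 0 < enn2real (Epi (?v C))" by (subst (asm) ennreal_less_iff) auto
      then have "Z < enn2real (Epi (?v C))" by simp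
      with elim have "\<forall>\<^sub>F n in sequentially. asum (?v C) n \<omega> / real n > Z" by (blast dest: order_tendstoD)
      then show "\<forall>\<^sub>F n in sequentially. Z \<le> asum v n \<omega> / real n"
      proof eventually_elim
        case (elim n)
        have "asum (?v C) n \<omega> \<le> asum v n \<omega>" unfolding asum_def by (intro sum_mono) simp
        then have "asum (?v C) n \<omega> / real n \<le> asum v n \<omega> / real n" by (intro divide_right_mono) auto
        with elim show ?case by linarith
      qed
    qed
  qed
qed

text \<open>\<open>ret_time\<close> uses \<open>LEAST\<close>, which is meaningful only if a later
  visit exists; infinitely many visits guarantee that. Only the first return is matched with
  \<open>visit_at\<close>; of the others it is enough that they tend to infinity, because the
  averages are controlled along all times.\<close>

lemma AE_ret_time:
  "AE \<omega> in P i. visit_at i 1 (tau M i \<omega>) (traj \<omega>) \<and> filterlim (\<lambda>k. ret_time M i k \<omega>) at_top sequentially"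
  using AE_visit_at[of i]
proof eventually_elim
  case (elim \<omega>)
  have ex: "\<exists>m>t. M m \<omega> = i" for t
  proof -
    obtain m where m: "visit_at i (Suc t) m (traj \<omega>)" using elim by blast
    \<comment> \<open>At most one visit per step, so the visit numbered \<open>Suc t\<close> occurs
      after time \<open>t\<close>.\<close>
    have "visits i m (traj \<omega>) \<le> m" by (induction m) auto
    with m show ?thesis by (intro exI[of _ m]) (auto simp: visit_at_def traj_def)
  qed
  have "strict_mono (\<lambda>k. ret_time M i k \<omega>)"
    unfolding strict_mono_Suc_iff
  proof
    fix k
    obtain m where "m > ret_time M i k \<omega> \<and> M m \<omega> = i" using ex by blast
    then have "(LEAST m. m > ret_time M i k \<omega> \<and> M m \<omega> = i) > ret_time M i k \<omega>"
      by (rule LeastI2) simp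
    then show "ret_time M i k \<omega> < ret_time M i (Suc k) \<omega>" by simp
  qed
  moreover have "visit_at i 1 (tau M i \<omega>) (traj \<omega>)"
  proof -
    obtain n where "0 < n" "fst (traj \<omega> n) = i" using ex[of 0] by (auto simp: traj_def)
    from visit_at_first[of n "traj \<omega>" i, OF this] show ?thesis by (simp add: traj_def)
  qed
  ultimately show ?case by (simp add: filterlim_subseq)
qed

lemma asum_tau_measurable[measurable]:
  assumes [measurable]: "v \<in> borel_measurable borel"
  shows "(\<lambda>\<omega>. asum v (tau M i \<omega>) \<omega>) \<in> borel_measurable (P j)"
proof -
  have "tau M i = (\<lambda>\<omega>. LEAST m. 0 < m \<and> M m \<omega> = i)" by (simp add: fun_eq_iff)
  then have [measurable]: "tau M i \<in> measurable (P j) (count_space UNIV)" by simp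
  show ?thesis by (rule measurable_compose_countable) measurable
qed

lemma AE_asum_tau:
  assumes nonneg: "\<And>x. 0 \<le> v x"
  shows "AE \<omega> in P i. asum v (tau M i \<omega>) \<omega> = cycR v i 0 \<omega>"
  using AE_ret_time[of i]
proof eventually_elim
  case (elim \<omega>)
  then have "visit_at i 1 (tau M i \<omega>) (traj \<omega>)" by blast
  from sum_cycR[where v=v, OF this nonneg] show ?case by simp
qed

lemma integrable_asum_tau:
  assumes v[measurable]: "v \<in> borel_measurable borel" and nonneg: "\<And>x. 0 \<le> v x"
  shows "integrable (P i) (\<lambda>\<omega>. asum v (tau M i \<omega>) \<omega>) \<longleftrightarrow> Epi v < \<infinity>"
proof -
  have "integrable (P i) (\<lambda>\<omega>. asum v (tau M i \<omega>) \<omega>) \<longleftrightarrow> integrable (P i) (cycR v i 0)"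
    using AE_asum_tau[OF nonneg] by (intro integrable_cong_AE) auto
  also have "\<dots> \<longleftrightarrow> Epi v < \<infinity>"
  proof
    assume "integrable (P i) (cycR v i 0)"
    then have "(\<integral>\<^sup>+\<omega>. ennreal (cycR v i 0 \<omega>) \<partial>P i) = ennreal (expectation i (cycR v i 0))"
      using cycR_nonneg by (intro nn_integral_eq_integral) auto
    then show "Epi v < \<infinity>"
      unfolding nn_integral_cycR[OF v nonneg, of i, symmetric] by (simp add: ennreal_mult_less_top)
  qed (rule cycR_integrable[OF v nonneg])
  finally show ?thesis .
qed

lemma expectation_asum_tau:
  assumes v[measurable]: "v \<in> borel_measurable borel" and nonneg: "\<And>x. 0 \<le> v x" and fin: "Epi v < \<infinity>"
  shows "expectation i (\<lambda>\<omega>. asum v (tau M i \<omega>) \<omega>) = enn2real (Epi v) / \<pi> i"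
proof -
  have "expectation i (\<lambda>\<omega>. asum v (tau M i \<omega>) \<omega>) = expectation i (cycR v i 0)"
    using AE_asum_tau[OF nonneg] by (intro integral_cong_AE) auto
  then show ?thesis by (simp add: cycR_integrable(2)[OF assms])
qed

text \<open>The full sequence of averages always has a limit in the extended half-line, namely
  \<open>Epi v\<close>, so a finite limit along any subsequence identifies it. The subsequence may
  depend on the path, as return times do, and a single initial state is enough.\<close>

lemma subsequence_limit_imp_Epi:
  assumes v: "v \<in> borel_measurable borel" and nonneg: "\<And>x. 0 \<le> v x"
    and lim: "AE \<omega> in P i. \<exists>t. filterlim t at_top sequentially \<and> (\<lambda>n. asum v (t n) \<omega> / real (t n)) \<longlonglongrightarrow> L"
  shows "Epi v < \<infinity>" and "enn2real (Epi v) = L"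
proof -
  show fin: "Epi v < \<infinity>"
  proof (rule ccontr)
    assume "\<not> Epi v < \<infinity>"
    then have "Epi v = \<infinity>" by (simp add: not_less top.extremum_unique)
    from AE_asum_at_top[OF v nonneg this, of i] lim have "AE \<omega> in P i. False"
    proof eventually_elim
      case (elim \<omega>)
      then obtain t where t: "filterlim t at_top sequentially" "(\<lambda>n. asum v (t n) \<omega> / real (t n)) \<longlonglongrightarrow> L"
        by blast
      have "filterlim (\<lambda>n. asum v (t n) \<omega> / real (t n)) at_top sequentially"
        by (rule filterlim_compose[OF elim(1) t(1)])
      with t(2) show False
        by (metis filterlim_at_top_imp_at_infinity not_tendsto_and_filterlim_at_infinity sequentially_bot)
    qed
    then show False by simp
  qed
  from AE_asum_tendsto[OF v nonneg fin, of i] lim have "AE \<omega> in P i. enn2real (Epi v) = L"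
  proof eventually_elim
    case (elim \<omega>)
    then obtain t where t: "filterlim t at_top sequentially" "(\<lambda>n. asum v (t n) \<omega> / real (t n)) \<longlonglongrightarrow> L"
      by blast
    have "(\<lambda>n. asum v (t n) \<omega> / real (t n)) \<longlonglongrightarrow> enn2real (Epi v)"
      by (rule filterlim_compose[OF elim(1) t(1)])
    with t(2) show ?case by (metis LIMSEQ_unique)
  qed
  then show "enn2real (Epi v) = L" by simp
qed

text \<open>\<open>quasi\<close> excludes infinity minus infinity, so the difference of the averages
  has an almost sure limit in the extended reals; \<open>neq\<close> says that this limit is not
  \<open>\<mu>\<close>. Half the distance serves as \<open>\<epsilon>\<close> for a finite
  limit.\<close>

lemma AE_eventually_away:
  assumes v: "v \<in> borel_measurable borel" "\<And>x. 0 \<le> v x" and u: "u \<in> borel_measurable borel" "\<And>x. 0 \<le> u x"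
    and quasi: "Epi u < \<infinity> \<or> Epi v < \<infinity>"
    and neq: "\<not> (Epi v < \<infinity> \<and> Epi u < \<infinity> \<and> enn2real (Epi v) - enn2real (Epi u) = \<mu>)"
  obtains \<epsilon> where "0 < \<epsilon>"
    "\<And>i. AE \<omega> in P i. \<forall>\<^sub>F n in sequentially. \<bar>(asum v n \<omega> - asum u n \<omega>) / real n - \<mu>\<bar> > \<epsilon>"
proof -
  have at_top: "filterlim (\<lambda>n. (asum g n \<omega> - asum h n \<omega>) / real n) at_top sequentially"
    if "(\<lambda>n. asum h n \<omega> / real n) \<longlonglongrightarrow> c" "filterlim (\<lambda>n. asum g n \<omega> / real n) at_top sequentially" for g h c \<omega>
    using filterlim_tendsto_add_at_top[OF tendsto_minus[OF that(1)] that(2)] by (simp add: diff_divide_distrib)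
  consider (fin) "Epi v < \<infinity>" "Epi u < \<infinity>" | (v) "Epi v = \<infinity>" "Epi u < \<infinity>" | (u) "Epi v < \<infinity>" "Epi u = \<infinity>"
  proof -
    have "Epi g = \<infinity> \<or> Epi g < \<infinity>" for g by (metis infinity_ennreal_def less_top)
    with quasi show ?thesis using that by blast
  qed
  then show thesis
  proof cases
    case fin
    define c where "c = enn2real (Epi v) - enn2real (Epi u)"
    have c: "c \<noteq> \<mu>" using neq fin by (simp add: c_def)
    show thesis
    proof (rule that[of "\<bar>c - \<mu>\<bar> / 2"])
      fix i
      show "AE \<omega> in P i. \<forall>\<^sub>F n in sequentially. \<bar>(asum v n \<omega> - asum u n \<omega>) / real n - \<mu>\<bar> > \<bar>c - \<mu>\<bar> / 2"
        using AE_asum_tendsto[OF v fin(1), of i] AE_asum_tendsto[OF u fin(2), of i]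
      proof eventually_elim
        case (elim \<omega>)
        have "(\<lambda>n. \<bar>(asum v n \<omega> - asum u n \<omega>) / real n - \<mu>\<bar>) \<longlonglongrightarrow> \<bar>c - \<mu>\<bar>"
          unfolding diff_divide_distrib c_def using elim by (intro tendsto_intros)
        then show ?case by (rule order_tendstoD) (use c in simp)
      qed
    qed (use c in simp)
  next
    case v': v
    show thesis
    \<comment> \<open>The limit is infinite, so any positive distance would do.\<close>
    proof (rule that[of 1])
      fix i
      show "AE \<omega> in P i. \<forall>\<^sub>F n in sequentially. \<bar>(asum v n \<omega> - asum u n \<omega>) / real n - \<mu>\<bar> > 1"
        using AE_asum_at_top[OF v v'(1), of i] AE_asum_tendsto[OF u v'(2), of i]
      proof eventually_elim
        case (elim \<omega>)
        from at_top[OF elim(2,1)] have "\<forall>\<^sub>F n in sequentially. \<mu> + 2 \<le> (asum v n \<omega> - asum u n \<omega>) / real n"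
          by (simp add: filterlim_at_top)
        then show ?case by eventually_elim linarith
      qed
    qed simp
  next
    case u': u
    show thesis
    proof (rule that[of 1])
      fix i
      show "AE \<omega> in P i. \<forall>\<^sub>F n in sequentially. \<bar>(asum v n \<omega> - asum u n \<omega>) / real n - \<mu>\<bar> > 1"
        using AE_asum_at_top[OF u u'(2), of i] AE_asum_tendsto[OF v u'(1), of i]
      proof eventually_elim
        case (elim \<omega>)
        from at_top[OF elim(2,1)] have "\<forall>\<^sub>F n in sequentially. 2 - \<mu> \<le> (asum u n \<omega> - asum v n \<omega>) / real n"
          by (simp add: filterlim_at_top)
        then show ?case
        proof eventually_elim
          case (elim n)
          have "(asum v n \<omega> - asum u n \<omega>) / real n = - ((asum u n \<omega> - asum v n \<omega>) / real n)"
            by (simp add: diff_divide_distrib)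
          with elim show ?case by linarith
        qed
      qed
    qed simp
  qed
qed

end

section \<open>Equivalence of the conditions\<close>

theorem theorem10p1:
  fixes P :: "'s::countable \<Rightarrow> 'w measure" and M :: "nat \<Rightarrow> 'w \<Rightarrow> 's"
    and X :: "nat \<Rightarrow> 'w \<Rightarrow> real" and p :: "'s \<Rightarrow> 's \<Rightarrow> real"
    and K :: "'s \<Rightarrow> 's \<Rightarrow> real measure" and \<pi> :: "'s \<Rightarrow> real" and \<mu> :: real
  assumes mrw: "MRW P M X p K"
    and irr: "irreducible_chain P M"
    and posrec: "positive_recurrent P M"
    and stat: "stationary_distribution p \<pi>"
  defines "a \<equiv> EposX1 P \<pi> X < \<infinity> \<and> EnegX1 P \<pi> X < \<infinity> \<and> enn2real (EposX1 P \<pi> X) - enn2real (EnegX1 P \<pi> X) = \<mu>"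
    and "b \<equiv> (\<forall>i. AE \<omega> in P i. (\<lambda>n. Ssum X n \<omega> / real n) \<longlonglongrightarrow> \<mu>)
              \<and> (EnegX1 P \<pi> X < \<infinity> \<or> EposX1 P \<pi> X < \<infinity>)"
    and "c \<equiv> (\<exists>mp mm. mp - mm = \<mu> \<and>
              (\<forall>i. AE \<omega> in P i. (\<lambda>n. Sminus X n \<omega> / real n) \<longlonglongrightarrow> mm
                               \<and> (\<lambda>n. Splus X n \<omega> / real n) \<longlonglongrightarrow> mp))"
    and "d \<equiv> (\<lambda>i. \<exists>mp mm. mp - mm = \<mu> \<and>
              (AE \<omega> in P i.
                 (\<lambda>n. Sminus X (ret_time M i n \<omega>) \<omega> / real (ret_time M i n \<omega>)) \<longlonglongrightarrow> mm
               \<and> (\<lambda>n. Splus X (ret_time M i n \<omega>) \<omega> / real (ret_time M i n \<omega>)) \<longlonglongrightarrow> mp))"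
    and "e \<equiv> (\<lambda>i. integrable (P i) (\<lambda>\<omega>. Sminus X (tau M i \<omega>) \<omega>)
              \<and> integrable (P i) (\<lambda>\<omega>. Splus X (tau M i \<omega>) \<omega>)
              \<and> (\<integral>\<omega>. Ssum X (tau M i \<omega>) \<omega> \<partial>P i) = \<mu> / \<pi> i)"
    and "f \<equiv> (\<lambda>i. \<forall>\<epsilon>>0. summable (\<lambda>n. (1 / real n) *
              measure (P i) {\<omega> \<in> space (P i). \<bar>Ssum X n \<omega> / real n - \<mu>\<bar> > \<epsilon>}))"
  shows "(a \<longleftrightarrow> b) \<and> (a \<longleftrightarrow> c)
       \<and> (a \<longleftrightarrow> (\<exists>i. d i)) \<and> (a \<longleftrightarrow> (\<forall>i. d i))
       \<and> (a \<longleftrightarrow> (\<exists>i. e i)) \<and> (a \<longleftrightarrow> (\<forall>i. e i))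
       \<and> (a \<longleftrightarrow> (EnegX1 P \<pi> X < \<infinity> \<or> EposX1 P \<pi> X < \<infinity>) \<and> (\<exists>i. f i))
       \<and> (a \<longleftrightarrow> (EnegX1 P \<pi> X < \<infinity> \<or> EposX1 P \<pi> X < \<infinity>) \<and> (\<forall>i. f i))"
proof -
  interpret stationary_mrw P M X p K \<pi>
    using mrw irr posrec stat by unfold_locales (auto simp: positive_recurrent_def)
  define vp :: "real \<Rightarrow> real" where "vp x = max x 0" for x
  define vm :: "real \<Rightarrow> real" where "vm x = max (- x) 0" for x
  have vp: "vp \<in> borel_measurable borel" "\<And>x. 0 \<le> vp x" and vm: "vm \<in> borel_measurable borel" "\<And>x. 0 \<le> vm x"
    by (simp_all add: vp_def[abs_def] vm_def[abs_def])
  note [measurable] = vp(1) vm(1)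
  define ep em where "ep = Epi vp" and "em = Epi vm"
  have pos: "EposX1 P \<pi> X = ep" and neg: "EnegX1 P \<pi> X = em"
    unfolding ep_def em_def vp_def vm_def by (rule refl)+
  have Sp: "Splus X = asum vp" and Sm: "Sminus X = asum vm"
    by (simp_all add: fun_eq_iff Splus_def Sminus_def asum_def vp_def vm_def)
  have S: "Ssum X n \<omega> = asum vp n \<omega> - asum vm n \<omega>" for n \<omega>
    unfolding Ssum_def asum_def sum_subtractf[symmetric]
    by (intro sum.cong) (auto simp: vp_def vm_def max_def)
  have a_iff: "a \<longleftrightarrow> ep < \<infinity> \<and> em < \<infinity> \<and> enn2real ep - enn2real em = \<mu>"
    unfolding a_def pos neg ..
  have lim_p: "AE \<omega> in P i. (\<lambda>n. asum vp n \<omega> / real n) \<longlonglongrightarrow> enn2real ep"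
    and lim_m: "AE \<omega> in P i. (\<lambda>n. asum vm n \<omega> / real n) \<longlonglongrightarrow> enn2real em" if a for i
    using that AE_asum_tendsto[OF vp] AE_asum_tendsto[OF vm] unfolding a_iff ep_def em_def by blast+
  have ab: b if a
  proof -
    have "AE \<omega> in P i. (\<lambda>n. Ssum X n \<omega> / real n) \<longlonglongrightarrow> \<mu>" for i
      using lim_p[OF that, of i] lim_m[OF that, of i]
    proof eventually_elim
      case (elim \<omega>)
      from tendsto_diff[OF elim] show ?case using that by (simp add: S diff_divide_distrib a_iff)
    qed
    then show b using that unfolding b_def a_iff pos neg by blast
  qed
  have ac: c if a
    unfolding c_def Sp Sm
  proof (intro exI conjI allI)
    show "enn2real ep - enn2real em = \<mu>" using that a_iff by blast
    show "AE \<omega> in P i. (\<lambda>n. asum vm n \<omega> / real n) \<longlonglongrightarrow> enn2real em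
        \<and> (\<lambda>n. asum vp n \<omega> / real n) \<longlonglongrightarrow> enn2real ep" for i
      using lim_p[OF that, of i] lim_m[OF that, of i] by eventually_elim blast
  qed
  have ad: "d i" if a for i
    unfolding d_def Sp Sm
  proof (intro exI conjI)
    show "enn2real ep - enn2real em = \<mu>" using that a_iff by blast
    show "AE \<omega> in P i. (\<lambda>n. asum vm (ret_time M i n \<omega>) \<omega> / real (ret_time M i n \<omega>)) \<longlonglongrightarrow> enn2real em
        \<and> (\<lambda>n. asum vp (ret_time M i n \<omega>) \<omega> / real (ret_time M i n \<omega>)) \<longlonglongrightarrow> enn2real ep"
      using lim_p[OF that, of i] lim_m[OF that, of i] AE_ret_time[of i]
    proof eventually_elim
      case (elim \<omega>)
      then have "filterlim (\<lambda>k. ret_time M i k \<omega>) at_top sequentially" by blast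
      from filterlim_compose[OF elim(1) this] filterlim_compose[OF elim(2) this] show ?case by blast
    qed
  qed
  \<comment> \<open>The integrability conditions are exactly the finiteness of \<open>ep\<close> and
    \<open>em\<close>; the mean is then compared after cancelling \<open>\<pi> i > 0\<close>. As
    this holds for each \<open>i\<close>, the versions for some and for all states are settled
    together.\<close>
  have e_iff: "e i \<longleftrightarrow> a" for i
  proof -
    have "(\<integral>\<omega>. Ssum X (tau M i \<omega>) \<omega> \<partial>P i) = (enn2real ep - enn2real em) / \<pi> i"
      if "ep < \<infinity>" "em < \<infinity>"
      unfolding S using that integrable_asum_tau[OF vp] integrable_asum_tau[OF vm]
        expectation_asum_tau[OF vp] expectation_asum_tau[OF vm]
      by (simp add: ep_def em_def diff_divide_distrib)
    then show ?thesis
      unfolding e_def a_iff Sp Sm integrable_asum_tau[OF vp] integrable_asum_tau[OF vm] ep_def[symmetric] em_def[symmetric]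
      using pi_pos[of i] by auto
  qed
  have af: "f i" if a for i
    unfolding f_def
  proof (intro allI impI)
    fix \<epsilon> :: real assume "0 < \<epsilon>"
    then have \<epsilon>: "0 < \<epsilon> / 2" by simp
    let ?D = "\<lambda>v x n. {\<omega> \<in> space (P i). \<bar>asum v n \<omega> / real n - enn2real x\<bar> > \<epsilon> / 2}"
    let ?E = "\<lambda>n. {\<omega> \<in> space (P i). \<bar>Ssum X n \<omega> / real n - \<mu>\<bar> > \<epsilon>}"
    have fin: "Epi vp < \<infinity>" "Epi vm < \<infinity>" and \<mu>: "enn2real ep - enn2real em = \<mu>"
      using that unfolding a_iff ep_def em_def by auto
    have "summable (\<lambda>n. 1 / real n * prob i (?D vp ep n) + 1 / real n * prob i (?D vm em n))"
      unfolding ep_def em_def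
      by (intro summable_add summable_deviations vp vm fin \<epsilon>)
    then show "summable (\<lambda>n. 1 / real n * prob i (?E n))"
    proof (rule summable_comparison_test')
      fix n :: nat
      have sub: "?E n \<subseteq> ?D vp ep n \<union> ?D vm em n"
      proof
        fix \<omega> assume w: "\<omega> \<in> ?E n"
        have "Ssum X n \<omega> / real n - \<mu> = (asum vp n \<omega> / real n - enn2real ep) - (asum vm n \<omega> / real n - enn2real em)"
          unfolding S \<mu>[symmetric] by (simp add: diff_divide_distrib)
        moreover have "\<bar>Ssum X n \<omega> / real n - \<mu>\<bar> > \<epsilon>" "\<omega> \<in> space (P i)" using w by auto
        ultimately have "\<bar>asum vp n \<omega> / real n - enn2real ep\<bar> > \<epsilon> / 2 \<or> \<bar>asum vm n \<omega> / real n - enn2real em\<bar> > \<epsilon> / 2"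
          by linarith
        then show "\<omega> \<in> ?D vp ep n \<union> ?D vm em n" using \<open>\<omega> \<in> space (P i)\<close> by blast
      qed
      have "prob i (?E n) \<le> prob i (?D vp ep n \<union> ?D vm em n)"
        by (rule finite_measure_mono[OF sub]) measurable
      also have "\<dots> \<le> prob i (?D vp ep n) + prob i (?D vm em n)" by (rule measure_Un_le) measurable
      finally have "1 / real n * prob i (?E n) \<le> 1 / real n * (prob i (?D vp ep n) + prob i (?D vm em n))"
        by (intro mult_left_mono) auto
      then show "norm (1 / real n * prob i (?E n)) \<le> 1 / real n * prob i (?D vp ep n) + 1 / real n * prob i (?D vm em n)"
        by (simp add: distrib_left add_divide_distrib)
    qed
  qed
  \<comment> \<open>A common form of (c) and (d): \<open>t\<close> will be the identity or the
    return times, hence it is quantified inside \<open>AE\<close>.\<close>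
  have limits_imp_a: a if "mp - mm = \<mu>"
    and lim: "AE \<omega> in P i. \<exists>t. filterlim t at_top sequentially \<and> (\<lambda>n. asum vm (t n) \<omega> / real (t n)) \<longlonglongrightarrow> mm
      \<and> (\<lambda>n. asum vp (t n) \<omega> / real (t n)) \<longlonglongrightarrow> mp" for mp mm i
  proof -
    have "AE \<omega> in P i. \<exists>t. filterlim t at_top sequentially \<and> (\<lambda>n. asum vm (t n) \<omega> / real (t n)) \<longlonglongrightarrow> mm"
      using lim by eventually_elim blast
    note m = subsequence_limit_imp_Epi[OF vm this]
    have "AE \<omega> in P i. \<exists>t. filterlim t at_top sequentially \<and> (\<lambda>n. asum vp (t n) \<omega> / real (t n)) \<longlonglongrightarrow> mp"
      using lim by eventually_elim blast
    note p = subsequence_limit_imp_Epi[OF vp this]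
    show a unfolding a_iff ep_def em_def using m p that(1) by simp
  qed
  have ca: a if c
  proof -
    from that obtain mp mm where eq: "mp - mm = \<mu>" and lim: "\<And>i. AE \<omega> in P i. (\<lambda>n. asum vm n \<omega> / real n) \<longlonglongrightarrow> mm
        \<and> (\<lambda>n. asum vp n \<omega> / real n) \<longlonglongrightarrow> mp" unfolding c_def Sp Sm by blast
    \<comment> \<open>\<open>undefined\<close> merely names some state; one initial state
      suffices.\<close>
    have "AE \<omega> in P undefined. \<exists>t. filterlim t at_top sequentially \<and> (\<lambda>n. asum vm (t n) \<omega> / real (t n)) \<longlonglongrightarrow> mm
      \<and> (\<lambda>n. asum vp (t n) \<omega> / real (t n)) \<longlonglongrightarrow> mp"
      using lim[of undefined] by eventually_elim (use filterlim_ident in blast)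
    from limits_imp_a[OF eq this] show a .
  qed
  have da: a if "d i" for i
  proof -
    from that obtain mp mm where eq: "mp - mm = \<mu>" and lim: "AE \<omega> in P i.
        (\<lambda>n. asum vm (ret_time M i n \<omega>) \<omega> / real (ret_time M i n \<omega>)) \<longlonglongrightarrow> mm
        \<and> (\<lambda>n. asum vp (ret_time M i n \<omega>) \<omega> / real (ret_time M i n \<omega>)) \<longlonglongrightarrow> mp" unfolding d_def Sp Sm by blast
    have "AE \<omega> in P i. \<exists>t. filterlim t at_top sequentially \<and> (\<lambda>n. asum vm (t n) \<omega> / real (t n)) \<longlonglongrightarrow> mm
      \<and> (\<lambda>n. asum vp (t n) \<omega> / real (t n)) \<longlonglongrightarrow> mp"
      using lim AE_ret_time[of i] by eventually_elim blast
    from limits_imp_a[OF eq this] show a .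
  qed
  \<comment> \<open>This serves both remaining converses: the same eventual distance contradicts the
    limit in (b) and, through the harmonic series, the summability in (f).\<close>
  have away: "\<exists>\<epsilon>>0. \<forall>i. AE \<omega> in P i. \<forall>\<^sub>F n in sequentially. \<bar>Ssum X n \<omega> / real n - \<mu>\<bar> > \<epsilon>"
    if "em < \<infinity> \<or> ep < \<infinity>" "\<not> a"
    unfolding S
    by (rule AE_eventually_away[OF vp vm, of \<mu>]) (use that in \<open>auto simp: a_iff ep_def em_def\<close>)
  have ba: a if b
  proof (rule ccontr)
    assume "\<not> a"
    with that away obtain \<epsilon> where \<epsilon>: "\<epsilon> > 0"
      and ev: "\<And>i. AE \<omega> in P i. \<forall>\<^sub>F n in sequentially. \<bar>Ssum X n \<omega> / real n - \<mu>\<bar> > \<epsilon>"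
      unfolding b_def pos neg by blast
    have "AE \<omega> in P undefined. (\<lambda>n. Ssum X n \<omega> / real n) \<longlonglongrightarrow> \<mu>" using that unfolding b_def by blast
    with ev[of undefined] have "AE \<omega> in P undefined. False"
    proof eventually_elim
      case (elim \<omega>)
      from tendstoD[OF elim(2) \<epsilon>] elim(1) have "\<forall>\<^sub>F n in sequentially. False"
        by eventually_elim (simp add: dist_real_def)
      then show False by simp
    qed
    then show False by simp
  qed
  have fa: a if quasi: "em < \<infinity> \<or> ep < \<infinity>" and "f i" for i
  proof (rule ccontr)
    assume "\<not> a"
    with quasi away obtain \<epsilon> where \<epsilon>: "\<epsilon> > 0"
      and ev: "\<And>i. AE \<omega> in P i. \<forall>\<^sub>F n in sequentially. \<bar>Ssum X n \<omega> / real n - \<mu>\<bar> > \<epsilon>" by blast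
    have "\<not> summable (\<lambda>n. 1 / real n * prob i {\<omega> \<in> space (P i). \<bar>Ssum X n \<omega> / real n - \<mu>\<bar> > \<epsilon>})"
    proof (rule not_summable_weighted_prob)
      show "AE \<omega> in P i. \<forall>\<^sub>F n in sequentially. \<omega> \<in> {\<omega> \<in> space (P i). \<bar>Ssum X n \<omega> / real n - \<mu>\<bar> > \<epsilon>}"
        using ev[of i] AE_space by eventually_elim simp
    qed (simp add: S)
    with \<open>f i\<close> \<epsilon> show False unfolding f_def by blast
  qed
  have quasi: "em < \<infinity> \<or> ep < \<infinity>" if a using that a_iff by blast
  show ?thesis
    unfolding pos neg using ab ba ac ca ad da e_iff af fa quasi by blast
qed

end
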